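(* Let $(M,g_M)$ be a complete non-positively curved Ricci surface, biholomorphic to $\mathbb{C}\setminus\{0\}$, with two catenoidal ends (that is, both punctures $0$ and $\infty$ are catenoidal ends). Then $(M,g_M)$ is isometric to one of the following surfaces, each being $\mathbb{C}\setminus\{0\}$ with the metric determined by the indicated Weierstrass data: (1) a catenoid: $g=z,\ \eta=a z^{-2}dz$, with $a\in\mathbb{R}$, $a>0$; (2) a catenoid cousin: $g=z^{\mu},\ \eta=a z^{-\mu-1}dz$, with $a,\mu\in\mathbb{R}$, $a>0$, $\mu>0$, $\mu\neq 1$; (3) the surface given by $g=z^{n}+a,\ \eta=b z^{-n-1}dz$, with $a,b\in\mathbb{R}$, $a>0$, $b>0$, and $n\in\mathbb{N}$, $n\ge 1$. Moreover, all these surfaces (over all three families and all values of the parameters) are mutually non-isometric.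
   Context: Ricci surface: an orientable Riemannian surface $(M,g_M)$ whose Gauss curvature $K$ satisfies $K\Delta K+g_M(dK,dK)+4K^3=0$, where $\Delta=-\mathrm{div}\,\mathrm{grad}$ is the nonnegative Laplacian. It is non-positively curved if $K\le 0$. $M$ is regarded as a Riemann surface through the conformal class of $g_M$ and an orientation. Its total curvature is $\int_M K\,dA$. Weierstrass data: let $\pi:\tilde M\to M$ be the universal cover of a non-positively curved Ricci surface. There are a meromorphic function $g$ and a holomorphic 1-form $\eta$ (locally $\eta=\alpha\,dz$) on $\tilde M$, where $\eta$ has a zero of order $2m$ at each pole of $g$ of order $m$ and no other zeros, such that $\pi^*g_M=\frac14|\alpha|^2(1+|g|^2)^2|dz|^2$. The pair $(g,\eta)$ is called the Weierstrass data of $M$; it is unique up to $\eta\mapsto e^{i\theta}\eta$ and up to $(g,\eta)\mapsto(\tilde g,\tilde\eta)$ with $\tilde g=\sigma\cdot g$ ($\sigma\in PSU(2)$ acting by Möbius transformations) and $\tilde\eta=Q/d\tilde g$, where $Q:=dg\otimes\eta$ is the Hopf differential. Thus $Q$ is a holomorphic quadratic differential on $\tilde M$, unique up to a factor $e^{i\theta}$. Catenoidal end: suppose $M$ has finite total curvature and is biholomorphic to $S_k\setminus\{p_1,\dots,p_r\}$, with $S_k$ a compact Riemann surface of genus $k$. The puncture $p_i$ is a catenoidal end if it has a neighbourhood on which $Q$ is well defined (i.e. $Q$ is single-valued on the punctured neighbourhood, descending from the universal cover) and meromorphic, with $\mathrm{ord}_{p_i}Q=-2$ (a pole of order exactly 2).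 In particular, having catenoidal ends includes the assumption of finite total curvature. The surface determined by (possibly multivalued) Weierstrass data $g$, $\eta=\alpha\,dz$ on $\mathbb{C}\setminus\{0\}$ is $\mathbb{C}\setminus\{0\}$ with the (single-valued) metric $\frac14|\alpha|^2(1+|g|^2)^2|dz|^2$. *)

theory Defs
  imports "HOL-Complex_Analysis.Complex_Analysis"
begin

section \<open>Calculus in one coordinate patch\<close>

text \<open>The coordinate plane is \<^typ>\<open>complex\<close>, regarded as a real plane with basis 1, i.
  Coordinate functions only matter on the open set under consideration, and
  all derivatives are real (Frechet) derivatives.\<close>

definition pd :: "complex \<Rightarrow> (complex \<Rightarrow> 'b::real_normed_vector) \<Rightarrow> complex \<Rightarrow> 'b" where
  "pd e f x = frechet_derivative f (at x) e"

abbreviation coord_basis :: "complex set" where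
  "coord_basis \<equiv> {1, \<i>}"

primrec Ck_on :: "nat \<Rightarrow> complex set \<Rightarrow> (complex \<Rightarrow> 'b::real_normed_vector) \<Rightarrow> bool" where
  "Ck_on 0 X f \<longleftrightarrow> continuous_on X f"
| "Ck_on (Suc k) X f \<longleftrightarrow>
     (\<forall>x\<in>X. f differentiable (at x)) \<and> (\<forall>e\<in>coord_basis. Ck_on k X (pd e f))"

definition smooth_on :: "complex set \<Rightarrow> (complex \<Rightarrow> 'b::real_normed_vector) \<Rightarrow> bool" where
  "smooth_on X f \<longleftrightarrow> (\<forall>k. Ck_on k X f)"

text \<open>The Jacobian determinant of a plane map.\<close>

definition jac_det :: "(complex \<Rightarrow> complex) \<Rightarrow> complex \<Rightarrow> real" where
  "jac_det f x = Re (pd 1 f x) * Im (pd \<i> f x) - Im (pd 1 f x) * Re (pd \<i> f x)"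

text \<open>A Riemannian metric in coordinates: at each point a bilinear form on the plane. Its
  coefficients are \<open>G x i j\<close> for i, j in the coordinate basis.\<close>

type_synonym metric_tensor = "complex \<Rightarrow> complex \<Rightarrow> complex \<Rightarrow> real"

definition metric_det :: "metric_tensor \<Rightarrow> complex \<Rightarrow> real" where
  "metric_det G x = G x 1 1 * G x \<i> \<i> - G x 1 \<i> * G x \<i> 1"

text \<open>The coefficients of the inverse matrix; only used for i, j in the coordinate basis.\<close>

definition metric_inv :: "metric_tensor \<Rightarrow> metric_tensor" where
  "metric_inv G x i j =
     (if i = j then G x (if i = 1 then \<i> else 1) (if i = 1 then \<i> else 1) else - G x i j)
       / metric_det G x"

text \<open>\<open>christoffel G l i j\<close> is the Christoffel symbol with upper index l and lower indices i, j.\<close>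

definition christoffel ::
    "metric_tensor \<Rightarrow> complex \<Rightarrow> complex \<Rightarrow> complex \<Rightarrow> complex \<Rightarrow> real" where
  "christoffel G l i j x = (\<Sum>m\<in>coord_basis. metric_inv G x l m *
      (pd i (\<lambda>y. G y j m) x + pd j (\<lambda>y. G y i m) x - pd m (\<lambda>y. G y i j) x)) / 2"

text \<open>The component l of \<open>R(1,i)i\<close>, where R is the curvature tensor of the Levi-Civita
  connection, \<open>R(X,Y)Z = \<nabla>X \<nabla>Y Z - \<nabla>Y \<nabla>X Z - \<nabla>[X,Y] Z\<close>.\<close>

definition curvature_component :: "metric_tensor \<Rightarrow> complex \<Rightarrow> complex \<Rightarrow> real" where
  "curvature_component G l x =
     pd 1 (christoffel G l \<i> \<i>) x - pd \<i> (christoffel G l 1 \<i>) x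
     + (\<Sum>m\<in>coord_basis. christoffel G m \<i> \<i> x * christoffel G l 1 m x
                         - christoffel G m 1 \<i> x * christoffel G l \<i> m x)"

definition gauss_coord :: "metric_tensor \<Rightarrow> complex \<Rightarrow> real" where
  "gauss_coord G x = (\<Sum>l\<in>coord_basis. G x l 1 * curvature_component G l x) / metric_det G x"

text \<open>The nonnegative Laplacian, i.e. minus the divergence of the gradient.\<close>

definition laplacian_coord :: "metric_tensor \<Rightarrow> (complex \<Rightarrow> real) \<Rightarrow> complex \<Rightarrow> real" where
  "laplacian_coord G f x = - (\<Sum>i\<in>coord_basis.
      pd i (\<lambda>y. sqrt (metric_det G y) * (\<Sum>j\<in>coord_basis. metric_inv G y i j * pd j f y)) x)
      / sqrt (metric_det G x)"

definition differential_sq :: "metric_tensor \<Rightarrow> (complex \<Rightarrow> real) \<Rightarrow> complex \<Rightarrow> real" where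
  "differential_sq G f x =
     (\<Sum>i\<in>coord_basis. \<Sum>j\<in>coord_basis. metric_inv G x i j * pd i f x * pd j f x)"


section \<open>Oriented Riemannian surfaces\<close>

text \<open>A chart consists of its domain and its coordinate map; the values of the coordinate map
  outside the domain are irrelevant. The field \<open>met\<close> gives the expression of the metric in each
  chart, as a function of the coordinate point.\<close>

type_synonym 'a chart = "'a set \<times> ('a \<Rightarrow> complex)"

record 'a surface =
  pts :: "'a set"
  atlas :: "'a chart set"
  met :: "'a chart \<Rightarrow> metric_tensor"

abbreviation dom_of :: "'a chart \<Rightarrow> 'a set" where "dom_of c \<equiv> fst c"
abbreviation coord_of :: "'a chart \<Rightarrow> 'a \<Rightarrow> complex" where "coord_of c \<equiv> snd c"
abbreviation range_of :: "'a chart \<Rightarrow> complex set" where "range_of c \<equiv> coord_of c ` dom_of c"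

definition param_of :: "'a chart \<Rightarrow> complex \<Rightarrow> 'a" where
  "param_of c = inv_into (dom_of c) (coord_of c)"

definition coordinate_patch :: "'a::topological_space set \<Rightarrow> 'a chart \<Rightarrow> bool" where
  "coordinate_patch M c \<longleftrightarrow> openin (top_of_set M) (dom_of c) \<and> open (range_of c) \<and>
     homeomorphism (dom_of c) (range_of c) (coord_of c) (param_of c)"

definition transition :: "'a chart \<Rightarrow> 'a chart \<Rightarrow> complex \<Rightarrow> complex" where
  "transition c d = coord_of d \<circ> param_of c"

text \<open>The condition on the transition map from c to d; it has to be imposed in both directions.\<close>

definition oriented_compatible :: "'a chart \<Rightarrow> 'a chart \<Rightarrow> bool" where
  "oriented_compatible c d \<longleftrightarrow>
     smooth_on (coord_of c ` (dom_of c \<inter> dom_of d)) (transition c d) \<and>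
     (\<forall>x \<in> coord_of c ` (dom_of c \<inter> dom_of d). jac_det (transition c d) x > 0)"

text \<open>The atlas of a surface is the maximal oriented smooth atlas. The space is Hausdorff and second
  countable by the sort of its elements.\<close>

definition riemannian_surface ::
    "'a::{t2_space,second_countable_topology} surface \<Rightarrow> bool" where
  "riemannian_surface S \<longleftrightarrow>
     pts S \<noteq> {} \<and> connected (pts S) \<and>
     (\<forall>c\<in>atlas S. coordinate_patch (pts S) c) \<and>
     (\<Union>c\<in>atlas S. dom_of c) = pts S \<and>
     (\<forall>c\<in>atlas S. \<forall>d\<in>atlas S. oriented_compatible c d) \<and>
     (\<forall>c. coordinate_patch (pts S) c \<and>
          (\<forall>d\<in>atlas S. oriented_compatible c d \<and> oriented_compatible d c) \<longrightarrow> c \<in> atlas S) \<and>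
     (\<forall>c\<in>atlas S. \<forall>x\<in>range_of c. bilinear (met S c x) \<and>
          (\<forall>u v. met S c x u v = met S c x v u) \<and> (\<forall>v. v \<noteq> 0 \<longrightarrow> met S c x v v > 0)) \<and>
     (\<forall>c\<in>atlas S. \<forall>u v. smooth_on (range_of c) (\<lambda>x. met S c x u v)) \<and>
     (\<forall>c\<in>atlas S. \<forall>d\<in>atlas S. \<forall>x \<in> coord_of c ` (dom_of c \<inter> dom_of d). \<forall>u v.
          met S c x u v =
          met S d (transition c d x) (pd u (transition c d) x) (pd v (transition c d) x))"

text \<open>K is the Gauss curvature if it has the right expression in every chart.\<close>

definition gauss_curvature :: "'a surface \<Rightarrow> ('a \<Rightarrow> real) \<Rightarrow> bool" where
  "gauss_curvature S K \<longleftrightarrow>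
     (\<forall>c\<in>atlas S. \<forall>p\<in>dom_of c. K p = gauss_coord (met S c) (coord_of c p))"

definition ricci_surface :: "'a::{t2_space,second_countable_topology} surface \<Rightarrow> bool" where
  "ricci_surface S \<longleftrightarrow> riemannian_surface S \<and>
     (\<exists>K. gauss_curvature S K \<and>
        (\<forall>c\<in>atlas S. \<forall>x\<in>range_of c.
           (let k = K \<circ> param_of c in
             k x * laplacian_coord (met S c) k x + differential_sq (met S c) k x + 4 * k x ^ 3 = 0)))"

definition nonpositively_curved :: "'a surface \<Rightarrow> bool" where
  "nonpositively_curved S \<longleftrightarrow> (\<exists>K. gauss_curvature S K \<and> (\<forall>p\<in>pts S. K p \<le> 0))"

definition area_measure :: "'a::topological_space surface \<Rightarrow> 'a measure \<Rightarrow> bool" where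
  "area_measure S A \<longleftrightarrow> sets A = sets (restrict_space borel (pts S)) \<and>
     (\<forall>c\<in>atlas S. \<forall>B\<in>sets A. B \<subseteq> dom_of c \<longrightarrow>
        emeasure A B = (\<integral>\<^sup>+x\<in>coord_of c ` B. ennreal (sqrt (metric_det (met S c) x)) \<partial>lborel))"

definition finite_total_curvature :: "'a::topological_space surface \<Rightarrow> bool" where
  "finite_total_curvature S \<longleftrightarrow>
     (\<exists>A K. area_measure S A \<and> gauss_curvature S K \<and> integrable A K)"


section \<open>Completeness\<close>

text \<open>The speed does not depend on the chart at parameters where the curve is differentiable.\<close>

definition speed :: "'a surface \<Rightarrow> (real \<Rightarrow> 'a) \<Rightarrow> real \<Rightarrow> real" where
  "speed S \<gamma> t =
     (let c = (SOME c. c \<in> atlas S \<and> \<gamma> t \<in> dom_of c);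
          v = vector_derivative (coord_of c \<circ> \<gamma>) (at t)
      in sqrt (met S c (coord_of c (\<gamma> t)) v v))"

text \<open>The library's piecewise C1 curves may have unbounded derivative near an exceptional
  parameter, so finite length is required explicitly.\<close>

definition rectifiable_curve :: "'a::topological_space surface \<Rightarrow> (real \<Rightarrow> 'a) \<Rightarrow> bool" where
  "rectifiable_curve S \<gamma> \<longleftrightarrow> path \<gamma> \<and> path_image \<gamma> \<subseteq> pts S \<and>
     (\<forall>c\<in>atlas S. \<forall>a b. 0 \<le> a \<and> a < b \<and> b \<le> 1 \<and> \<gamma> ` {a..b} \<subseteq> dom_of c \<longrightarrow>
        (coord_of c \<circ> \<gamma>) piecewise_C1_differentiable_on {a..b}) \<and>
     speed S \<gamma> integrable_on {0..1}"

definition riem_dist :: "'a::topological_space surface \<Rightarrow> 'a \<Rightarrow> 'a \<Rightarrow> real" where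
  "riem_dist S p q = Inf {integral {0..1} (speed S \<gamma>) | \<gamma>.
     rectifiable_curve S \<gamma> \<and> pathstart \<gamma> = p \<and> pathfinish \<gamma> = q}"

definition complete_surface :: "'a::topological_space surface \<Rightarrow> bool" where
  "complete_surface S \<longleftrightarrow>
     (\<forall>s::nat \<Rightarrow> 'a. range s \<subseteq> pts S \<and>
        (\<forall>e>0. \<exists>N. \<forall>m\<ge>N. \<forall>n\<ge>N. riem_dist S (s m) (s n) < e) \<longrightarrow>
        (\<exists>p\<in>pts S. (\<lambda>n. riem_dist S (s n) p) \<longlonglongrightarrow> 0))"


section \<open>Isometries\<close>

definition smooth_map ::
    "'a::topological_space surface \<Rightarrow> 'b::topological_space surface \<Rightarrow> ('a \<Rightarrow> 'b) \<Rightarrow> bool" where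
  "smooth_map S T F \<longleftrightarrow> continuous_on (pts S) F \<and> F ` pts S \<subseteq> pts T \<and>
     (\<forall>c\<in>atlas S. \<forall>d\<in>atlas T.
        smooth_on (coord_of c ` (dom_of c \<inter> F -` dom_of d)) (coord_of d \<circ> F \<circ> param_of c))"

definition metric_preserving :: "'a surface \<Rightarrow> 'b surface \<Rightarrow> ('a \<Rightarrow> 'b) \<Rightarrow> bool" where
  "metric_preserving S T F \<longleftrightarrow>
     (\<forall>c\<in>atlas S. \<forall>d\<in>atlas T. \<forall>x \<in> coord_of c ` (dom_of c \<inter> F -` dom_of d). \<forall>u v.
        let f = coord_of d \<circ> F \<circ> param_of c
        in met S c x u v = met T d (f x) (pd u f x) (pd v f x))"

text \<open>Isometries are not required to preserve the orientations.\<close>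

definition isometric ::
    "'a::topological_space surface \<Rightarrow> 'b::topological_space surface \<Rightarrow> bool" where
  "isometric S T \<longleftrightarrow> (\<exists>F F'. smooth_map S T F \<and> smooth_map T S F' \<and>
     (\<forall>p\<in>pts S. F' (F p) = p) \<and> (\<forall>q\<in>pts T. F (F' q) = q) \<and> metric_preserving S T F)"


section \<open>The underlying Riemann surface\<close>

text \<open>The holomorphic charts of the Riemann surface given by the conformal class of the metric and
  the orientation are the positively oriented charts in which the metric is conformal to the
  Euclidean one.\<close>

definition holomorphic_charts :: "'a surface \<Rightarrow> 'a chart set" where
  "holomorphic_charts S =
     {c\<in>atlas S. \<exists>\<rho>. \<forall>x\<in>range_of c. \<forall>u v. met S c x u v = \<rho> x * (u \<bullet> v)}"

text \<open>A biholomorphic map of an open part U of the surface onto a plane domain is the same thing as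
  a holomorphic chart with domain U.\<close>

definition biholomorphic_onto ::
    "'a surface \<Rightarrow> 'a set \<Rightarrow> ('a \<Rightarrow> complex) \<Rightarrow> complex set \<Rightarrow> bool" where
  "biholomorphic_onto S U \<Phi> D \<longleftrightarrow> (U, \<Phi>) \<in> holomorphic_charts S \<and> \<Phi> ` U = D"

text \<open>The universal cover of a non-positively curved surface is not the sphere, so by uniformization
  it may be taken to be a simply connected plane domain.\<close>

definition universal_cover ::
    "'a::topological_space surface \<Rightarrow> complex set \<Rightarrow> (complex \<Rightarrow> 'a) \<Rightarrow> bool" where
  "universal_cover S \<Omega> \<pi> \<longleftrightarrow> open \<Omega> \<and> simply_connected \<Omega> \<and> covering_space \<Omega> \<pi> (pts S) \<and>
     (\<forall>c\<in>holomorphic_charts S. (coord_of c \<circ> \<pi>) holomorphic_on (\<Omega> \<inter> \<pi> -` dom_of c))"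


section \<open>Weierstrass data and catenoidal ends\<close>

definition weierstrass_factor ::
    "(complex \<Rightarrow> complex) \<Rightarrow> (complex \<Rightarrow> complex) \<Rightarrow> complex \<Rightarrow> real" where
  "weierstrass_factor g \<alpha> z = 1 / 4 * (cmod (\<alpha> z))\<^sup>2 * (1 + (cmod (g z))\<^sup>2)\<^sup>2"

text \<open>The holomorphic 1-form \<open>\<eta> = \<alpha> dz\<close> is represented by \<open>\<alpha>\<close>. At the (isolated) poles of g the
  formula for the pulled back metric holds by continuity, so it is only stated elsewhere.\<close>

definition weierstrass_data ::
    "'a::topological_space surface \<Rightarrow> complex set \<Rightarrow> (complex \<Rightarrow> 'a) \<Rightarrow>
     (complex \<Rightarrow> complex) \<Rightarrow> (complex \<Rightarrow> complex) \<Rightarrow> bool" where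
  "weierstrass_data S \<Omega> \<pi> g \<alpha> \<longleftrightarrow> universal_cover S \<Omega> \<pi> \<and>
     g nicely_meromorphic_on \<Omega> \<and> \<alpha> holomorphic_on \<Omega> \<and>
     (\<forall>z\<in>\<Omega>. if is_pole g z then zorder \<alpha> z = - 2 * zorder g z else \<alpha> z \<noteq> 0) \<and>
     (\<forall>c\<in>atlas S. \<forall>z \<in> \<Omega> \<inter> \<pi> -` dom_of c. \<not> is_pole g z \<longrightarrow> (\<forall>u v.
        met S c (coord_of c (\<pi> z)) (pd u (coord_of c \<circ> \<pi>) z) (pd v (coord_of c \<circ> \<pi>) z)
        = weierstrass_factor g \<alpha> z * (u \<bullet> v)))"

text \<open>A puncture is given by a map w which restricts to a holomorphic chart of a punctured
  neighbourhood of the puncture onto a punctured disc around 0. The Hopf differential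
  \<open>g' \<alpha> dz\<^sup>2\<close> is the pullback of \<open>q dw\<^sup>2\<close> on all of the preimage of this neighbourhood.\<close>

definition catenoidal_end :: "'a::topological_space surface \<Rightarrow> ('a \<Rightarrow> complex) \<Rightarrow> bool" where
  "catenoidal_end S w \<longleftrightarrow>
     (\<exists>\<Omega> \<pi> g \<alpha>. weierstrass_data S \<Omega> \<pi> g \<alpha> \<and>
       (\<exists>r>0. \<exists>q.
          biholomorphic_onto S {p\<in>pts S. 0 < cmod (w p) \<and> cmod (w p) < r} w (ball 0 r - {0}) \<and>
          q holomorphic_on (ball 0 r - {0}) \<and> is_pole q 0 \<and> zorder q 0 = -2 \<and>
          (\<forall>z\<in>\<Omega>. 0 < cmod (w (\<pi> z)) \<and> cmod (w (\<pi> z)) < r \<and> \<not> is_pole g z \<longrightarrow>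
             deriv g z * \<alpha> z = q (w (\<pi> z)) * (deriv (w \<circ> \<pi>) z)\<^sup>2)))"


section \<open>The model surfaces\<close>

text \<open>The plane domain D with the metric \<open>\<rho> |dz|\<^sup>2\<close>.\<close>

definition conformal_plane_domain :: "complex set \<Rightarrow> (complex \<Rightarrow> real) \<Rightarrow> complex surface" where
  "conformal_plane_domain D \<rho> =
     \<lparr>pts = D,
      atlas = {c. coordinate_patch D c \<and>
                  oriented_compatible c (D, \<lambda>z. z) \<and> oriented_compatible (D, \<lambda>z. z) c},
      met = (\<lambda>c x u v. \<rho> (param_of c x) * (pd u (param_of c) x \<bullet> pd v (param_of c) x))\<rparr>"

datatype model_params = Catenoid real | Catenoid_Cousin real real | Third_Family nat real real

fun admissible :: "model_params \<Rightarrow> bool" where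
  "admissible (Catenoid a) \<longleftrightarrow> a > 0"
| "admissible (Catenoid_Cousin \<mu> a) \<longleftrightarrow> a > 0 \<and> \<mu> > 0 \<and> \<mu> \<noteq> 1"
| "admissible (Third_Family n a b) \<longleftrightarrow> n \<ge> 1 \<and> a > 0 \<and> b > 0"

text \<open>For the multivalued data of the second family any branch may be used, since the metric only
  involves the moduli; \<open>powr\<close> is the principal branch.\<close>

fun model_g :: "model_params \<Rightarrow> complex \<Rightarrow> complex" where
  "model_g (Catenoid a) z = z"
| "model_g (Catenoid_Cousin \<mu> a) z = z powr of_real \<mu>"
| "model_g (Third_Family n a b) z = z ^ n + of_real a"

fun model_\<alpha> :: "model_params \<Rightarrow> complex \<Rightarrow> complex" where
  "model_\<alpha> (Catenoid a) z = of_real a * z powi (-2)"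
| "model_\<alpha> (Catenoid_Cousin \<mu> a) z = of_real a * z powr of_real (- \<mu> - 1)"
| "model_\<alpha> (Third_Family n a b) z = of_real b * z powi (- int n - 1)"

definition model_surface :: "model_params \<Rightarrow> complex surface" where
  "model_surface m =
     conformal_plane_domain (- {0}) (weierstrass_factor (model_g m) (model_\<alpha> m))"

end

theory Submission
  imports Defs
begin

text \<open>In the coordinate \<open>log z\<close> the Weierstrass data of an annulus lift to a pair of entire
  functions \<open>u, v\<close>, with \<open>g = v / u\<close>, such that the metric is determined by the periodic
  energy \<open>P = \<bar>u\<bar>\<^sup>2 + \<bar>v\<bar>\<^sup>2\<close>, and the Hopf differential is the Wronskian of the pair. \<open>P\<close>
  determines the pair up to a constant unitary matrix, hence the Wronskian up to a unit. A pole of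
  order two at each end bounds the Wronskian, so by Liouville's theorem it is a constant \<open>c \<noteq> 0\<close>.
  As \<open>\<Delta> log P = 4 \<bar>c\<bar>\<^sup>2 / P\<^sup>2\<close> is the curvature density, finite total curvature bounds the slope of
  the circle means of \<open>log P\<close>, and with the submean inequality \<open>P\<close> is of exponential growth. Then
  the periodic potential \<open>\<psi>\<close> in \<open>u'' = \<psi> u\<close>, \<open>v'' = \<psi> v\<close> is bounded at both ends, hence constant,
  and solving the equation leaves only the listed energies. Conversely an isometry of two models is
  conformal up to complex conjugation, which preserves every model; it lifts to an entire map whose
  derivative has constant modulus, and this identifies the parameters.\<close>

section \<open>Energy and Wronskian of a pair of holomorphic functions\<close>

text \<open>Neither \<open>g\<close> nor the pair \<open>u\<close>, \<open>v\<close> is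
  single-valued on the annulus: a deck translation acts on the pair by a unitary matrix, and the
  data chosen at the two ends may differ by another one. Hence the argument uses only quantities
  that can be read off P and its derivatives, such as |W| and psi = P_zz / P. The main obstacle is
  growth. The circle means control averages of ln P only, while a pointwise bound by the submean
  inequality needs averages of its positive part over discs. The two differ by at most 1 / P^2, and
  since |W| is the constant |c|, this error is a multiple of the curvature density, whose integral
  is finite. The exponential bound so obtained is what excludes an essential singularity of psi, as
  a function of exp z, at either end. Once psi is a constant s^2, periodicity of P keeps u and v
  bounded on the imaginary axis, which forces s to be real and nonzero; the exponent of the model is
  mu = 2 s. The parameters a and b are then invariants of the Gram matrix of the coefficient vectors
  of exp (s z) and exp (- s z).\<close>

definition energy :: "(complex \<Rightarrow> complex) \<Rightarrow> (complex \<Rightarrow> complex) \<Rightarrow> complex \<Rightarrow> real" where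
  "energy u v z = (cmod (u z))\<^sup>2 + (cmod (v z))\<^sup>2"

definition wronskian :: "(complex \<Rightarrow> complex) \<Rightarrow> (complex \<Rightarrow> complex) \<Rightarrow> complex \<Rightarrow> complex" where
  "wronskian u v z = u z * deriv v z - deriv u z * v z"

text \<open>This and \<open>energy_zz\<close> are the Wirtinger derivatives P_z and P_zz of P =
  \<open>energy u v\<close>: the conjugated factors are antiholomorphic and pass through as
  constants. The mixed derivative of P with respect to z and its conjugate is
  \<open>energy (deriv u) (deriv v)\<close>.\<close>

definition energy_z :: "(complex \<Rightarrow> complex) \<Rightarrow> (complex \<Rightarrow> complex) \<Rightarrow> complex \<Rightarrow> complex" where
  "energy_z u v z = deriv u z * cnj (u z) + deriv v z * cnj (v z)"

definition energy_zz :: "(complex \<Rightarrow> complex) \<Rightarrow> (complex \<Rightarrow> complex) \<Rightarrow> complex \<Rightarrow> complex" where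
  "energy_zz u v z = deriv (deriv u) z * cnj (u z) + deriv (deriv v) z * cnj (v z)"

lemma energy_nonneg [simp]: "energy u v z \<ge> 0"
  by (simp add: energy_def)

lemma norm_sq_le_energy: "(cmod (u z))\<^sup>2 \<le> energy u v z" "(cmod (v z))\<^sup>2 \<le> energy u v z"
  by (simp_all add: energy_def)

lemma energy_complex: "complex_of_real (energy u v z) = u z * cnj (u z) + v z * cnj (v z)"
  unfolding energy_def by (simp add: complex_norm_square flip: of_real_power)

text \<open>The Wronskian is the determinant of the vectors (u, v) and (u', v') of C^2, and
  \<open>energy_z\<close> is their Hermitian product. The identity is Cauchy-Schwarz with its
  defect.\<close>

lemma lagrange_identity:
  "(cmod (wronskian u v z))\<^sup>2 =
     energy u v z * energy (deriv u) (deriv v) z - (cmod (energy_z u v z))\<^sup>2"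
proof -
  have "complex_of_real ((cmod (wronskian u v z))\<^sup>2) =
     complex_of_real (energy u v z * energy (deriv u) (deriv v) z - (cmod (energy_z u v z))\<^sup>2)"
    unfolding complex_norm_square of_real_diff of_real_mult energy_complex wronskian_def energy_z_def
    by (simp add: algebra_simps)
  then show ?thesis by (simp only: of_real_eq_iff)
qed

lemma energy_pos_if_wronskian:
  assumes "wronskian u v z \<noteq> 0"
  shows "energy u v z > 0"
proof -
  have "u z \<noteq> 0 \<or> v z \<noteq> 0" using assms by (auto simp: wronskian_def)
  then show ?thesis by (auto simp: energy_def intro: add_pos_nonneg add_nonneg_pos)
qed

lemma has_derivative_holomorphic:
  assumes "f holomorphic_on X" "open X" "z \<in> X"
  shows "(f has_derivative (\<lambda>h. deriv f z * h)) (at z)"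
  using holomorphic_derivI[OF assms] by (simp add: has_field_derivative_def)

lemma has_derivative_energy_z:
  assumes u: "u holomorphic_on X" and v: "v holomorphic_on X" and X: "open X" "z \<in> X"
  shows "(energy_z u v has_derivative
           (\<lambda>h. energy_zz u v z * h + of_real (energy (deriv u) (deriv v) z) * cnj h)) (at z)"
proof -
  note D = has_derivative_holomorphic[OF u X] has_derivative_holomorphic[OF v X]
    has_derivative_holomorphic[OF holomorphic_deriv[OF u X(1)] X]
    has_derivative_holomorphic[OF holomorphic_deriv[OF v X(1)] X]
  show ?thesis
    unfolding energy_z_def[abs_def]
    by (rule has_derivative_eq_rhs, (rule derivative_intros D has_derivative_cnj)+)
       (auto simp: fun_eq_iff energy_zz_def energy_complex algebra_simps)
qed

lemma has_derivative_energy: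
  assumes u: "u holomorphic_on X" and v: "v holomorphic_on X" and X: "open X" "z \<in> X"
  shows "(energy u v has_derivative (\<lambda>h. 2 * Re (energy_z u v z * h))) (at z)"
proof -
  note D = has_derivative_holomorphic[OF u X] has_derivative_holomorphic[OF v X]
  have "((\<lambda>z. Re (u z * cnj (u z) + v z * cnj (v z))) has_derivative
           (\<lambda>h. 2 * Re (energy_z u v z * h))) (at z)"
    by (rule has_derivative_eq_rhs,
        (rule derivative_intros D has_derivative_cnj bounded_linear.has_derivative[OF bounded_linear_Re])+)
       (auto simp: fun_eq_iff energy_z_def algebra_simps)
  moreover have "(\<lambda>z. Re (u z * cnj (u z) + v z * cnj (v z))) = energy u v"
    unfolding energy_complex[symmetric] by simp
  ultimately show ?thesis by simp
qed

lemma energy_z_eq: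
  assumes "u holomorphic_on X" "v holomorphic_on X" "u' holomorphic_on X" "v' holomorphic_on X"
    and "open X" "z \<in> X" "\<And>z. z \<in> X \<Longrightarrow> energy u v z = energy u' v' z"
  shows "energy_z u v z = energy_z u' v' z"
proof -
  have "(energy u v has_derivative (\<lambda>h. 2 * Re (energy_z u' v' z * h))) (at z)"
    by (rule has_derivative_transform_within_open[OF has_derivative_energy[OF assms(3-6)] assms(5,6)])
       (simp add: assms(7))
  then have eq: "(\<lambda>h. 2 * Re (energy_z u v z * h)) = (\<lambda>h. 2 * Re (energy_z u' v' z * h))"
    using has_derivative_unique has_derivative_energy[OF assms(1,2,5,6)] by blast
  show ?thesis using fun_cong[OF eq, of 1] fun_cong[OF eq, of \<i>] by (simp add: complex_eq_iff)
qed

text \<open>By polarisation, \<^term>\<open>energy u v\<close> determines the pair up to a constant unitary matrix; all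
  that is needed is that its second derivatives determine the following two invariants.\<close>

lemma
  assumes "u holomorphic_on X" "v holomorphic_on X" "u' holomorphic_on X" "v' holomorphic_on X"
    and "open X" "z \<in> X" "\<And>z. z \<in> X \<Longrightarrow> energy u v z = energy u' v' z"
  shows energy_zz_eq: "energy_zz u v z = energy_zz u' v' z"
    and norm_wronskian_eq: "cmod (wronskian u v z) = cmod (wronskian u' v' z)"
proof -
  have E: "energy_z u v z = energy_z u' v' z" if "z \<in> X" for z
    using energy_z_eq[OF assms(1-5) that assms(7)] by simp
  let ?D = "\<lambda>u v h. energy_zz u v z * h + of_real (energy (deriv u) (deriv v) z) * cnj h"
  have "(energy_z u v has_derivative ?D u' v') (at z)"
    by (rule has_derivative_transform_within_open[OF has_derivative_energy_z[OF assms(3-6)] assms(5,6)])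
       (simp add: E)
  then have eq: "?D u v = ?D u' v'"
    using has_derivative_unique has_derivative_energy_z[OF assms(1,2,5,6)] by blast
  \<comment> \<open>The values at h = 1 and h = i give the sum and the difference of the complex
    linear and the antilinear coefficient of the derivative of P_z.\<close>
  have *: "energy_zz u v z + N = energy_zz u' v' z + N' \<Longrightarrow> energy_zz u v z - N = energy_zz u' v' z - N'
     \<Longrightarrow> energy_zz u v z = energy_zz u' v' z \<and> N = N'" for N N' :: complex
    by (smt (verit) add_diff_cancel_left' add_diff_eq diff_add_cancel diff_add_eq mult_2 mult_left_cancel zero_neq_numeral)
  have 1: "energy_zz u v z + of_real (energy (deriv u) (deriv v) z)
       = energy_zz u' v' z + of_real (energy (deriv u') (deriv v') z)"
    using fun_cong[OF eq, of 1] by simp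
  have "\<i> * (energy_zz u v z - of_real (energy (deriv u) (deriv v) z))
       = \<i> * (energy_zz u' v' z - of_real (energy (deriv u') (deriv v') z))"
    using fun_cong[OF eq, of \<i>] by (simp add: algebra_simps)
  then have 2: "energy_zz u v z - of_real (energy (deriv u) (deriv v) z)
       = energy_zz u' v' z - of_real (energy (deriv u') (deriv v') z)"
    by simp
  from *[OF 1 2] show "energy_zz u v z = energy_zz u' v' z" by blast
  from *[OF 1 2] have "energy (deriv u) (deriv v) z = energy (deriv u') (deriv v') z" by simp
  then have "(cmod (wronskian u v z))\<^sup>2 = (cmod (wronskian u' v' z))\<^sup>2"
    unfolding lagrange_identity using E[OF assms(6)] assms(6,7) by simp
  then show "cmod (wronskian u v z) = cmod (wronskian u' v' z)" by simp
qed

section \<open>Circle means of the logarithmic energy\<close>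

text \<open>The partial derivatives of ln P, from P_x = 2 Re P_z and P_y = - 2 Im P_z. The second
  ones below have the form P_xx / P - (P_x / P)^2, where P_xx and P_yy are twice the mixed Wirtinger
  derivative plus or minus 2 Re P_zz.\<close>

definition log_energy_x :: "(complex \<Rightarrow> complex) \<Rightarrow> (complex \<Rightarrow> complex) \<Rightarrow> complex \<Rightarrow> real" where
  "log_energy_x u v z = 2 * Re (energy_z u v z) / energy u v z"

definition log_energy_y :: "(complex \<Rightarrow> complex) \<Rightarrow> (complex \<Rightarrow> complex) \<Rightarrow> complex \<Rightarrow> real" where
  "log_energy_y u v z = - 2 * Im (energy_z u v z) / energy u v z"

definition log_energy_xx :: "(complex \<Rightarrow> complex) \<Rightarrow> (complex \<Rightarrow> complex) \<Rightarrow> complex \<Rightarrow> real" where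
  "log_energy_xx u v z =
     2 * (Re (energy_zz u v z) + energy (deriv u) (deriv v) z) / energy u v z
       - (log_energy_x u v z)\<^sup>2"

definition log_energy_yy :: "(complex \<Rightarrow> complex) \<Rightarrow> (complex \<Rightarrow> complex) \<Rightarrow> complex \<Rightarrow> real" where
  "log_energy_yy u v z =
     - 2 * (Re (energy_zz u v z) - energy (deriv u) (deriv v) z) / energy u v z
       - (log_energy_y u v z)\<^sup>2"

text \<open>The terms with Re P_zz cancel. What remains is 4 / P^2 times P
  \<open>energy (deriv u) (deriv v)\<close> - |P_z|^2, which is |W|^2 by
  \<open>lagrange_identity\<close>.\<close>

lemma laplacian_log_energy:
  assumes "energy u v z > 0"
  shows "log_energy_xx u v z + log_energy_yy u v z
           = 4 * (cmod (wronskian u v z))\<^sup>2 / (energy u v z)\<^sup>2"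
proof -
  have "(cmod (energy_z u v z))\<^sup>2 = (Re (energy_z u v z))\<^sup>2 + (Im (energy_z u v z))\<^sup>2"
    by (rule cmod_power2)
  then show ?thesis
    using assms unfolding log_energy_xx_def log_energy_yy_def log_energy_x_def log_energy_y_def
      lagrange_identity by (simp add: field_simps power2_eq_square)
qed

lemma has_derivative_quotient_re_im:
  fixes f g :: "complex \<Rightarrow> real"
  assumes "(f has_derivative (\<lambda>h. a * Re h + b * Im h)) (at z)"
    and "(g has_derivative (\<lambda>h. c * Re h + d * Im h)) (at z)" and "g z > 0"
  shows "((\<lambda>z. f z / g z) has_derivative
      (\<lambda>h. (a / g z - f z * c / (g z)\<^sup>2) * Re h + (b / g z - f z * d / (g z)\<^sup>2) * Im h)) (at z)"
  by (rule has_derivative_eq_rhs[OF has_derivative_divide'[OF assms(1,2)]])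
     (use assms(3) in \<open>auto simp: fun_eq_iff field_simps power2_eq_square\<close>)

context
  fixes u v :: "complex \<Rightarrow> complex" and X z
  assumes u: "u holomorphic_on X" and v: "v holomorphic_on X" and X: "open X" "z \<in> X"
    and pos: "energy u v z > 0"
begin

lemma has_derivative_ln_energy:
  "((\<lambda>z. ln (energy u v z)) has_derivative
      (\<lambda>h. log_energy_x u v z * Re h + log_energy_y u v z * Im h)) (at z)"
  by (rule has_derivative_eq_rhs, rule has_derivative_ln[OF pos has_derivative_energy[OF u v X]])
     (use pos in \<open>auto simp: fun_eq_iff log_energy_x_def log_energy_y_def field_simps\<close>)

text \<open>The Laplacian is assembled from the pure second derivatives, so the mixed one stays an
  anonymous \<open>b\<close>.\<close>

lemma has_derivative_log_energy_x:
  "\<exists>b. ((\<lambda>z. log_energy_x u v z) has_derivative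
      (\<lambda>h. log_energy_xx u v z * Re h + b * Im h)) (at z)"
proof -
  have P: "(energy u v has_derivative
      (\<lambda>h. 2 * Re (energy_z u v z) * Re h + - 2 * Im (energy_z u v z) * Im h)) (at z)"
    by (rule has_derivative_eq_rhs[OF has_derivative_energy[OF u v X]]) (simp add: fun_eq_iff algebra_simps)
  have R: "((\<lambda>z. 2 * Re (energy_z u v z)) has_derivative
      (\<lambda>h. 2 * (Re (energy_zz u v z) + energy (deriv u) (deriv v) z) * Re h
           + - 2 * Im (energy_zz u v z) * Im h)) (at z)"
    by (rule has_derivative_eq_rhs[OF has_derivative_mult_right[OF
          bounded_linear.has_derivative[OF bounded_linear_Re has_derivative_energy_z[OF u v X]]]])
       (simp add: fun_eq_iff algebra_simps)
  show ?thesis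
    unfolding log_energy_x_def[abs_def]
    by (rule exI, rule has_derivative_eq_rhs[OF has_derivative_quotient_re_im[OF R P pos]])
       (use pos in \<open>simp add: log_energy_xx_def log_energy_x_def power_divide power2_eq_square\<close>)
qed

lemma has_derivative_log_energy_y:
  "\<exists>b. ((\<lambda>z. log_energy_y u v z) has_derivative
      (\<lambda>h. b * Re h + log_energy_yy u v z * Im h)) (at z)"
proof -
  have P: "(energy u v has_derivative
      (\<lambda>h. 2 * Re (energy_z u v z) * Re h + - 2 * Im (energy_z u v z) * Im h)) (at z)"
    by (rule has_derivative_eq_rhs[OF has_derivative_energy[OF u v X]]) (simp add: fun_eq_iff algebra_simps)
  have R: "((\<lambda>z. - 2 * Im (energy_z u v z)) has_derivative
      (\<lambda>h. - 2 * Im (energy_zz u v z) * Re h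
           + - 2 * (Re (energy_zz u v z) - energy (deriv u) (deriv v) z) * Im h)) (at z)"
    by (rule has_derivative_eq_rhs[OF has_derivative_mult_right[OF
          bounded_linear.has_derivative[OF bounded_linear_Im has_derivative_energy_z[OF u v X]]]])
       (simp add: fun_eq_iff algebra_simps)
  show ?thesis
    unfolding log_energy_y_def[abs_def]
    by (rule exI, rule has_derivative_eq_rhs[OF has_derivative_quotient_re_im[OF R P pos]])
       (use pos in \<open>simp add: log_energy_yy_def log_energy_y_def power_divide power2_eq_square\<close>)
qed

end

lemma has_derivative_Complex_left: "((\<lambda>t. Complex t y) has_derivative (\<lambda>h. Complex h 0)) (at t within A)"
  unfolding Complex_eq by (auto intro!: derivative_eq_intros)

lemma has_derivative_Complex_right: "((\<lambda>t. Complex x t) has_derivative (\<lambda>h. Complex 0 h)) (at t within A)"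
  unfolding Complex_eq by (auto intro!: derivative_eq_intros)

lemma has_real_derivative_along_x:
  assumes "(f has_derivative (\<lambda>h. a * Re h + b * Im h)) (at (Complex x y))"
  shows "((\<lambda>t. f (Complex t y)) has_real_derivative (a :: real)) (at x within A)"
  using has_derivative_compose[OF has_derivative_Complex_left assms]
  by (simp add: has_field_derivative_def)

lemma has_real_derivative_along_y:
  assumes "(f has_derivative (\<lambda>h. a * Re h + b * Im h)) (at (Complex x y))"
  shows "((\<lambda>t. f (Complex x t)) has_real_derivative (b :: real)) (at y within A)"
  using has_derivative_compose[OF has_derivative_Complex_right assms]
  by (simp add: has_field_derivative_def)

lemma holomorphic_compose_UNIV:
  assumes "f holomorphic_on UNIV" "g holomorphic_on X"
  shows "(\<lambda>z. f (g z)) holomorphic_on X"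
  using holomorphic_on_compose_gen[OF assms(2,1)] by (simp add: o_def)

lemma deriv_compose_UNIV:
  assumes "f holomorphic_on UNIV" "(g has_field_derivative g') (at z)"
  shows "deriv (\<lambda>z. f (g z)) z = deriv f (g z) * g'"
  by (rule DERIV_imp_deriv, rule DERIV_chain2[OF _ assms(2)])
     (use holomorphic_derivI[OF assms(1)] in simp)

lemma energy_compose: "energy (\<lambda>z. u (g z)) (\<lambda>z. v (g z)) z = energy u v (g z)"
  by (simp add: energy_def)

lemma continuous_on_energy:
  assumes "u holomorphic_on X" "v holomorphic_on X"
  shows "continuous_on X (energy u v)"
  unfolding energy_def[abs_def]
  by (intro continuous_intros holomorphic_on_imp_continuous_on assms)

text \<open>In the coordinate log z, a vertical segment of length 2 pi is the circle of radius exp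
  t. The integral is not divided by 2 pi. The integrand of \<open>curvature_mean\<close> below is
  the Laplacian of ln P, that is, the density of - K dA in this coordinate.\<close>

definition log_mean :: "(complex \<Rightarrow> complex) \<Rightarrow> (complex \<Rightarrow> complex) \<Rightarrow> real \<Rightarrow> real" where
  "log_mean u v t = integral {0..2 * pi} (\<lambda>\<theta>. ln (energy u v (Complex t \<theta>)))"

definition curvature_mean :: "(complex \<Rightarrow> complex) \<Rightarrow> (complex \<Rightarrow> complex) \<Rightarrow> real \<Rightarrow> real" where
  "curvature_mean u v t = integral {0..2 * pi}
     (\<lambda>\<theta>. 4 * (cmod (wronskian u v (Complex t \<theta>)))\<^sup>2 / (energy u v (Complex t \<theta>))\<^sup>2)"

text \<open>Periodicity is asked of the energy alone, so that the pair itself may have unitary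
  monodromy.\<close>

locale periodic_pair =
  fixes u v :: "complex \<Rightarrow> complex"
  assumes holo_u: "u holomorphic_on UNIV" and holo_v: "v holomorphic_on UNIV"
    and energy_pos: "energy u v z > 0"
    and energy_periodic: "energy u v (z + 2 * of_real pi * \<i>) = energy u v z"
begin

definition log_mean' :: "real \<Rightarrow> real" where
  "log_mean' t = integral {0..2 * pi} (\<lambda>\<theta>. log_energy_x u v (Complex t \<theta>))"

lemma holo_deriv:
  "deriv u holomorphic_on UNIV" "deriv v holomorphic_on UNIV"
  "deriv (deriv u) holomorphic_on UNIV" "deriv (deriv v) holomorphic_on UNIV"
  by (auto intro!: holomorphic_deriv holo_u holo_v)

lemmas holo_continuous = holo_u[THEN holomorphic_on_imp_continuous_on]
  holo_v[THEN holomorphic_on_imp_continuous_on] holo_deriv[THEN holomorphic_on_imp_continuous_on]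

lemma continuous_compose_UNIV:
  "continuous_on UNIV f \<Longrightarrow> continuous_on A g \<Longrightarrow> continuous_on A (\<lambda>x. f (g x))"
  using continuous_on_compose2[of UNIV f A g] by simp

lemma continuous_energy: "continuous_on UNIV (energy u v)"
  by (intro continuous_on_energy holo_u holo_v)

lemma energy_nonzero [simp]: "energy u v z \<noteq> 0"
  using energy_pos[of z] by simp

lemma continuous_ln_energy: "continuous_on UNIV (\<lambda>z. ln (energy u v z))"
  by (intro continuous_intros continuous_energy) simp

lemma continuous_energy_z: "continuous_on UNIV (energy_z u v)"
  "continuous_on UNIV (energy_zz u v)" "continuous_on UNIV (energy (deriv u) (deriv v))"
  unfolding energy_z_def[abs_def] energy_zz_def[abs_def] energy_def[abs_def]
  by (intro continuous_intros holo_continuous)+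

lemma continuous_log_energy_x: "continuous_on UNIV (log_energy_x u v)"
  unfolding log_energy_x_def[abs_def]
  by (intro continuous_intros continuous_energy continuous_energy_z) simp

lemma continuous_log_energy_xx: "continuous_on UNIV (log_energy_xx u v)"
  unfolding log_energy_xx_def[abs_def]
  by (intro continuous_intros continuous_energy continuous_energy_z continuous_log_energy_x) simp

lemma continuous_wronskian: "continuous_on UNIV (wronskian u v)"
  unfolding wronskian_def[abs_def] by (intro continuous_intros holo_continuous)

lemma continuous_curvature:
  "continuous_on UNIV (\<lambda>z. 4 * (cmod (wronskian u v z))\<^sup>2 / (energy u v z)\<^sup>2)"
  by (intro continuous_intros continuous_wronskian continuous_energy) simp

lemma continuous_Complex: "continuous_on A (\<lambda>(t, \<theta>). Complex t \<theta>)"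
  unfolding Complex_eq split_beta by (intro continuous_intros)

lemma continuous_Complex_right: "continuous_on A (Complex t)"
  unfolding Complex_eq[abs_def] by (intro continuous_intros)

text \<open>Makes the boundary terms cancel when the second angular derivative is integrated over a
  period.\<close>

lemma log_energy_y_periodic: "log_energy_y u v (z + 2 * of_real pi * \<i>) = log_energy_y u v z"
proof -
  let ?T = "\<lambda>z. z + 2 * of_real pi * \<i>"
  have "energy_z u v z = energy_z (\<lambda>z. u (?T z)) (\<lambda>z. v (?T z)) z"
    by (rule energy_z_eq[of _ UNIV])
       (simp_all add: holo_u holo_v holomorphic_compose_UNIV[OF _ holomorphic_on_add[OF holomorphic_on_ident holomorphic_on_const]] energy_periodic[unfolded energy_def] energy_def)
  also have "\<dots> = energy_z u v (?T z)"
    unfolding energy_z_def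
    by (subst (1 2) deriv_compose_UNIV[where g' = 1]) (auto intro!: holo_u holo_v derivative_eq_intros)
  finally show ?thesis by (simp add: log_energy_y_def energy_periodic)
qed

lemma log_mean_deriv: "(log_mean u v has_real_derivative log_mean' t) (at t)"
proof -
  have "((\<lambda>t. integral (cbox 0 (2 * pi)) (\<lambda>\<theta>. ln (energy u v (Complex t \<theta>)))) has_real_derivative
      integral (cbox 0 (2 * pi)) (\<lambda>\<theta>. log_energy_x u v (Complex t \<theta>))) (at t within UNIV)"
  proof (rule leibniz_rule_field_derivative)
    show "((\<lambda>t. ln (energy u v (Complex t \<theta>))) has_real_derivative log_energy_x u v (Complex t \<theta>))
        (at t within UNIV)" for t \<theta>
      by (rule has_real_derivative_along_x, rule has_derivative_ln_energy[of _ UNIV])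
         (auto simp: holo_u holo_v energy_pos)
    show "(\<lambda>\<theta>. ln (energy u v (Complex t \<theta>))) integrable_on cbox 0 (2 * pi)" for t
      by (intro integrable_continuous continuous_compose_UNIV[OF continuous_ln_energy] continuous_Complex_right)
    show "continuous_on (UNIV \<times> cbox 0 (2 * pi)) (\<lambda>(t, \<theta>). log_energy_x u v (Complex t \<theta>))"
      using continuous_compose_UNIV[OF continuous_log_energy_x continuous_Complex]
      by (simp add: split_beta)
  qed auto
  then show ?thesis by (simp add: log_mean_def[abs_def] log_mean'_def)
qed

text \<open>Differentiation under the integral yields the mean of the second t-derivative of ln P.
  The second angular derivative integrates to 0 over a period and may be added, which completes the
  Laplacian.\<close>

lemma log_mean'_deriv: "(log_mean' has_real_derivative curvature_mean u v t) (at t)"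
proof -
  have 1: "((\<lambda>t. integral (cbox 0 (2 * pi)) (\<lambda>\<theta>. log_energy_x u v (Complex t \<theta>))) has_real_derivative
      integral (cbox 0 (2 * pi)) (\<lambda>\<theta>. log_energy_xx u v (Complex t \<theta>))) (at t within UNIV)"
  proof (rule leibniz_rule_field_derivative)
    fix t \<theta> :: real
    obtain b where "(log_energy_x u v has_derivative
      (\<lambda>h. log_energy_xx u v (Complex t \<theta>) * Re h + b * Im h)) (at (Complex t \<theta>))"
      using has_derivative_log_energy_x[of u UNIV v "Complex t \<theta>"] holo_u holo_v energy_pos by auto
    then show "((\<lambda>t. log_energy_x u v (Complex t \<theta>)) has_real_derivative log_energy_xx u v (Complex t \<theta>))
        (at t within UNIV)"
      by (rule has_real_derivative_along_x)
  next
    show "(\<lambda>\<theta>. log_energy_x u v (Complex t \<theta>)) integrable_on cbox 0 (2 * pi)" for t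
      by (intro integrable_continuous continuous_compose_UNIV[OF continuous_log_energy_x] continuous_Complex_right)
    show "continuous_on (UNIV \<times> cbox 0 (2 * pi)) (\<lambda>(t, \<theta>). log_energy_xx u v (Complex t \<theta>))"
      using continuous_compose_UNIV[OF continuous_log_energy_xx continuous_Complex]
      by (simp add: split_beta)
  qed auto
  have "((\<lambda>\<theta>. log_energy_yy u v (Complex t \<theta>)) has_integral
          (log_energy_y u v (Complex t (2 * pi)) - log_energy_y u v (Complex t 0))) {0..2*pi}"
  proof (rule fundamental_theorem_of_calculus)
    fix \<theta> :: real
    obtain b where "(log_energy_y u v has_derivative
      (\<lambda>h. b * Re h + log_energy_yy u v (Complex t \<theta>) * Im h)) (at (Complex t \<theta>))"
      using has_derivative_log_energy_y[of u UNIV v "Complex t \<theta>"] holo_u holo_v energy_pos by auto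
    then show "((\<lambda>\<theta>. log_energy_y u v (Complex t \<theta>)) has_vector_derivative log_energy_yy u v (Complex t \<theta>))
        (at \<theta> within {0..2*pi})"
      unfolding has_real_derivative_iff_has_vector_derivative[symmetric]
      by (rule has_real_derivative_along_y)
  qed simp
  moreover have "Complex t (2 * pi) = Complex t 0 + 2 * of_real pi * \<i>"
    by (simp add: complex_eq_iff)
  ultimately have yy: "((\<lambda>\<theta>. log_energy_yy u v (Complex t \<theta>)) has_integral 0) {0..2*pi}"
    by (simp add: log_energy_y_periodic)
  have "((\<lambda>\<theta>. log_energy_xx u v (Complex t \<theta>)) has_integral
          integral {0..2*pi} (\<lambda>\<theta>. log_energy_xx u v (Complex t \<theta>))) {0..2*pi}"
    by (intro integrable_integral integrable_continuous_real
        continuous_compose_UNIV[OF continuous_log_energy_xx] continuous_Complex_right)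
  from has_integral_add[OF this yy]
  have "integral {0..2*pi} (\<lambda>\<theta>. log_energy_xx u v (Complex t \<theta>)) = curvature_mean u v t"
    unfolding curvature_mean_def laplacian_log_energy[OF energy_pos]
    by (simp add: integral_unique)
  with 1 show ?thesis by (simp add: log_mean'_def[abs_def])
qed

lemma curvature_mean_nonneg: "curvature_mean u v t \<ge> 0"
  unfolding curvature_mean_def
  by (intro integral_nonneg integrable_continuous_real
      continuous_compose_UNIV[OF continuous_curvature] continuous_Complex_right) auto

end

section \<open>Area in logarithmic polar coordinates\<close>

text \<open>Both measures agree on boxes. This opens plane integrals to Fubini's theorem and to
  one-dimensional substitutions.\<close>

lemma lborel_complex:
  "distr (lborel \<Otimes>\<^sub>M lborel) borel (\<lambda>(x, y). Complex x y) = (lborel :: complex measure)"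
proof (rule lborel_eqI[symmetric])
  have meas: "(\<lambda>(x, y). Complex x y) \<in> (borel \<Otimes>\<^sub>M borel) \<rightarrow>\<^sub>M borel"
    unfolding borel_measurable_complex_iff by (simp add: split_beta)
  fix l u :: complex
  assume lu: "\<And>b. b \<in> Basis \<Longrightarrow> l \<bullet> b \<le> u \<bullet> b"
  have le: "Re l \<le> Re u" "Im l \<le> Im u"
    using lu[of 1] lu[of \<i>] by (auto simp: Basis_complex_def inner_complex_def)
  have "emeasure (distr (lborel \<Otimes>\<^sub>M lborel) borel (\<lambda>(x, y). Complex x y)) (box l u)
      = emeasure (lborel \<Otimes>\<^sub>M lborel) ({Re l<..<Re u} \<times> {Im l<..<Im u})"
    by (subst emeasure_distr) (use meas in \<open>auto simp: box_def Basis_complex_def inner_complex_def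
        space_pair_measure intro!: arg_cong[where f = "emeasure _"]\<close>)
  also have "\<dots> = emeasure lborel {Re l<..<Re u} * emeasure lborel {Im l<..<Im u}"
    by (rule lborel.emeasure_pair_measure_Times) auto
  also have "\<dots> = (\<Prod>b\<in>Basis. (u - l) \<bullet> b)"
    using le by (simp add: Basis_complex_def inner_complex_def ennreal_mult)
  finally show "emeasure (distr (lborel \<Otimes>\<^sub>M lborel) borel (\<lambda>(x, y). Complex x y)) (box l u)
      = (\<Prod>b\<in>Basis. (u - l) \<bullet> b)" .
qed simp

lemma measurable_Complex [measurable (raw)]:
  "f \<in> borel_measurable M \<Longrightarrow> g \<in> borel_measurable M \<Longrightarrow> (\<lambda>x. Complex (f x) (g x)) \<in> borel_measurable M"
  unfolding borel_measurable_complex_iff by simp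

lemma nn_integral_complex:
  assumes [measurable]: "F \<in> borel_measurable borel"
  shows "(\<integral>\<^sup>+z. F z \<partial>lborel) = (\<integral>\<^sup>+x. \<integral>\<^sup>+y. F (Complex x y) \<partial>lborel \<partial>lborel)"
proof -
  have "(\<integral>\<^sup>+z. F z \<partial>lborel) = (\<integral>\<^sup>+p. F (case p of (x, y) \<Rightarrow> Complex x y) \<partial>(lborel \<Otimes>\<^sub>M lborel))"
    by (subst lborel_complex[symmetric], subst nn_integral_distr) (simp_all add: split_beta)
  also have "\<dots> = (\<integral>\<^sup>+x. \<integral>\<^sup>+y. F (Complex x y) \<partial>lborel \<partial>lborel)"
    by (subst lborel.nn_integral_fst[symmetric]) (simp_all add: split_beta)
  finally show ?thesis .
qed

lemma nn_integral_rotate_complex: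
  assumes [measurable]: "F \<in> borel_measurable borel"
  shows "(\<integral>\<^sup>+z. F (\<i> * z) \<partial>lborel) = (\<integral>\<^sup>+z. F z \<partial>lborel)"
proof -
  have "(\<integral>\<^sup>+z. F (\<i> * z) \<partial>lborel) = (\<integral>\<^sup>+x. \<integral>\<^sup>+y. F (Complex (- y) x) \<partial>lborel \<partial>lborel)"
    by (subst nn_integral_complex) (simp_all add: Complex_eq algebra_simps)
  also have "\<dots> = (\<integral>\<^sup>+y. \<integral>\<^sup>+x. F (Complex (- y) x) \<partial>lborel \<partial>lborel)"
    by (rule lborel_pair.Fubini') simp
  also have "\<dots> = (\<integral>\<^sup>+y. \<integral>\<^sup>+x. F (Complex y x) \<partial>lborel \<partial>lborel)"
    using nn_integral_real_affine[of "\<lambda>y. \<integral>\<^sup>+x. F (Complex y x) \<partial>lborel" "-1" 0] by simp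
  also have "\<dots> = (\<integral>\<^sup>+z. F z \<partial>lborel)"
    by (rule nn_integral_complex[symmetric]) simp
  finally show ?thesis .
qed

text \<open>Polar coordinates by two substitutions on the line: x = exp t cos phi at fixed phi, and
  y = x tan phi at fixed x. On the sector |phi| <= pi / 4 the cosine is positive and the tangent is
  a coordinate.\<close>

lemma polar_sector_le:
  assumes [measurable]: "F \<in> borel_measurable borel" and ab: "a < b"
  shows "(\<integral>\<^sup>+\<phi>. (\<integral>\<^sup>+t. ennreal (exp (2 * t)) * F (exp (Complex t \<phi>)) * indicator {a..b} t \<partial>lborel)
            * indicator {- (pi / 4)..pi / 4} \<phi> \<partial>lborel) \<le> (\<integral>\<^sup>+z. F z \<partial>lborel)"
proof -
  let ?I = "{- (pi / 4)..pi / 4}"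
  have cos_pos: "cos \<phi> > 0" if "\<phi> \<in> ?I" for \<phi>
    using that pi_gt_zero by (intro cos_gt_zero_pi; simp; linarith)
  have inner: "(\<integral>\<^sup>+t. ennreal (exp (2 * t)) * F (exp (Complex t \<phi>)) * indicator {a..b} t \<partial>lborel)
      \<le> ennreal (1 + (tan \<phi>)\<^sup>2) * (\<integral>\<^sup>+x. ennreal x * F (Complex x (x * tan \<phi>)) * indicator {0<..} x \<partial>lborel)"
    if \<phi>: "\<phi> \<in> ?I" for \<phi>
  proof -
    \<comment> \<open>With x = exp t cos phi and dx = x dt, the product x dx equals exp (2 t) (cos
      phi)^2 dt. The factor 1 + (tan phi)^2 cancels the cosine, and it is at the same time the
      derivative of tan that the second substitution consumes.\<close>
    let ?H = "\<lambda>x. ennreal (1 + (tan \<phi>)\<^sup>2) * (ennreal x * F (Complex x (x * tan \<phi>)) * indicator {0<..} x)"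
    let ?g = "\<lambda>t. exp t * cos \<phi>"
    have "(\<integral>\<^sup>+x. ?H x * indicator {?g a..?g b} x \<partial>lborel)
        = (\<integral>\<^sup>+t. ?H (?g t) * ?g t * indicator {a..b} t \<partial>lborel)"
      by (rule nn_integral_substitution_aux)
         (use ab cos_pos[OF \<phi>] in \<open>auto intro!: derivative_eq_intros continuous_intros\<close>)
    also have "\<dots> = (\<integral>\<^sup>+t. ennreal (exp (2 * t)) * F (exp (Complex t \<phi>)) * indicator {a..b} t \<partial>lborel)"
    proof (rule nn_integral_cong)
      fix t :: real
      have c: "cos \<phi> \<noteq> 0" using cos_pos[OF \<phi>] by simp
      have e: "Complex (?g t) (?g t * tan \<phi>) = exp (Complex t \<phi>)"
        using c by (simp add: complex_eq_iff Re_exp Im_exp tan_def)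
      have "(1 + (tan \<phi>)\<^sup>2) * (cos \<phi>)\<^sup>2 = 1"
        using c by (simp add: tan_sec inverse_eq_divide field_simps)
      moreover have "(1 + (tan \<phi>)\<^sup>2) * (?g t * ?g t) = ((1 + (tan \<phi>)\<^sup>2) * (cos \<phi>)\<^sup>2) * (exp t * exp t)"
        by (simp add: power2_eq_square)
      ultimately have "(1 + (tan \<phi>)\<^sup>2) * (?g t * ?g t) = exp (2 * t)"
        by (simp add: exp_add[symmetric])
      then have "ennreal (exp (2 * t)) = ennreal ((1 + (tan \<phi>)\<^sup>2) * (?g t * ?g t))"
        by (simp only:)
      also have "\<dots> = ennreal (1 + (tan \<phi>)\<^sup>2) * (ennreal (?g t) * ennreal (?g t))"
        using cos_pos[OF \<phi>] by (subst ennreal_mult, simp, simp, subst ennreal_mult) simp_all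
      finally have "ennreal (exp (2 * t)) = ennreal (1 + (tan \<phi>)\<^sup>2) * (ennreal (?g t) * ennreal (?g t))" .
      then show "?H (?g t) * ?g t * indicator {a..b} t
          = ennreal (exp (2 * t)) * F (exp (Complex t \<phi>)) * indicator {a..b} t"
        using e cos_pos[OF \<phi>] by (simp add: mult_ac)
    qed
    finally have "(\<integral>\<^sup>+t. ennreal (exp (2 * t)) * F (exp (Complex t \<phi>)) * indicator {a..b} t \<partial>lborel)
       = (\<integral>\<^sup>+x. ?H x * indicator {?g a..?g b} x \<partial>lborel)" by simp
    also have "\<dots> \<le> (\<integral>\<^sup>+x. ?H x \<partial>lborel)"
      by (intro nn_integral_mono) (auto simp: indicator_def)
    also have "\<dots> = ennreal (1 + (tan \<phi>)\<^sup>2) * (\<integral>\<^sup>+x. ennreal x * F (Complex x (x * tan \<phi>)) * indicator {0<..} x \<partial>lborel)"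
      by (rule nn_integral_cmult) simp
    finally show ?thesis .
  qed
  let ?K = "\<lambda>x \<phi>. ennreal x * F (Complex x (x * tan \<phi>)) * indicator {0<..} x * ennreal (1 + (tan \<phi>)\<^sup>2) * indicator ?I \<phi>"
  have tan_meas [measurable]: "(\<lambda>x::real. tan x) \<in> borel_measurable borel"
    unfolding tan_def by measurable
  have "(\<integral>\<^sup>+\<phi>. (\<integral>\<^sup>+t. ennreal (exp (2 * t)) * F (exp (Complex t \<phi>)) * indicator {a..b} t \<partial>lborel)
            * indicator ?I \<phi> \<partial>lborel)
      \<le> (\<integral>\<^sup>+\<phi>. \<integral>\<^sup>+x. ?K x \<phi> \<partial>lborel \<partial>lborel)"
  proof (rule nn_integral_mono)
    fix \<phi> :: real
    have "(\<integral>\<^sup>+x. ?K x \<phi> \<partial>lborel) = ennreal (1 + (tan \<phi>)\<^sup>2) *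
        (\<integral>\<^sup>+x. ennreal x * F (Complex x (x * tan \<phi>)) * indicator {0<..} x \<partial>lborel) * indicator ?I \<phi>"
      by (subst nn_integral_cmult[symmetric], simp, subst nn_integral_multc[symmetric], simp)
         (simp add: mult_ac)
    then show "(\<integral>\<^sup>+t. ennreal (exp (2 * t)) * F (exp (Complex t \<phi>)) * indicator {a..b} t \<partial>lborel)
            * indicator ?I \<phi> \<le> (\<integral>\<^sup>+x. ?K x \<phi> \<partial>lborel)"
      using inner[of \<phi>] by (auto simp: indicator_def)
  qed
  also have "\<dots> = (\<integral>\<^sup>+x. \<integral>\<^sup>+\<phi>. ?K x \<phi> \<partial>lborel \<partial>lborel)"
    by (rule lborel_pair.Fubini') simp
  also have "\<dots> \<le> (\<integral>\<^sup>+x. \<integral>\<^sup>+y. F (Complex x y) \<partial>lborel \<partial>lborel)"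
  proof (rule nn_integral_mono)
    fix x :: real
    show "(\<integral>\<^sup>+\<phi>. ?K x \<phi> \<partial>lborel) \<le> (\<integral>\<^sup>+y. F (Complex x y) \<partial>lborel)"
    proof (cases "x > 0")
      case True
      have "(\<integral>\<^sup>+\<phi>. ?K x \<phi> \<partial>lborel)
          = (\<integral>\<^sup>+\<phi>. (ennreal x * F (Complex x (x * tan \<phi>))) * ennreal (1 + (tan \<phi>)\<^sup>2) * indicator ?I \<phi> \<partial>lborel)"
        using True by simp
      also have "\<dots> = (\<integral>\<^sup>+s. (ennreal x * F (Complex x (x * s))) * indicator {tan (- (pi / 4))..tan (pi / 4)} s \<partial>lborel)"
      proof (rule nn_integral_substitution_aux[symmetric])
        fix \<phi> assume "\<phi> \<in> ?I"
        then have c: "cos \<phi> \<noteq> 0" using cos_pos[of \<phi>] by simp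
        have "(tan has_real_derivative inverse ((cos \<phi>)\<^sup>2)) (at \<phi>)" by (rule DERIV_tan[OF c])
        then show "(tan has_real_derivative 1 + (tan \<phi>)\<^sup>2) (at \<phi>)"
          using tan_sec[OF c] by (simp add: power_inverse)
      next
        show "continuous_on ?I (\<lambda>\<phi>. 1 + (tan \<phi>)\<^sup>2)"
          using cos_pos by (intro continuous_intros) force
      qed auto
      also have "\<dots> \<le> (\<integral>\<^sup>+s. ennreal x * F (Complex x (x * s)) \<partial>lborel)"
        by (intro nn_integral_mono) (auto simp: indicator_def)
      also have "\<dots> = ennreal x * (\<integral>\<^sup>+s. F (Complex x (x * s)) \<partial>lborel)"
        by (rule nn_integral_cmult) simp
      also have "\<dots> = (\<integral>\<^sup>+y. F (Complex x y) \<partial>lborel)"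
        using nn_integral_real_affine[of "\<lambda>y. F (Complex x y)" x 0] True by simp
      finally show ?thesis .
    qed simp
  qed
  also have "\<dots> = (\<integral>\<^sup>+z. F z \<partial>lborel)"
    by (rule nn_integral_complex[symmetric]) simp
  finally show ?thesis .
qed

text \<open>Induction over quarter turns: replacing F z by F (i z) preserves the plane integral and
  shifts the angle by pi / 2.\<close>

lemma polar_sector_rotated_le:
  assumes "F \<in> borel_measurable borel" and "a < b"
  shows "(\<integral>\<^sup>+\<phi>. (\<integral>\<^sup>+t. ennreal (exp (2 * t)) * F (exp (Complex t \<phi>)) * indicator {a..b} t \<partial>lborel)
            * indicator {real k * (pi / 2) - pi / 4..real k * (pi / 2) + pi / 4} \<phi> \<partial>lborel)
         \<le> (\<integral>\<^sup>+z. F z \<partial>lborel)"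
  using assms(1)
proof (induction k arbitrary: F)
  case 0
  then show ?case using polar_sector_le[OF 0 \<open>a < b\<close>] by simp
next
  case (Suc k)
  note [measurable] = Suc.prems
  let ?G = "\<lambda>F \<phi>. \<integral>\<^sup>+t. ennreal (exp (2 * t)) * F (exp (Complex t \<phi>)) * indicator {a..b} t \<partial>lborel"
  have rot: "exp (Complex t (pi / 2 + \<phi>)) = \<i> * exp (Complex t \<phi>)" for t \<phi>
    by (simp add: complex_eq_iff Re_exp Im_exp cos_add sin_add)
  have "(\<integral>\<^sup>+\<phi>. ?G F \<phi> * indicator {real (Suc k) * (pi / 2) - pi / 4..real (Suc k) * (pi / 2) + pi / 4} \<phi> \<partial>lborel)
      = (\<integral>\<^sup>+\<phi>. ?G F (pi / 2 + \<phi>) *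
           indicator {real (Suc k) * (pi / 2) - pi / 4..real (Suc k) * (pi / 2) + pi / 4} (pi / 2 + \<phi>) \<partial>lborel)"
    by (subst nn_integral_real_affine[of _ 1 "pi / 2"]) simp_all
  also have "\<dots> = (\<integral>\<^sup>+\<phi>. ?G (\<lambda>z. F (\<i> * z)) \<phi> * indicator {real k * (pi / 2) - pi / 4..real k * (pi / 2) + pi / 4} \<phi> \<partial>lborel)"
  proof (rule nn_integral_cong)
    fix \<phi> :: real
    have "(indicator {real (Suc k) * (pi / 2) - pi / 4..real (Suc k) * (pi / 2) + pi / 4} (pi / 2 + \<phi>) :: ennreal)
        = indicator {real k * (pi / 2) - pi / 4..real k * (pi / 2) + pi / 4} \<phi>"
      by (auto simp: indicator_def field_simps)
    then show "?G F (pi / 2 + \<phi>) * indicator {real (Suc k) * (pi / 2) - pi / 4..real (Suc k) * (pi / 2) + pi / 4} (pi / 2 + \<phi>)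
        = ?G (\<lambda>z. F (\<i> * z)) \<phi> * indicator {real k * (pi / 2) - pi / 4..real k * (pi / 2) + pi / 4} \<phi>"
      by (simp only: rot)
  qed
  also have "\<dots> \<le> (\<integral>\<^sup>+z. F (\<i> * z) \<partial>lborel)"
    by (rule Suc.IH) simp
  also have "\<dots> = (\<integral>\<^sup>+z. F z \<partial>lborel)"
    by (rule nn_integral_rotate_complex) simp
  finally show ?case .
qed

text \<open>The constant 5 counts the sectors of opening pi / 2 centred at 0, pi / 2, ..., 2 pi,
  which cover [0, 2 pi]. The overlap costs a constant factor only, and the aim is
  finiteness.\<close>

lemma polar_le:
  assumes [measurable]: "F \<in> borel_measurable borel" and ab: "a < b"
  shows "(\<integral>\<^sup>+\<phi>. (\<integral>\<^sup>+t. ennreal (exp (2 * t)) * F (exp (Complex t \<phi>)) * indicator {a..b} t \<partial>lborel)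
            * indicator {0..2 * pi} \<phi> \<partial>lborel) \<le> 5 * (\<integral>\<^sup>+z. F z \<partial>lborel)"
proof -
  let ?G = "\<lambda>\<phi>. \<integral>\<^sup>+t. ennreal (exp (2 * t)) * F (exp (Complex t \<phi>)) * indicator {a..b} t \<partial>lborel"
  let ?J = "\<lambda>k. {real k * (pi / 2) - pi / 4..real k * (pi / 2) + pi / 4}"
  have cover: "\<phi> \<in> (\<Union>k<5. ?J k)" if "\<phi> \<in> {0..2 * pi}" for \<phi>
  proof -
    \<comment> \<open>Index of the multiple of pi / 2 nearest to phi.\<close>
    define k where "k = nat \<lfloor>(\<phi> + pi / 4) / (pi / 2)\<rfloor>"
    have nn: "0 \<le> (\<phi> + pi / 4) / (pi / 2)" using that pi_gt_zero by simp
    have k: "real k \<le> (\<phi> + pi / 4) / (pi / 2)" "(\<phi> + pi / 4) / (pi / 2) < real k + 1"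
      unfolding k_def using nn by linarith+
    have "\<phi> \<le> 2 * pi" using that by simp
    then have "\<phi> + pi / 4 < 5 * (pi / 2)" using pi_gt_zero by linarith
    then have "(\<phi> + pi / 4) / (pi / 2) < 5" using pi_gt_zero by (simp add: pos_divide_less_eq)
    with k(1) have "k < 5" by linarith
    moreover have "\<phi> \<in> ?J k" using k pi_gt_zero by (simp add: field_simps)
    ultimately show ?thesis by blast
  qed
  have "(\<integral>\<^sup>+\<phi>. ?G \<phi> * indicator {0..2 * pi} \<phi> \<partial>lborel)
      \<le> (\<integral>\<^sup>+\<phi>. (\<Sum>k<5. ?G \<phi> * indicator (?J k) \<phi>) \<partial>lborel)"
  proof (rule nn_integral_mono)
    fix \<phi> :: real
    show "?G \<phi> * indicator {0..2 * pi} \<phi> \<le> (\<Sum>k<5. ?G \<phi> * indicator (?J k) \<phi>)"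
    proof (cases "\<phi> \<in> {0..2 * pi}")
      case True
      from cover[OF this] obtain k where "k < 5" "\<phi> \<in> ?J k" by blast
      then have "?G \<phi> * indicator {0..2 * pi} \<phi> = ?G \<phi> * indicator (?J k) \<phi>" using True by simp
      also have "\<dots> \<le> (\<Sum>k<5. ?G \<phi> * indicator (?J k) \<phi>)"
        using \<open>k < 5\<close> by (intro member_le_sum) auto
      finally show ?thesis .
    qed simp
  qed
  also have "\<dots> = (\<Sum>k<5. \<integral>\<^sup>+\<phi>. ?G \<phi> * indicator (?J k) \<phi> \<partial>lborel)"
    by (rule nn_integral_sum) simp
  also have "\<dots> \<le> (\<Sum>k<5::nat. \<integral>\<^sup>+z. F z \<partial>lborel)"
    by (intro sum_mono polar_sector_rotated_le ab) simp
  finally show ?thesis by simp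
qed

section \<open>From Lebesgue integrals over the plane to iterated gauge integrals over strips and
  squares\<close>

lemma nn_integral_Icc_eq_integral:
  fixes g :: "real \<Rightarrow> real"
  assumes "continuous_on {a..b} g" "\<And>x. x \<in> {a..b} \<Longrightarrow> (g x :: real) \<ge> 0"
  shows "(\<integral>\<^sup>+x. ennreal (g x) * indicator {a..b} x \<partial>lborel) = ennreal (integral {a..b} g)"
  by (rule nn_integral_has_integral_lebesgue')
     (use assms(2) integrable_integral[OF integrable_continuous_real[OF assms(1)]] in simp_all)

lemma continuous_on_Complex_compose:
  assumes "continuous_on UNIV g" "continuous_on A h" "continuous_on A k"
  shows "continuous_on A (\<lambda>p. g (Complex (h p) (k p)))"
  unfolding Complex_eq
  by (rule continuous_on_compose2[OF assms(1)]) (intro continuous_intros assms(2,3), simp)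

lemma continuous_on_integral_Complex:
  fixes g :: "complex \<Rightarrow> real"
  assumes g: "continuous_on UNIV g"
  shows "continuous_on A (\<lambda>x. integral {c..d} (\<lambda>y. g (Complex x y)))"
proof -
  have "continuous_on (A \<times> cbox c d) (\<lambda>(x, y). g (Complex x y))"
    unfolding split_beta
    by (intro continuous_on_Complex_compose[OF g] continuous_on_fst continuous_on_snd continuous_on_id)
  from integral_continuous_on_param[OF this] show ?thesis by (simp add: cbox_interval)
qed

lemma integral_Complex_nonneg:
  assumes g: "continuous_on UNIV g" "\<And>z. (g z :: real) \<ge> 0"
  shows "integral {c..d} (\<lambda>y. g (Complex x y)) \<ge> 0"
  by (intro integral_nonneg integrable_continuous_real continuous_on_Complex_compose[OF g(1)]
      continuous_on_const continuous_on_id) (rule g(2))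

lemma nn_integral_right_swap:
  fixes f h :: "'a \<Rightarrow> ennreal"
  assumes "(\<lambda>y. f y * h y) \<in> borel_measurable M"
  shows "(\<integral>\<^sup>+y. f y * c * h y \<partial>M) = (\<integral>\<^sup>+y. f y * h y \<partial>M) * c"
  unfolding nn_integral_multc[OF assms, symmetric] by (simp only: mult_ac)

lemma nn_integral_Icc_Icc_eq_integral:
  assumes g: "continuous_on UNIV g" "\<And>z. (g z :: real) \<ge> 0"
  shows "(\<integral>\<^sup>+y. (\<integral>\<^sup>+x. ennreal (g (Complex x y)) * indicator {a..b} x \<partial>lborel) * indicator {c..d} y \<partial>lborel)
     = ennreal (integral {a..b} (\<lambda>x. integral {c..d} (\<lambda>y. g (Complex x y))))"
proof -
  have meas [measurable]: "g \<in> borel_measurable borel"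
    using g(1) by (rule borel_measurable_continuous_onI)
  have "(\<integral>\<^sup>+y. (\<integral>\<^sup>+x. ennreal (g (Complex x y)) * indicator {a..b} x \<partial>lborel) * indicator {c..d} y \<partial>lborel)
     = (\<integral>\<^sup>+y. \<integral>\<^sup>+x. ennreal (g (Complex x y)) * indicator {a..b} x * indicator {c..d} y \<partial>lborel \<partial>lborel)"
    by (intro nn_integral_cong nn_integral_multc[symmetric]) simp
  also have "\<dots> = (\<integral>\<^sup>+x. \<integral>\<^sup>+y. ennreal (g (Complex x y)) * indicator {a..b} x * indicator {c..d} y \<partial>lborel \<partial>lborel)"
    by (rule lborel_pair.Fubini') simp
  also have "\<dots> = (\<integral>\<^sup>+x. (\<integral>\<^sup>+y. ennreal (g (Complex x y)) * indicator {c..d} y \<partial>lborel) * indicator {a..b} x \<partial>lborel)"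
    by (intro nn_integral_cong nn_integral_right_swap) simp
  also have "\<dots> = (\<integral>\<^sup>+x. ennreal (integral {c..d} (\<lambda>y. g (Complex x y))) * indicator {a..b} x \<partial>lborel)"
  proof (rule nn_integral_cong)
    fix x :: real
    have "(\<integral>\<^sup>+y. ennreal (g (Complex x y)) * indicator {c..d} y \<partial>lborel)
        = ennreal (integral {c..d} (\<lambda>y. g (Complex x y)))"
      by (rule nn_integral_Icc_eq_integral)
         (use continuous_on_Complex_compose[OF g(1) continuous_on_const continuous_on_id] g(2) in auto)
    then show "(\<integral>\<^sup>+y. ennreal (g (Complex x y)) * indicator {c..d} y \<partial>lborel) * indicator {a..b} x
        = ennreal (integral {c..d} (\<lambda>y. g (Complex x y))) * indicator {a..b} x"
      by (simp only:)
  qed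
  also have "\<dots> = ennreal (integral {a..b} (\<lambda>x. integral {c..d} (\<lambda>y. g (Complex x y))))"
    by (intro nn_integral_Icc_eq_integral continuous_on_integral_Complex integral_Complex_nonneg g)
  finally show ?thesis .
qed

lemma integral_strip_le:
  assumes "F \<in> borel_measurable borel" and "(\<integral>\<^sup>+z. F z \<partial>lborel) \<le> ennreal B" "B \<ge> 0"
    and g: "continuous_on UNIV g" "\<And>z. (g z :: real) \<ge> 0"
    and Fg: "\<And>t \<phi>. t \<in> {a..b} \<Longrightarrow> ennreal (g (Complex t \<phi>)) \<le> ennreal (exp (2 * t)) * F (exp (Complex t \<phi>))"
    and "a < b"
  shows "integral {a..b} (\<lambda>t. integral {0..2 * pi} (\<lambda>\<phi>. g (Complex t \<phi>))) \<le> 5 * B"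
proof -
  have "ennreal (integral {a..b} (\<lambda>t. integral {0..2 * pi} (\<lambda>\<phi>. g (Complex t \<phi>))))
      = (\<integral>\<^sup>+\<phi>. (\<integral>\<^sup>+t. ennreal (g (Complex t \<phi>)) * indicator {a..b} t \<partial>lborel) * indicator {0..2 * pi} \<phi> \<partial>lborel)"
    by (rule nn_integral_Icc_Icc_eq_integral[symmetric, OF g])
  also have "\<dots> \<le> (\<integral>\<^sup>+\<phi>. (\<integral>\<^sup>+t. ennreal (exp (2 * t)) * F (exp (Complex t \<phi>)) * indicator {a..b} t \<partial>lborel)
            * indicator {0..2 * pi} \<phi> \<partial>lborel)"
    by (rule nn_integral_mono, rule mult_right_mono, rule nn_integral_mono)
       (use Fg in \<open>auto simp: indicator_def\<close>)
  also have "\<dots> \<le> 5 * (\<integral>\<^sup>+z. F z \<partial>lborel)"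
    by (rule polar_le) fact+
  also have "\<dots> \<le> 5 * ennreal B"
    by (intro mult_left_mono assms) simp
  also have "\<dots> = ennreal (5 * B)"
    using \<open>B \<ge> 0\<close> by (simp add: ennreal_mult)
  finally show ?thesis using \<open>B \<ge> 0\<close> by (subst (asm) ennreal_le_iff) auto
qed

text \<open>The range [-1, 0] of t describes the annulus of radii exp (-1) to 1 about z, which lies
  in the square. Leaving out the core keeps the range of t compact; the 5 is that of
  \<open>polar_le\<close>.\<close>

lemma integral_disc_le_integral_square:
  assumes g: "continuous_on UNIV g" "\<And>z. (g z :: real) \<ge> 0"
  shows "integral {-1..0} (\<lambda>t. integral {0..2 * pi} (\<lambda>\<phi>. exp (2 * t) * g (z + exp (Complex t \<phi>))))
     \<le> 5 * integral {Re z - 1..Re z + 1} (\<lambda>x. integral {Im z - 1..Im z + 1} (\<lambda>y. g (Complex x y)))"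
proof -
  let ?B = "integral {Re z - 1..Re z + 1} (\<lambda>x. integral {Im z - 1..Im z + 1} (\<lambda>y. g (Complex x y)))"
  let ?S = "\<lambda>w. indicator {Re z - 1..Re z + 1} (Re w) * indicator {Im z - 1..Im z + 1} (Im w) :: ennreal"
  have [measurable]: "g \<in> borel_measurable borel"
    using g(1) by (rule borel_measurable_continuous_onI)
  have F: "(\<integral>\<^sup>+w. ennreal (g (z + w)) * ?S (z + w) \<partial>lborel) = ennreal ?B"
  proof -
    have "(\<integral>\<^sup>+w. ennreal (g (z + w)) * ?S (z + w) \<partial>lborel) = (\<integral>\<^sup>+w. ennreal (g w) * ?S w \<partial>lborel)"
      by (subst (2) lborel_distr_plus[symmetric, of z], subst nn_integral_distr) simp_all
    also have "\<dots> = (\<integral>\<^sup>+x. \<integral>\<^sup>+y. ennreal (g (Complex x y)) * ?S (Complex x y) \<partial>lborel \<partial>lborel)"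
      by (rule nn_integral_complex) simp
    also have "\<dots> = (\<integral>\<^sup>+y. \<integral>\<^sup>+x. ennreal (g (Complex x y)) * ?S (Complex x y) \<partial>lborel \<partial>lborel)"
      by (rule lborel_pair.Fubini') simp
    also have "\<dots> = (\<integral>\<^sup>+y. (\<integral>\<^sup>+x. ennreal (g (Complex x y)) * indicator {Re z - 1..Re z + 1} x \<partial>lborel)
        * indicator {Im z - 1..Im z + 1} y \<partial>lborel)"
      unfolding complex.sel mult.assoc[symmetric] by (intro nn_integral_cong nn_integral_multc) simp
    also have "\<dots> = ennreal ?B" by (rule nn_integral_Icc_Icc_eq_integral[OF g])
    finally show ?thesis .
  qed
  have "integral {-1..0} (\<lambda>t. integral {0..2 * pi}
      (\<lambda>\<phi>. (\<lambda>w. exp (2 * Re w) * g (z + exp w)) (Complex t \<phi>))) \<le> 5 * ?B"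
  proof (rule integral_strip_le[OF _ eq_refl[OF F]])
    show "?B \<ge> 0"
      by (intro integral_nonneg integrable_continuous_real continuous_on_integral_Complex
          integral_Complex_nonneg g)
    show "ennreal (exp (2 * Re (Complex t \<phi>)) * g (z + exp (Complex t \<phi>)))
        \<le> ennreal (exp (2 * t)) * (ennreal (g (z + exp (Complex t \<phi>))) * ?S (z + exp (Complex t \<phi>)))"
      if "t \<in> {-1..0}" for t \<phi>
    proof -
      have "\<bar>Re (exp (Complex t \<phi>))\<bar> \<le> 1" "\<bar>Im (exp (Complex t \<phi>))\<bar> \<le> 1"
        using that abs_Re_le_cmod[of "exp (Complex t \<phi>)"] abs_Im_le_cmod[of "exp (Complex t \<phi>)"]
          exp_le_one_iff[of t] by (auto simp: norm_exp_eq_Re simp del: exp_le_one_iff)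
      then have "?S (z + exp (Complex t \<phi>)) = 1" by (auto simp: indicator_def abs_le_iff)
      then show ?thesis by (simp add: ennreal_mult g)
    qed
    show "continuous_on UNIV (\<lambda>w. exp (2 * Re w) * g (z + exp w))"
      by (intro continuous_intros continuous_on_compose2[OF g(1)]) auto
  qed (auto simp: g(2))
  then show ?thesis by simp
qed

section \<open>Linear growth of the logarithmic energy\<close>

lemma integral_two_periods:
  fixes f :: "real \<Rightarrow> real"
  assumes "continuous_on UNIV f" "\<And>x. f (x + T) = f x" "T \<ge> 0"
  shows "integral {0..2 * T} f = 2 * integral {0..T} f"
proof -
  have int: "f integrable_on {a..b}" for a b
    using assms(1) by (intro integrable_continuous_real) (blast intro: continuous_on_subset)
  have "integral {0..2 * T} f = integral {0..T} f + integral {T..2 * T} f"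
    using assms(3) by (intro Henstock_Kurzweil_Integration.integral_combine[symmetric] int) auto
  also have "integral {T..2 * T} f = integral {0..T} f"
    using integral_shift_real_ivl[of T T "2 * T" f] assms(2) by simp
  finally show ?thesis by simp
qed

context periodic_pair
begin

text \<open>A convex function lies above its tangents: \<open>log_mean'\<close> is nondecreasing
  because its derivative \<open>curvature_mean\<close> is nonnegative.\<close>

lemma log_mean_convex_le:
  assumes "s \<le> t"
  shows "log_mean u v s \<ge> log_mean u v t - log_mean' t * (t - s)"
proof (cases "s = t")
  case False
  with assms have "s < t" by simp
  obtain \<xi> where \<xi>: "s < \<xi>" "\<xi> < t" "log_mean u v t - log_mean u v s = (t - s) * log_mean' \<xi>"
    using MVT2[OF \<open>s < t\<close>, of "log_mean u v" log_mean'] log_mean_deriv by blast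
  have "log_mean' \<xi> \<le> log_mean' t"
    by (rule DERIV_nonneg_imp_nondecreasing) (use \<xi> log_mean'_deriv curvature_mean_nonneg in \<open>auto intro: less_imp_le\<close>)
  then have "(t - s) * log_mean' \<xi> \<le> (t - s) * log_mean' t"
    using \<open>s < t\<close> by (intro mult_left_mono) auto
  with \<xi>(3) show ?thesis by (simp add: algebra_simps)
qed simp

end

text \<open>In logarithmic polar coordinates around \<open>z\<close> the pair is periodic, so its circle
  means are convex functions of the logarithm of the radius; being bounded near the centre they are
  nondecreasing.\<close>

lemma ln_energy_submean:
  assumes u: "u holomorphic_on UNIV" and v: "v holomorphic_on UNIV" and pos: "\<And>z. energy u v z > 0"
  shows "2 * pi * ln (energy u v z)
           \<le> integral {0..2 * pi} (\<lambda>\<phi>. ln (energy u v (z + exp (Complex t \<phi>))))"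
proof -
  let ?T = "\<lambda>w. z + exp w"
  have holT: "?T holomorphic_on UNIV" by (intro holomorphic_intros)
  interpret P: periodic_pair "\<lambda>w. u (?T w)" "\<lambda>w. v (?T w)"
    by unfold_locales
       (simp_all add: energy_compose[of u ?T v] pos exp_add exp_two_pi_i' exp_two_pi_i holomorphic_compose_UNIV[OF u holT]
          holomorphic_compose_UNIV[OF v holT])
  let ?Y = "log_mean (\<lambda>w. u (?T w)) (\<lambda>w. v (?T w))"
  let ?w = "\<lambda>z. ln (energy u v z)"
  have Y: "?Y s = integral {0..2 * pi} (\<lambda>\<phi>. ?w (z + exp (Complex s \<phi>)))" for s
    by (simp add: log_mean_def energy_compose[of u ?T v])
  have integrable: "(\<lambda>\<phi>. ?w (z + exp (Complex s \<phi>))) integrable_on {0..2 * pi}" for s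
    using integrable_continuous_real[OF P.continuous_compose_UNIV[OF P.continuous_ln_energy P.continuous_Complex_right]]
    by (simp add: energy_compose[of u ?T v])
  have nz: "energy u v z \<noteq> 0" for z using pos[of z] by simp
  \<comment> \<open>As s tends to minus infinity the circle shrinks to z, and continuity of ln P
    makes the means converge to 2 pi times its value at z.\<close>
  have near: "\<exists>s0. \<forall>s\<le>s0. \<bar>?Y s - 2 * pi * ?w z\<bar> \<le> 2 * pi * e" if "e > 0" for e
  proof -
    have "continuous_on UNIV (energy u v)" by (intro continuous_on_energy u v)
    then have "continuous_on UNIV ?w"
      by (rule continuous_on_ln) (simp add: nz)
    then have "isCont ?w z"
      by (simp add: continuous_on_eq_continuous_at)
    then obtain d where d: "d > 0" "\<And>w. dist w z < d \<Longrightarrow> dist (?w w) (?w z) < e"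
      using \<open>e > 0\<close> unfolding continuous_at_eps_delta by metis
    show ?thesis
    proof (intro exI[of _ "ln (d / 2)"] allI impI)
      fix s assume "s \<le> ln (d / 2)"
      then have "exp s < d" using d(1) 
        using exp_le_cancel_iff[of s "ln (d / 2)"] by simp
      then have b: "\<bar>?w (z + exp (Complex s \<phi>)) - ?w z\<bar> \<le> e" for \<phi>
        using d(2)[of "z + exp (Complex s \<phi>)"] by (simp add: dist_norm norm_exp_eq_Re)
      have "norm (integral {0..2 * pi} (\<lambda>\<phi>. ?w (z + exp (Complex s \<phi>)) - ?w z)) \<le> integral {0..2 * pi} (\<lambda>\<phi>. e)"
        by (rule integral_norm_bound_integral) (use b integrable in \<open>auto intro!: integrable_diff\<close>)
      moreover have "integral {0..2 * pi} (\<lambda>\<phi>. ?w (z + exp (Complex s \<phi>)) - ?w z) = ?Y s - 2 * pi * ?w z"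
        unfolding Y by (subst Henstock_Kurzweil_Integration.integral_diff[OF integrable]) auto
      ultimately show "\<bar>?Y s - 2 * pi * ?w z\<bar> \<le> 2 * pi * e" by simp
    qed
  qed
  \<comment> \<open>A negative slope somewhere would let the tangent, and with it the convex means,
    tend to plus infinity as s decreases, against their convergence at the centre.\<close>
  have nonneg: "P.log_mean' t \<ge> 0" for t
  proof (rule ccontr)
    assume "\<not> ?thesis"
    then have neg: "- P.log_mean' t > 0" by simp
    obtain s0 where s0: "\<And>s. s \<le> s0 \<Longrightarrow> ?Y s \<le> 2 * pi * ?w z + 2 * pi"
      using near[of 1] by (auto simp: abs_le_iff algebra_simps)
    \<comment> \<open>Going left by \<open>?q\<close> over minus the slope lifts the tangent to 1
      above the bound that holds for all s <= s0.\<close>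
    let ?q = "2 * pi * ?w z + 2 * pi - ?Y t + 1"
    define s where "s = min (min s0 t) (t - ?q / (- P.log_mean' t))"
    have "?q / (- P.log_mean' t) \<le> t - s" unfolding s_def by linarith
    then have "?q \<le> - P.log_mean' t * (t - s)" by (simp only: pos_divide_le_eq[OF neg] mult.commute)
    moreover have "s \<le> t" "s \<le> s0" by (auto simp: s_def)
    ultimately show False using P.log_mean_convex_le[of s t] s0[of s] by simp
  qed
  have "2 * pi * ?w z \<le> ?Y t + e" if "e > 0" for e
  proof -
    obtain s0 where s0: "\<And>s. s \<le> s0 \<Longrightarrow> \<bar>?Y s - 2 * pi * ?w z\<bar> \<le> 2 * pi * (e / (2 * pi))"
      using near[of "e / (2 * pi)"] divide_pos_pos[OF \<open>e > 0\<close>, of "2 * pi"] by auto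
    have "?Y (min s0 t) \<le> ?Y t"
      by (rule DERIV_nonneg_imp_nondecreasing) (use P.log_mean_deriv nonneg in auto)
    then show ?thesis using s0[of "min s0 t"] by (simp add: abs_le_iff)
  qed
  then have "2 * pi * ?w z \<le> ?Y t" by (rule field_le_epsilon)
  then show ?thesis by (simp add: Y)
qed

locale finite_curvature_pair = periodic_pair +
  fixes c :: complex and B :: real
  assumes wronskian_const: "wronskian u v z = c" and c_nonzero: "c \<noteq> 0"
    and curvature_bound: "a < b \<Longrightarrow> integral {a..b} (curvature_mean u v) \<le> B"
begin

lemma continuous_curvature_mean: "continuous_on A (curvature_mean u v)"
  unfolding curvature_mean_def[abs_def] by (rule continuous_on_integral_Complex[OF continuous_curvature])

lemma B_nonneg: "B \<ge> 0"
proof -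
  have "0 \<le> integral {0..1} (curvature_mean u v)"
    by (intro integral_nonneg integrable_continuous_real continuous_curvature_mean curvature_mean_nonneg)
  then show ?thesis using curvature_bound[of 0 1] by simp
qed

text \<open>The slope changes between two radii by the curvature of the annulus between them, which
  is at most \<open>B\<close>.\<close>

lemma log_mean'_bounded: "\<bar>log_mean' t - log_mean' 0\<bar> \<le> B"
proof -
  have *: "\<bar>log_mean' b - log_mean' a\<bar> \<le> B" if "a < b" for a b
  proof -
    have "(curvature_mean u v has_integral (log_mean' b - log_mean' a)) {a..b}"
      by (rule fundamental_theorem_of_calculus)
         (use that log_mean'_deriv in \<open>auto simp: has_real_derivative_iff_has_vector_derivative[symmetric]
            intro: has_field_derivative_at_within\<close>)
    then have "integral {a..b} (curvature_mean u v) = log_mean' b - log_mean' a" by (rule integral_unique)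
    moreover have "integral {a..b} (curvature_mean u v) \<ge> 0"
      by (intro integral_nonneg integrable_continuous_real continuous_curvature_mean curvature_mean_nonneg)
    ultimately show ?thesis using curvature_bound[OF that] by simp
  qed
  show ?thesis using *[of 0 t] *[of t 0] B_nonneg by (cases t "0::real" rule: linorder_cases) (auto simp: abs_minus_commute)
qed

lemma log_mean_linear: "\<exists>C. \<forall>t. log_mean u v t \<le> C * (1 + \<bar>t\<bar>)"
proof (intro exI allI)
  fix t :: real
  let ?D = "\<bar>log_mean' 0\<bar> + B"
  have "norm (log_mean u v t - log_mean u v 0) \<le> ?D * norm (t - 0)"
  proof (rule field_differentiable_bound[of UNIV _ log_mean'])
    show "(log_mean u v has_field_derivative log_mean' z) (at z within UNIV)" for z
      using log_mean_deriv by simp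
    show "norm (log_mean' z) \<le> ?D" for z using log_mean'_bounded[of z] by simp
  qed auto
  then have "log_mean u v t \<le> \<bar>log_mean u v 0\<bar> + ?D * \<bar>t\<bar>"
    unfolding real_norm_def diff_0_right by linarith
  moreover have "0 \<le> \<bar>log_mean u v 0\<bar> * \<bar>t\<bar>" by simp
  moreover have "?D \<ge> 0" using B_nonneg by simp
  ultimately show "log_mean u v t \<le> (\<bar>log_mean u v 0\<bar> + ?D) * (1 + \<bar>t\<bar>)"
    unfolding distrib_left distrib_right by linarith
qed

text \<open>The submean inequality, integrated over an annulus about z, bounds ln P at z by the
  integral of max 0 (ln P) over a square. Nonnegativity of this integrand permits enlarging the
  domain, first to the square and then to full periods. Replacing it by ln P costs a multiple of the
  curvature, and the circle means of ln P grow linearly.\<close>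

lemma energy_growth: "\<exists>C. \<forall>z. energy u v z \<le> exp (C * (1 + \<bar>Re z\<bar>))"
proof -
  let ?w = "\<lambda>z. ln (energy u v z)"
  let ?p = "\<lambda>z. max 0 (?w z)"
  obtain C where C: "\<And>t. log_mean u v t \<le> C * (1 + \<bar>t\<bar>)" using log_mean_linear by blast
  have contp: "continuous_on UNIV ?p" by (intro continuous_intros continuous_energy) simp
  \<comment> \<open>ln x <= x - 1 at x = 1 / P^2 bounds - 2 ln P by 1 / P^2; the constant Wronskian
    turns this into the curvature density divided by 4 |c|^2.\<close>
  have p_le: "?p z \<le> ?w z + 4 * (cmod (wronskian u v z))\<^sup>2 / (energy u v z)\<^sup>2 / (4 * (cmod c)\<^sup>2)" for z
  proof -
    have E: "energy u v z > 0" by (rule energy_pos)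
    have "ln (1 / (energy u v z)\<^sup>2) \<le> 1 / (energy u v z)\<^sup>2 - 1"
      by (rule ln_le_minus_one) (use E in simp)
    then have "- 2 * ?w z \<le> 1 / (energy u v z)\<^sup>2" using E by (simp add: ln_div ln_realpow)
    moreover have "1 / (energy u v z)\<^sup>2 \<ge> 0" by simp
    ultimately have "?p z \<le> ?w z + 1 / (energy u v z)\<^sup>2" by (smt (verit))
    also have "1 / (energy u v z)\<^sup>2 = 4 * (cmod (wronskian u v z))\<^sup>2 / (energy u v z)\<^sup>2 / (4 * (cmod c)\<^sup>2)"
      using c_nonzero by (simp add: wronskian_const)
    finally show ?thesis .
  qed
  have p_mean: "integral {0..2 * pi} (\<lambda>\<theta>. ?p (Complex t \<theta>))
      \<le> log_mean u v t + curvature_mean u v t / (4 * (cmod c)\<^sup>2)" for t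
  proof -
    let ?k = "\<lambda>z. 4 * (cmod (wronskian u v z))\<^sup>2 / (energy u v z)\<^sup>2"
    have int: "(\<lambda>\<theta>. ?p (Complex t \<theta>)) integrable_on {0..2 * pi}" "(\<lambda>\<theta>. ?w (Complex t \<theta>)) integrable_on {0..2 * pi}"
      "(\<lambda>\<theta>. ?k (Complex t \<theta>)) integrable_on {0..2 * pi}"
      by (intro integrable_continuous_real continuous_compose_UNIV[OF contp]
          continuous_compose_UNIV[OF continuous_ln_energy] continuous_compose_UNIV[OF continuous_curvature]
          continuous_Complex_right)+
    note int3 = integrable_on_divide[OF int(3), of "4 * (cmod c)\<^sup>2"]
    have "integral {0..2 * pi} (\<lambda>\<theta>. ?p (Complex t \<theta>))
        \<le> integral {0..2 * pi} (\<lambda>\<theta>. ?w (Complex t \<theta>) + ?k (Complex t \<theta>) / (4 * (cmod c)\<^sup>2))"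
      by (rule integral_le[OF int(1) integrable_add[OF int(2) int3]]) (rule p_le)
    also have "\<dots> = log_mean u v t + curvature_mean u v t / (4 * (cmod c)\<^sup>2)"
      unfolding log_mean_def curvature_mean_def Henstock_Kurzweil_Integration.integral_add[OF int(2) int3]
        integral_divide ..
    finally show ?thesis .
  qed
  have p_per: "?p (Complex t (\<theta> + 2 * pi)) = ?p (Complex t \<theta>)" for t \<theta>
    using energy_periodic[of "Complex t \<theta>"] by (simp add: Complex_eq algebra_simps)
  \<comment> \<open>The sum 4 |C| * 2 + 2 B / (4 |c|^2) bounds the integral over two periods in y
    and an interval of length 2 in x, up to the factor 1 + |Re z|. The 5 comes from
    \<open>integral_disc_le_integral_square\<close>, and pi (1 - exp (-2)) is the area of the
    annulus over which the submean inequality is integrated.\<close>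
  define C' where "C' = (4 * \<bar>C\<bar> * 2 + 2 * B / (4 * (cmod c)\<^sup>2)) * 5 / (pi * (1 - exp (-2)))"
  have e2: "1 - exp (-2 :: real) > 0" by simp
  \<comment> \<open>For these z the interval from Im z - 1 to Im z + 1 lies within [0, 4 pi], that
    is, within two periods. All other z are reached by periodicity below.\<close>
  have main: "?w z \<le> C' * (1 + \<bar>Re z\<bar>)" if z: "Im z \<in> {pi..3 * pi}" for z
  proof -
    have sub: "exp (2 * t) * (2 * pi * ?w z) \<le> integral {0..2 * pi} (\<lambda>\<phi>. exp (2 * t) * ?p (z + exp (Complex t \<phi>)))" for t
    proof -
      have "2 * pi * ?w z \<le> integral {0..2 * pi} (\<lambda>\<phi>. ?w (z + exp (Complex t \<phi>)))"
        by (rule ln_energy_submean[OF holo_u holo_v energy_pos])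
      also have "\<dots> \<le> integral {0..2 * pi} (\<lambda>\<phi>. ?p (z + exp (Complex t \<phi>)))"
        by (rule integral_le) (auto intro!: integrable_continuous_real continuous_compose_UNIV[OF contp]
            continuous_compose_UNIV[OF continuous_ln_energy] continuous_intros continuous_Complex_right)
      finally show ?thesis by simp
    qed
    let ?K = "4 * \<bar>C\<bar> * (1 + \<bar>Re z\<bar>)"
    let ?c = "\<lambda>x. 2 * (curvature_mean u v x / (4 * (cmod c)\<^sup>2))"
    have intK: "(\<lambda>x. ?K) integrable_on {a..b}" for a b :: real by (rule integrable_const_ivl)
    have intc: "?c integrable_on {a..b}" for a b
      by (intro integrable_continuous_real continuous_intros continuous_curvature_mean) (use c_nonzero in simp)
    have contg: "continuous_on UNIV (\<lambda>w. exp (2 * Re w) * ?p (z + exp w))"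
      by (intro continuous_intros continuous_compose_UNIV[OF contp])
    have "((\<lambda>t. exp (2 * t) * (2 * pi * ?w z)) has_integral
        (exp (2 * 0) / 2 * (2 * pi * ?w z) - exp (2 * (-1)) / 2 * (2 * pi * ?w z))) {-1..0}"
      by (rule fundamental_theorem_of_calculus)
         (auto simp: has_real_derivative_iff_has_vector_derivative[symmetric] intro!: derivative_eq_intros)
    then have i1: "integral {-1..0} (\<lambda>t. exp (2 * t) * (2 * pi * ?w z)) = (1 - exp (-2)) * pi * ?w z"
      by (subst integral_unique, assumption) (simp add: algebra_simps)
    have "(1 - exp (-2)) * pi * ?w z \<le> integral {-1..0}
          (\<lambda>t. integral {0..2 * pi} (\<lambda>\<phi>. exp (2 * t) * ?p (z + exp (Complex t \<phi>))))"
      unfolding i1[symmetric]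
    proof (rule integral_le)
      show "(\<lambda>t. exp (2 * t) * (2 * pi * ?w z)) integrable_on {-1..0}"
        by (intro integrable_continuous_real continuous_intros)
      show "(\<lambda>t. integral {0..2 * pi} (\<lambda>\<phi>. exp (2 * t) * ?p (z + exp (Complex t \<phi>)))) integrable_on {-1..0}"
        using integrable_continuous_real[OF continuous_on_integral_Complex[OF contg]] by simp
    qed (use sub in auto)
    also have "\<dots> \<le> 5 * integral {Re z - 1..Re z + 1} (\<lambda>x. integral {Im z - 1..Im z + 1} (\<lambda>y. ?p (Complex x y)))"
      by (rule integral_disc_le_integral_square[OF contp]) simp
    also have "\<dots> \<le> 5 * integral {Re z - 1..Re z + 1} (\<lambda>x. ?K + ?c x)"
    proof (intro mult_left_mono integral_le)
      fix x assume x: "x \<in> {Re z - 1..Re z + 1}"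
      have "integral {Im z - 1..Im z + 1} (\<lambda>y. ?p (Complex x y)) \<le> integral {0..2 * (2 * pi)} (\<lambda>y. ?p (Complex x y))"
      proof (rule integral_subset_le)
        have "pi > 1" using pi_gt3 by simp
        with z show "{Im z - 1..Im z + 1} \<subseteq> {0..2 * (2 * pi)}" by auto
      qed (rule integrable_continuous_real continuous_compose_UNIV[OF contp continuous_Complex_right] | simp)+
      also have "\<dots> = 2 * integral {0..2 * pi} (\<lambda>y. ?p (Complex x y))"
        by (rule integral_two_periods) (rule continuous_compose_UNIV[OF contp continuous_Complex_right] p_per pi_ge_zero | simp)+
      also have "\<dots> \<le> 2 * (C * (1 + \<bar>x\<bar>) + curvature_mean u v x / (4 * (cmod c)\<^sup>2))"
        using p_mean[of x] C[of x] by simp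
      also have "C * (1 + \<bar>x\<bar>) \<le> \<bar>C\<bar> * (2 * (1 + \<bar>Re z\<bar>))"
        by (rule mult_mono) (use x in auto)
      finally show "integral {Im z - 1..Im z + 1} (\<lambda>y. ?p (Complex x y))
          \<le> 4 * \<bar>C\<bar> * (1 + \<bar>Re z\<bar>) + 2 * (curvature_mean u v x / (4 * (cmod c)\<^sup>2))" by (simp add: algebra_simps)
    next
      show "(\<lambda>x. integral {Im z - 1..Im z + 1} (\<lambda>y. ?p (Complex x y))) integrable_on {Re z - 1..Re z + 1}"
        by (intro integrable_continuous_real continuous_on_integral_Complex[OF contp])
      show "(\<lambda>x. ?K + ?c x) integrable_on {Re z - 1..Re z + 1}"
        by (rule integrable_add[OF intK intc])
    qed simp
    also have "integral {Re z - 1..Re z + 1} (\<lambda>x. ?K + ?c x)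
        = ?K * 2 + 2 * (integral {Re z - 1..Re z + 1} (curvature_mean u v) / (4 * (cmod c)\<^sup>2))"
      unfolding Henstock_Kurzweil_Integration.integral_add[OF intK intc]
        integral_mult_right integral_divide by simp
    also have "\<dots> \<le> 4 * \<bar>C\<bar> * (1 + \<bar>Re z\<bar>) * 2 + 2 * (B / (4 * (cmod c)\<^sup>2))"
      by (intro add_left_mono mult_left_mono divide_right_mono curvature_bound) auto
    also have "\<dots> \<le> (4 * \<bar>C\<bar> * 2 + 2 * B / (4 * (cmod c)\<^sup>2)) * (1 + \<bar>Re z\<bar>)"
    proof -
      have "2 * (B / (4 * (cmod c)\<^sup>2)) * 1 \<le> 2 * (B / (4 * (cmod c)\<^sup>2)) * (1 + \<bar>Re z\<bar>)"
        by (intro mult_left_mono) (use B_nonneg in auto)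
      then show ?thesis by (simp add: algebra_simps)
    qed
    finally have "(1 - exp (-2)) * pi * ?w z \<le> 5 * ((4 * \<bar>C\<bar> * 2 + 2 * B / (4 * (cmod c)\<^sup>2)) * (1 + \<bar>Re z\<bar>))"
      by simp
    moreover have "(1 - exp (-2)) * pi * (C' * (1 + \<bar>Re z\<bar>)) = 5 * ((4 * \<bar>C\<bar> * 2 + 2 * B / (4 * (cmod c)\<^sup>2)) * (1 + \<bar>Re z\<bar>))"
      using e2 by (simp add: C'_def)
    ultimately have "((1 - exp (-2)) * pi) * ?w z \<le> ((1 - exp (-2)) * pi) * (C' * (1 + \<bar>Re z\<bar>))" by linarith
    then show ?thesis using e2 by (subst (asm) mult_le_cancel_left_pos) auto
  qed
  show ?thesis
  proof (intro exI[of _ C'] allI)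
    fix z
    obtain k :: int and y where y: "y \<in> {pi..3 * pi}" "Im z = y + of_int k * (2 * pi)"
    proof
      let ?k = "\<lfloor>(Im z - pi) / (2 * pi)\<rfloor>"
      have "of_int ?k \<le> (Im z - pi) / (2 * pi)" "(Im z - pi) / (2 * pi) < of_int ?k + 1" by linarith+
      then have "of_int ?k * (2 * pi) \<le> Im z - pi" "Im z - pi < (of_int ?k + 1) * (2 * pi)"
        by (simp_all only: pos_le_divide_eq pos_divide_less_eq pi_gt_zero zero_less_mult_iff zero_less_numeral simp_thms)
      then show "Im z - of_int ?k * (2 * pi) \<in> {pi..3 * pi}" by (simp add: distrib_right)
    qed simp
    have "energy u v (w + of_nat n * (2 * of_real pi * \<i>)) = energy u v w" for w n
    proof (induction n)
      case (Suc n)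
      then show ?case using energy_periodic[of "w + of_nat n * (2 * of_real pi * \<i>)"]
        by (simp add: algebra_simps)
    qed simp
    note nat_shift = this
    have "energy u v z = energy u v (Complex (Re z) y)"
    proof (cases "k \<ge> 0")
      case True
      have "z = Complex (Re z) y + of_nat (nat k) * (2 * of_real pi * \<i>)"
        using True y(2) by (simp add: complex_eq_iff)
      then show ?thesis using nat_shift by metis
    next
      case False
      have "Complex (Re z) y = z + of_nat (nat (- k)) * (2 * of_real pi * \<i>)"
        using False y(2) by (simp add: complex_eq_iff)
      then show ?thesis using nat_shift by metis
    qed
    moreover have "energy u v (Complex (Re z) y) \<le> exp (C' * (1 + \<bar>Re z\<bar>))"
      using main[of "Complex (Re z) y"] y(1) energy_pos[of "Complex (Re z) y"]
      by (metis (no_types, lifting) complex.sel exp_le_cancel_iff exp_ln)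
    ultimately show "energy u v z \<le> exp (C' * (1 + \<bar>Re z\<bar>))" by simp
  qed
qed

end

section \<open>The potential is constant\<close>

lemma periodic_norm_shift:
  fixes z :: complex
  assumes "\<And>z :: complex. f (z + 2 * of_real pi * \<i>) = f z"
  obtains w where "Re w = Re z" "Im w \<in> {0..2 * pi}" "f w = f z"
proof -
  define k where "k = \<lfloor>Im z / (2 * pi)\<rfloor>"
  have "of_int k \<le> Im z / (2 * pi)" "Im z / (2 * pi) < of_int k + 1" unfolding k_def by linarith+
  then have k: "of_int k * (2 * pi) \<le> Im z" "Im z < (of_int k + 1) * (2 * pi)"
    by (simp_all only: pos_le_divide_eq pos_divide_less_eq pi_gt_zero zero_less_mult_iff zero_less_numeral simp_thms)
  let ?w = "z - of_int k * (2 * of_real pi * \<i>)"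
  have nat_shift: "f (w + of_nat n * (2 * of_real pi * \<i>)) = f w" for w n
  proof (induction n)
    case (Suc n)
    then show ?case using assms[of "w + of_nat n * (2 * of_real pi * \<i>)"]
      by (simp add: algebra_simps)
  qed simp
  have "f ?w = f z"
  proof (cases "k \<ge> 0")
    case True
    have "z = ?w + of_nat (nat k) * (2 * of_real pi * \<i>)"
      using True by (simp add: complex_eq_iff)
    then show ?thesis using nat_shift by metis
  next
    case False
    have "?w = z + of_nat (nat (- k)) * (2 * of_real pi * \<i>)"
      using False by (simp add: complex_eq_iff)
    then show ?thesis using nat_shift by metis
  qed
  moreover have "Re ?w = Re z" "Im ?w \<in> {0..2 * pi}" using k by (simp_all add: distrib_right)
  ultimately show ?thesis using that by blast
qed

text \<open>Periodicity is asked of the modulus, since unitary monodromy of a pair multiplies its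
  Wronskian by a unit. Beyond the two half planes a compact rectangle represents all values of the
  modulus, so f is bounded and Liouville's theorem applies.\<close>

lemma periodic_bounded_imp_const:
  assumes f: "f holomorphic_on UNIV" and per: "\<And>z. cmod (f (z + 2 * of_real pi * \<i>)) = cmod (f z)"
    and left: "\<And>z. Re z \<le> a \<Longrightarrow> cmod (f z) \<le> K" and right: "\<And>z. Re z \<ge> b \<Longrightarrow> cmod (f z) \<le> K"
  shows "\<exists>c. \<forall>z. f z = c"
proof -
  have "compact (cbox (Complex a 0) (Complex b (2 * pi)))" by simp
  then have "compact ((\<lambda>z. cmod (f z)) ` cbox (Complex a 0) (Complex b (2 * pi)))"
    by (intro compact_continuous_image continuous_intros)
       (use f holomorphic_on_imp_continuous_on continuous_on_subset in blast)
  then obtain L where L: "\<And>z. z \<in> cbox (Complex a 0) (Complex b (2 * pi)) \<Longrightarrow> cmod (f z) \<le> L"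
    using compact_imp_bounded bounded_real by (metis (no_types, lifting) abs_norm_cancel image_eqI)
  have "cmod (f z) \<le> max K L" for z
  proof -
    obtain w where w: "Re w = Re z" "Im w \<in> {0..2 * pi}" "cmod (f w) = cmod (f z)"
      using periodic_norm_shift[of "\<lambda>z. cmod (f z)" z] per by metis
    show ?thesis
    proof (cases "Re z \<le> a \<or> Re z \<ge> b")
      case True
      then show ?thesis using left[of z] right[of z] by auto
    next
      case False
      then have "w \<in> cbox (Complex a 0) (Complex b (2 * pi))"
        using w by (auto simp: in_cbox_complex_iff)
      then show ?thesis using L[of w] w(3) by simp
    qed
  qed
  then have "bounded (range f)" unfolding bounded_iff by blast
  then show ?thesis using Liouville_theorem[OF f] by (metis UNIV_I constant_on_def)
qed

lemma periodic_factors_through_exp: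
  assumes f: "f holomorphic_on UNIV" and per: "\<And>z. f (z + 2 * of_real pi * \<i>) = f z"
  obtains F where "F holomorphic_on - {0}" "\<And>z. F (exp z) = f z"
proof -
  let ?F = "\<lambda>z. f (Ln z)"
  have F: "?F (exp z) = f z" for z
  proof -
    obtain n :: int where n: "Ln (exp z) = z + (of_int (2 * n) * of_real pi) * \<i>"
      using exp_eq[of "Ln (exp z)" z] by auto
    have int_shift: "f (w + of_int k * (2 * of_real pi * \<i>)) = f w" for w k
    proof (induction k rule: int_induct[of _ 0])
      case (step1 k)
      then show ?case using per[of "w + of_int k * (2 * of_real pi * \<i>)"] by (simp add: algebra_simps)
    next
      case (step2 k)
      then show ?case using per[of "w + of_int (k - 1) * (2 * of_real pi * \<i>)"] by (simp add: algebra_simps)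
    qed simp
    have "Ln (exp z) = z + of_int n * (2 * of_real pi * \<i>)" using n by simp
    then show ?thesis using int_shift by metis
  qed
  have "?F holomorphic_on - {0}"
    unfolding holomorphic_on_def
  proof
    fix z0 :: complex assume z0: "z0 \<in> - {0}"
    \<comment> \<open>A branch of the logarithm near \<open>z0\<close>, whose cut is turned away
      from \<open>z0\<close>. It differs from \<open>Ln\<close> by periods of f, so f has the same
      values along both, and holomorphy across the cut of \<open>Ln\<close> follows.\<close>
    let ?l = "\<lambda>z. Ln (z / z0) + Ln z0"
    let ?X = "{z. z / z0 \<notin> \<real>\<^sub>\<le>\<^sub>0}"
    have oX: "open ?X"
    proof -
      have "open ((\<lambda>z. z / z0) -` (- \<real>\<^sub>\<le>\<^sub>0))"
        by (intro open_vimage) (auto intro!: continuous_intros simp: z0[simplified] closed_nonpos_Reals_complex)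
      then show ?thesis by (simp add: vimage_def Compl_eq)
    qed
    have z0X: "z0 \<in> ?X" using z0 by simp
    have "(\<lambda>z. f (?l z)) holomorphic_on ?X"
      by (rule holomorphic_compose_UNIV[OF f]) (use z0 in \<open>auto intro!: holomorphic_intros\<close>)
    moreover have "f (?l z) = ?F z" if "z \<in> ?X" for z
    proof -
      have "z \<noteq> 0" using that by auto
      then have "exp (?l z) = z" using z0 by (simp add: exp_add)
      then show ?thesis using F[of "?l z"] by simp
    qed
    ultimately have "?F holomorphic_on ?X" by (rule holomorphic_transform)
    then have "?F field_differentiable at z0"
      using oX z0X holomorphic_on_imp_differentiable_at by blast
    then show "?F field_differentiable at z0 within - {0}" by (rule field_differentiable_at_within)
  qed
  with F that show ?thesis by blast
qed

text \<open>The coefficient \<open>\<psi>\<close> of the equation \<open>f'' = \<psi> f\<close> solved by both members of a pair with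
  constant Wronskian \<open>c\<close>.\<close>

definition potential :: "(complex \<Rightarrow> complex) \<Rightarrow> (complex \<Rightarrow> complex) \<Rightarrow> complex \<Rightarrow> complex \<Rightarrow> complex" where
  "potential u v c z = (deriv (deriv u) z * deriv v z - deriv u z * deriv (deriv v) z) / c"

locale entire_pair =
  fixes u v :: "complex \<Rightarrow> complex" and c :: complex
  assumes u: "u holomorphic_on UNIV" and v: "v holomorphic_on UNIV"
    and wronskian: "\<And>z. wronskian u v z = c" and c: "c \<noteq> 0"
begin

lemma holo: "deriv u holomorphic_on UNIV" "deriv v holomorphic_on UNIV"
  "deriv (deriv u) holomorphic_on UNIV" "deriv (deriv v) holomorphic_on UNIV"
  by (auto intro!: holomorphic_deriv u v)

text \<open>Differentiating the constant Wronskian gives u v'' = u'' v. So (u'', v'') is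
  proportional to (u, v), and Cramer's rule with determinant c yields the factor.\<close>

lemma second_deriv: "deriv (deriv u) z = potential u v c z * u z" "deriv (deriv v) z = potential u v c z * v z"
proof -
  have D: "f holomorphic_on UNIV \<Longrightarrow> (f has_field_derivative deriv f z) (at z)" for f :: "complex \<Rightarrow> complex"
    by (rule holomorphic_derivI[of _ UNIV]) auto
  have "((\<lambda>z. u z * deriv v z - deriv u z * v z) has_field_derivative
      u z * deriv (deriv v) z - deriv (deriv u) z * v z) (at z)"
    by (rule derivative_eq_intros D u v holo refl)+ (simp add: algebra_simps)
  moreover have "(\<lambda>z. u z * deriv v z - deriv u z * v z) = (\<lambda>z. c)"
    using wronskian by (simp add: wronskian_def fun_eq_iff)
  ultimately have "((\<lambda>z. c) has_field_derivative u z * deriv (deriv v) z - deriv (deriv u) z * v z) (at z)" by simp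
  then have 0: "u z * deriv (deriv v) z = deriv (deriv u) z * v z"
    using DERIV_unique[OF _ DERIV_const] by fastforce
  have W: "c = u z * deriv v z - deriv u z * v z" using wronskian[of z] by (simp add: wronskian_def)
  have "deriv (deriv u) z * c = (deriv (deriv u) z * deriv v z - deriv u z * deriv (deriv v) z) * u z"
    unfolding W using 0 by algebra
  then show "deriv (deriv u) z = potential u v c z * u z"
    using c by (simp add: potential_def field_simps)
  have "deriv (deriv v) z * c = (deriv (deriv u) z * deriv v z - deriv u z * deriv (deriv v) z) * v z"
    unfolding W using 0 by algebra
  then show "deriv (deriv v) z = potential u v c z * v z"
    using c by (simp add: potential_def field_simps)
qed

lemma energy_pos: "energy u v z > 0"
  by (rule energy_pos_if_wronskian) (simp add: wronskian c)

text \<open>Exhibits psi as P_zz / P: it depends on P alone, so it inherits the period of P, and it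
  can be estimated through P.\<close>

lemma energy_zz_eq_potential: "energy_zz u v z = potential u v c z * of_real (energy u v z)"
  by (simp add: energy_zz_def second_deriv energy_complex algebra_simps)

lemma holo_potential: "potential u v c holomorphic_on UNIV"
  unfolding potential_def[abs_def] by (intro holomorphic_intros holo c)

text \<open>Cauchy's estimates on the unit circle about z, where u and v are at most
  \<open>sqrt M\<close>.\<close>

lemma deriv_bounds:
  assumes "\<And>w. dist z w \<le> 1 \<Longrightarrow> energy u v w \<le> M"
  shows "cmod (deriv u z) \<le> sqrt M" "cmod (deriv v z) \<le> sqrt M"
    "cmod (deriv (deriv u) z) \<le> 2 * sqrt M" "cmod (deriv (deriv v) z) \<le> 2 * sqrt M"
proof -
  have *: "cmod ((deriv ^^ n) f z) \<le> fact n * sqrt M"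
    if "f holomorphic_on UNIV" "\<And>w. (cmod (f w))\<^sup>2 \<le> energy u v w" for f n
  proof -
    have "norm (f w) \<le> sqrt M" if "norm (z - w) = 1" for w
      using \<open>\<And>w. (cmod (f w))\<^sup>2 \<le> energy u v w\<close>[of w] assms[of w] that
      by (intro real_le_rsqrt) (auto simp: dist_norm)
    from Cauchy_inequality[OF holomorphic_on_subset[OF that(1)]
        holomorphic_on_imp_continuous_on[OF holomorphic_on_subset[OF that(1)]] zero_less_one this]
    show ?thesis by simp
  qed
  show "cmod (deriv u z) \<le> sqrt M" "cmod (deriv v z) \<le> sqrt M"
    using *[OF u norm_sq_le_energy(1), of 1] *[OF v norm_sq_le_energy(2), of 1] by simp_all
  show "cmod (deriv (deriv u) z) \<le> 2 * sqrt M" "cmod (deriv (deriv v) z) \<le> 2 * sqrt M"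
    using *[OF u norm_sq_le_energy(1), of 2] *[OF v norm_sq_le_energy(2), of 2] by (simp_all add: numeral_2_eq_2)
qed

lemma norm_le_sqrt_energy: "cmod (u z) \<le> sqrt (energy u v z)" "cmod (v z) \<le> sqrt (energy u v z)"
  using norm_sq_le_energy by (auto intro: real_le_rsqrt)

text \<open>The nonzero Wronskian keeps P from being small where it is bounded nearby: |c| <= |u|
  |v'| + |u'| |v|, with the derivatives bounded by \<open>deriv_bounds\<close>.\<close>

lemma energy_lower_bound:
  assumes "\<And>w. dist z w \<le> 1 \<Longrightarrow> energy u v w \<le> M"
  shows "(cmod c)\<^sup>2 \<le> 4 * M * energy u v z"
proof -
  have M: "M > 0" using assms[of z] energy_pos[of z] by simp
  have "cmod c \<le> cmod (u z) * cmod (deriv v z) + cmod (deriv u z) * cmod (v z)"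
    unfolding wronskian[of z, symmetric] wronskian_def
    by (metis norm_mult norm_triangle_ineq4)
  also have "\<dots> \<le> sqrt (energy u v z) * sqrt M + sqrt M * sqrt (energy u v z)"
    by (intro add_mono mult_mono norm_le_sqrt_energy deriv_bounds assms) (use M in auto)
  finally have "cmod c \<le> 2 * sqrt (M * energy u v z)" by (simp add: real_sqrt_mult)
  then have "(cmod c)\<^sup>2 \<le> (2 * sqrt (M * energy u v z))\<^sup>2" by (intro power_mono) auto
  then show ?thesis using M by (simp add: power_mult_distrib)
qed

text \<open>The left side is |P_zz|, at most |u''| |u| + |v''| |v|; each product is at most 2 M by
  the estimates on the unit disc.\<close>

lemma potential_energy_le:
  assumes "\<And>w. dist z w \<le> 1 \<Longrightarrow> energy u v w \<le> M"
  shows "cmod (potential u v c z) * energy u v z \<le> 4 * M"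
proof -
  have M: "M > 0" "energy u v z \<le> M" using assms[of z] energy_pos[of z] by simp_all
  have sq: "sqrt (energy u v z) \<le> sqrt M" using M by simp
  have "cmod (potential u v c z) * energy u v z = cmod (energy_zz u v z)"
    by (simp add: energy_zz_eq_potential norm_mult)
  also have "\<dots> \<le> cmod (deriv (deriv u) z) * cmod (u z) + cmod (deriv (deriv v) z) * cmod (v z)"
    unfolding energy_zz_def by (metis norm_mult norm_triangle_ineq complex_mod_cnj)
  also have "\<dots> \<le> (2 * sqrt M) * sqrt M + (2 * sqrt M) * sqrt M"
    by (intro add_mono mult_mono deriv_bounds assms order_trans[OF norm_le_sqrt_energy(1) sq]
        order_trans[OF norm_le_sqrt_energy(2) sq]) (use M in auto)
  finally show ?thesis using M by simp
qed

text \<open>The reflection z -> - z exchanges the two ends, so that results on the left end carry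
  over to the right one. It turns the Wronskian into its negative.\<close>

lemma reflected: "entire_pair (\<lambda>z. u (- z)) (\<lambda>z. v (- z)) (- c)"
  and energy_reflected: "energy (\<lambda>z. u (- z)) (\<lambda>z. v (- z)) z = energy u v (- z)"
  and potential_reflected: "potential (\<lambda>z. u (- z)) (\<lambda>z. v (- z)) (- c) z = potential u v c (- z)"
proof -
  have neg: "(\<lambda>z::complex. - z) holomorphic_on UNIV" by (intro holomorphic_intros)
  have d: "deriv (\<lambda>z. f (- z)) = (\<lambda>z. - deriv f (- z))" if "f holomorphic_on UNIV" for f
    by (rule ext, subst deriv_compose_UNIV[OF that, of _ "-1"]) (auto intro!: derivative_eq_intros)
  have d2: "deriv (\<lambda>z. - f (- z)) = (\<lambda>z. deriv f (- z))" if "f holomorphic_on UNIV" for f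
  proof
    fix z
    have "(\<lambda>z. - f z) holomorphic_on UNIV" using that by (intro holomorphic_intros)
    then have "deriv (\<lambda>z. - f (- z)) z = deriv (\<lambda>z. - f z) (- z) * -1"
      by (intro deriv_compose_UNIV[of "\<lambda>z. - f z" uminus]) (auto intro!: derivative_eq_intros)
    also have "deriv (\<lambda>z. - f z) (- z) = - deriv f (- z)"
      using that by (intro deriv_minus) (auto simp: holomorphic_on_def)
    finally show "deriv (\<lambda>z. - f (- z)) z = deriv f (- z)" by simp
  qed
  show "entire_pair (\<lambda>z. u (- z)) (\<lambda>z. v (- z)) (- c)"
    using holomorphic_compose_UNIV[OF u neg] holomorphic_compose_UNIV[OF v neg] c
      wronskian[unfolded wronskian_def]
    by unfold_locales (auto simp: wronskian_def d[OF u] d[OF v] algebra_simps minus_equation_iff[of c])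
  show "energy (\<lambda>z. u (- z)) (\<lambda>z. v (- z)) z = energy u v (- z)" by (simp add: energy_def)
  show "potential (\<lambda>z. u (- z)) (\<lambda>z. v (- z)) (- c) z = potential u v c (- z)"
    by (simp add: potential_def d[OF u] d[OF v] d2[OF holo(1)] d2[OF holo(2)] minus_divide_left)
qed

text \<open>If the potential, as a function of \<open>exp z\<close>, had a pole at the left end, then
  \<open>potential_energy_le\<close> would improve any exponential bound for the energy by an arbitrary factor
  with each unit step, against the exponential lower bound.\<close>

lemma potential_bounded_left:
  assumes per: "\<And>z. potential u v c (z + 2 * of_real pi * \<i>) = potential u v c z"
    and growth: "\<And>z. energy u v z \<le> exp (C * (1 + \<bar>Re z\<bar>))"
  shows "\<exists>a K. \<forall>z. Re z \<le> a \<longrightarrow> cmod (potential u v c z) \<le> K"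
proof -
  let ?\<psi> = "potential u v c"
  define D where "D = \<bar>C\<bar>"
  have growth': "energy u v z \<le> exp (D * (1 + \<bar>Re z\<bar>))" for z
    by (rule order_trans[OF growth]) (auto simp: D_def intro!: mult_right_mono)
  have ball: "energy u v w \<le> exp (D * (2 + \<bar>Re z\<bar>))" if "dist z w \<le> 1" for z w
  proof -
    have "\<bar>Re z - Re w\<bar> \<le> 1" using abs_Re_le_cmod[of "z - w"] that by (simp add: dist_norm)
    then have "D * (1 + \<bar>Re w\<bar>) \<le> D * (2 + \<bar>Re z\<bar>)" by (intro mult_left_mono) (auto simp: D_def)
    then show ?thesis using growth'[of w] by (meson exp_le_cancel_iff order_trans)
  qed
  have lower: "(cmod c)\<^sup>2 \<le> 4 * exp (D * (2 + \<bar>Re z\<bar>)) * energy u v z" for z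
    by (rule energy_lower_bound[OF ball])
  have psi_le: "(cmod c)\<^sup>2 * cmod (?\<psi> z) \<le> 16 * exp (2 * (D * (2 + \<bar>Re z\<bar>)))" for z
  proof -
    have "(cmod c)\<^sup>2 * cmod (?\<psi> z) \<le> 4 * exp (D * (2 + \<bar>Re z\<bar>)) * (cmod (?\<psi> z) * energy u v z)"
      using mult_right_mono[OF lower[of z], of "cmod (?\<psi> z)"] by (simp add: mult_ac)
    also have "\<dots> \<le> 4 * exp (D * (2 + \<bar>Re z\<bar>)) * (4 * exp (D * (2 + \<bar>Re z\<bar>)))"
      by (intro mult_left_mono potential_energy_le ball) auto
    finally show ?thesis by (simp add: exp_double power2_eq_square)
  qed
  obtain F where F: "F holomorphic_on - {0}" "\<And>z. F (exp z) = ?\<psi> z"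
    using periodic_factors_through_exp[OF holo_potential per] by blast
  \<comment> \<open>In the variable x = exp z the bound on psi is a multiple of |x| to the power - 2
    D. Multiplication by x^N with N >= 2 D makes F bounded near 0, so the singularity is at worst a
    pole.\<close>
  define N where "N = nat \<lceil>2 * D\<rceil>"
  have "2 * D \<ge> 0" by (simp add: D_def)
  then have N: "2 * D \<le> real N" unfolding N_def by linarith
  have bnd: "cmod (z ^ N * F z) \<le> 16 * exp (4 * D) / (cmod c)\<^sup>2" if z: "z \<in> ball 0 1 - {0}" for z
  proof -
    let ?w = "Ln z"
    have z': "z \<noteq> 0" "cmod z < 1" "cmod z > 0" using z by auto
    have Re: "Re ?w = ln (cmod z)" "ln (cmod z) < 0" using z' by (simp_all add: Re_Ln)
    have "(cmod c)\<^sup>2 * cmod (F z) \<le> 16 * exp (2 * (D * (2 + \<bar>Re ?w\<bar>)))"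
      using psi_le[of ?w] F(2)[of ?w] z' by simp
    also have "\<dots> = 16 * exp (4 * D) * exp (- (2 * D * ln (cmod z)))"
      using Re by (simp add: exp_add[symmetric] algebra_simps)
    also have "\<dots> \<le> 16 * exp (4 * D) * exp (- (real N * ln (cmod z)))"
      using Re(2) N by (intro mult_left_mono) auto
    finally have "(cmod c)\<^sup>2 * cmod (F z) * exp (real N * ln (cmod z))
        \<le> 16 * exp (4 * D) * exp (- (real N * ln (cmod z))) * exp (real N * ln (cmod z))"
      by (rule mult_right_mono) simp
    also have "\<dots> = 16 * exp (4 * D)" by (simp add: mult.assoc flip: exp_add)
    also have "exp (real N * ln (cmod z)) = cmod z ^ N" using z' by (simp add: exp_of_nat_mult)
    finally show ?thesis using c by (simp add: norm_mult norm_power field_simps)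
  qed
  have ness: "not_essential F 0"
  proof -
    have hol: "(\<lambda>z. z ^ N * F z) holomorphic_on ball 0 1 - {0}"
      by (intro holomorphic_intros holomorphic_on_subset[OF F(1)]) auto
    have "\<forall>\<^sub>F z in at 0. norm (z ^ N * F z) \<le> 16 * exp (4 * D) / (cmod c)\<^sup>2"
      unfolding eventually_at by (intro exI[of _ 1]) (use bnd in auto)
    then obtain g where g: "g holomorphic_on ball 0 1" "\<And>z. z \<in> ball 0 1 - {0} \<Longrightarrow> g z = z ^ N * F z"
      using holomorphic_on_extend_bounded[OF hol] by auto
    have gan: "g analytic_on {0}"
      using g(1) by (meson analytic_at centre_in_ball open_ball zero_less_one)
    have pan: "(\<lambda>z::complex. z ^ N) analytic_on {0}" by (intro analytic_intros)
    have "not_essential (\<lambda>z. g z / z ^ N) 0"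
      by (intro not_essential_divide not_essential_analytic isolated_singularity_at_analytic gan pan)
    moreover have "\<forall>\<^sub>F z in at 0. g z / z ^ N = F z"
      unfolding eventually_at by (intro exI[of _ 1]) (use g(2) in auto)
    ultimately show ?thesis using not_essential_cong[of "\<lambda>z. g z / z ^ N" F 0 0] by simp
  qed
  show ?thesis
  proof (cases "is_pole F 0")
    case False
    with ness obtain l where "F \<midarrow>0\<rightarrow> l" by (auto simp: not_essential_def)
    then have "\<forall>\<^sub>F z in at 0. dist (F z) l < 1" by (rule tendstoD) simp
    then obtain d where d: "d > 0" "\<And>z. z \<noteq> 0 \<Longrightarrow> cmod z < d \<Longrightarrow> dist (F z) l < 1"
      unfolding eventually_at by auto
    show ?thesis
    proof (intro exI allI impI)
      fix z assume z: "Re z \<le> ln (d / 2)"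
      then have "cmod (exp z) < d"
        using exp_le_cancel_iff[of "Re z" "ln (d / 2)"] d(1) by (simp add: norm_exp_eq_Re)
      then have "dist (?\<psi> z) l < 1" using d(2)[of "exp z"] F(2)[of z] by simp
      then show "cmod (?\<psi> z) \<le> cmod l + 1"
        using norm_triangle_sub[of "?\<psi> z" l] by (simp add: dist_norm)
    qed
  next
    case True
    \<comment> \<open>In the final comparison the lower bound for P and the initial upper bound
      together contribute exp (2 D k) after k unit steps; decay by this q at each step leaves exp (-
      k). In \<open>?L\<close>, the 4 is that of \<open>potential_energy_le\<close>, and exp D pays
      for passing from z to the unit disc about z.\<close>
    define q where "q = exp (- (2 * D) - 1)"
    let ?L = "4 * exp D / q"
    have q: "q > 0" by (simp add: q_def)
    have "filterlim F at_infinity (at 0)" using True by (simp add: is_pole_def)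
    then have "\<forall>\<^sub>F z in at 0. ?L \<le> cmod (F z)"
      using q by (subst (asm) filterlim_at_infinity[of 0]) auto
    then obtain d where d: "d > 0" "\<And>z. z \<noteq> 0 \<Longrightarrow> cmod z < d \<Longrightarrow> ?L \<le> cmod (F z)"
      unfolding eventually_at by auto
    define T where "T = max 0 (- ln (d / 2))"
    have T: "T \<ge> 0" by (simp add: T_def)
    have big: "?L \<le> cmod (?\<psi> z)" if "Re z \<le> - T" for z
    proof -
      have "Re z \<le> ln (d / 2)" using that by (simp add: T_def)
      then have "cmod (exp z) < d"
        using exp_le_cancel_iff[of "Re z" "ln (d / 2)"] d(1) by (simp add: norm_exp_eq_Re)
      then show ?thesis using d(2)[of "exp z"] F(2)[of z] by simp
    qed
    \<comment> \<open>Each step uses the previous estimate on the whole unit disc about z, which is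
      why z has to lie k units to the left of - T.\<close>
    have decay: "energy u v z \<le> exp (D * (1 - Re z)) * q ^ k" if "Re z \<le> - T - real k" for k z
      using that
    proof (induction k arbitrary: z)
      case 0
      then show ?case using growth'[of z] T by simp
    next
      case (Suc k)
      have "cmod (?\<psi> z) * energy u v z \<le> 4 * (exp (D * (2 - Re z)) * q ^ k)"
      proof (rule potential_energy_le)
        fix w assume "dist z w \<le> 1"
        then have r: "\<bar>Re z - Re w\<bar> \<le> 1" using abs_Re_le_cmod[of "z - w"] by (simp add: dist_norm)
        then have "energy u v w \<le> exp (D * (1 - Re w)) * q ^ k" using Suc.prems by (intro Suc.IH) auto
        also have "\<dots> \<le> exp (D * (2 - Re z)) * q ^ k"
          using r q by (intro mult_right_mono) (auto simp: D_def intro!: mult_left_mono)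
        finally show "energy u v w \<le> exp (D * (2 - Re z)) * q ^ k" .
      qed
      moreover have "?L * energy u v z \<le> cmod (?\<psi> z) * energy u v z"
        using Suc.prems by (intro mult_right_mono big) auto
      ultimately have "?L * energy u v z \<le> 4 * (exp (D * (2 - Re z)) * q ^ k)" by linarith
      also have "exp (D * (2 - Re z)) = exp D * exp (D * (1 - Re z))"
        by (simp add: exp_add[symmetric] algebra_simps)
      finally have "4 * exp D * energy u v z \<le> 4 * exp D * (exp (D * (1 - Re z)) * q ^ Suc k)"
        using q by (simp add: field_simps)
      then show ?case by (subst (asm) mult_le_cancel_left_pos) auto
    qed
    have bound: "(cmod c)\<^sup>2 \<le> 4 * exp (D * (3 + 2 * T)) * exp (- real k)" for k
    proof -
      let ?z = "of_real (- T - real k) :: complex"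
      have abs: "\<bar>Re ?z\<bar> = T + real k" using T by simp
      have "(cmod c)\<^sup>2 \<le> 4 * exp (D * (2 + (T + real k))) * energy u v ?z" using lower[of ?z] unfolding abs .
      also have "\<dots> \<le> 4 * exp (D * (2 + (T + real k))) * (exp (D * (1 - Re ?z)) * q ^ k)"
        by (intro mult_left_mono decay) auto
      also have "q ^ k = exp (real k * (- (2 * D) - 1))" unfolding q_def by (simp only: exp_of_nat_mult)
      also have "4 * exp (D * (2 + (T + real k))) * (exp (D * (1 - Re ?z)) * exp (real k * (- (2 * D) - 1)))
          = 4 * exp (D * (3 + 2 * T)) * exp (- real k)"
        by (simp add: mult.assoc exp_add[symmetric] algebra_simps)
      finally show ?thesis .
    qed
    have "(\<lambda>k. 4 * exp (D * (3 + 2 * T)) * exp (- real k)) \<longlonglongrightarrow> 4 * exp (D * (3 + 2 * T)) * 0"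
      by (intro tendsto_mult_left filterlim_compose[OF exp_at_bot]
          filterlim_compose[OF filterlim_uminus_at_bot_at_top filterlim_real_sequentially])
    then have "(cmod c)\<^sup>2 \<le> 4 * exp (D * (3 + 2 * T)) * 0"
      by (rule LIMSEQ_le_const) (use bound in blast)
    then show ?thesis using c by simp
  qed
qed

lemma potential_const:
  assumes per: "\<And>z. potential u v c (z + 2 * of_real pi * \<i>) = potential u v c z"
    and growth: "\<And>z. energy u v z \<le> exp (C * (1 + \<bar>Re z\<bar>))"
  shows "\<exists>k. \<forall>z. potential u v c z = k"
proof -
  interpret R: entire_pair "\<lambda>z. u (- z)" "\<lambda>z. v (- z)" "- c" by (rule reflected)
  obtain a K where 1: "\<And>z. Re z \<le> a \<Longrightarrow> cmod (potential u v c z) \<le> K"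
    using potential_bounded_left[OF per growth] by blast
  have "potential u v c (- (z + 2 * of_real pi * \<i>)) = potential u v c (- z)" for z
    using per[of "- z - 2 * of_real pi * \<i>"] by (simp add: algebra_simps)
  then obtain b L where "\<And>z. Re z \<le> b \<Longrightarrow> cmod (potential u v c (- z)) \<le> L"
    using R.potential_bounded_left[of C] growth[of "- _"] unfolding potential_reflected energy_reflected
    by (simp only: uminus_complex.sel abs_minus_cancel) blast
  from this[of "- _"] have 2: "Re z \<ge> - b \<Longrightarrow> cmod (potential u v c z) \<le> L" for z by simp
  show ?thesis
    by (rule periodic_bounded_imp_const[OF holo_potential, of a "max K L" "- b"])
       (use per 1 2 in \<open>auto simp: max.coboundedI1 max.coboundedI2\<close>)
qed

end

section \<open>Pairs with constant potential\<close>

lemma holomorphic_has_deriv: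
  "f holomorphic_on UNIV \<Longrightarrow> (f has_field_derivative deriv f z) (at z)"
  by (rule holomorphic_derivI[of _ UNIV]) auto

lemma zero_deriv_const:
  assumes "\<And>z. (f has_field_derivative 0) (at (z :: complex))"
  shows "f z = f 0"
  using has_field_derivative_zero_constant[of UNIV f] assms by (metis UNIV_I convex_UNIV)

text \<open>The operator factors: f' + s f and f' - s f are multiples of exp (s z) and exp (- s z),
  and their difference is 2 s f.\<close>

lemma solve_linear_ode:
  assumes f: "f holomorphic_on UNIV" and ode: "\<And>z. deriv (deriv f) z = s\<^sup>2 * f z" and s: "s \<noteq> 0"
  obtains \<alpha> \<beta> where "\<And>z. f z = \<alpha> * exp (s * z) + \<beta> * exp (- s * z)"
proof -
  note D = holomorphic_has_deriv[OF f] holomorphic_has_deriv[OF holomorphic_deriv[OF f open_UNIV], unfolded ode]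
  have p: "(deriv f z + s * f z) * exp (- s * z) = (deriv f 0 + s * f 0) * exp (- s * 0)" for z
    by (rule zero_deriv_const) (rule derivative_eq_intros D refl | simp add: algebra_simps power2_eq_square)+
  have q: "(deriv f z - s * f z) * exp (s * z) = (deriv f 0 - s * f 0) * exp (s * 0)" for z
    by (rule zero_deriv_const) (rule derivative_eq_intros D refl | simp add: algebra_simps power2_eq_square)+
  have "f z = ((deriv f 0 + s * f 0) / (2 * s)) * exp (s * z) + (- (deriv f 0 - s * f 0) / (2 * s)) * exp (- s * z)" for z
  proof -
    have e: "exp (- s * z) * exp (s * z) = 1" by (simp add: exp_minus)
    have "(deriv f 0 + s * f 0) * exp (s * z) = deriv f z + s * f z"
      using p[of z] e by (metis (no_types, lifting) exp_zero mult.assoc mult.right_neutral mult_zero_right)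
    moreover have "(deriv f 0 - s * f 0) * exp (- s * z) = deriv f z - s * f z"
      using q[of z] e by (metis (no_types, lifting) exp_zero mult.assoc mult.commute mult.right_neutral mult_zero_right)
    ultimately have "(deriv f 0 + s * f 0) * exp (s * z) - (deriv f 0 - s * f 0) * exp (- s * z) = 2 * s * f z"
      by (simp add: algebra_simps)
    then have "f z = ((deriv f 0 + s * f 0) * exp (s * z) - (deriv f 0 - s * f 0) * exp (- s * z)) / (2 * s)"
      using s by simp
    then show ?thesis unfolding times_divide_eq_left add_divide_distrib[symmetric]
      by (simp only: mult_minus_left diff_conv_add_uminus)
  qed
  then show ?thesis using that by blast
qed

lemma bounded_exp_coeff_zero:
  assumes "\<And>\<tau>::real. \<tau> \<ge> 0 \<Longrightarrow> (x :: real) * exp \<tau> \<le> M" and "x \<ge> 0"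
  shows "x = 0"
proof (rule ccontr)
  assume "x \<noteq> 0"
  with assms(2) have x: "x > 0" by simp
  have "M \<ge> 0" using assms(1)[of 0] x by simp
  then have "x * exp (M / x) \<le> M" by (intro assms(1)) (use x in simp)
  moreover have "x * exp (M / x) \<ge> x * (1 + M / x)"
    using x by (intro mult_left_mono exp_ge_add_one_self_aux) (auto simp: \<open>M \<ge> 0\<close>)
  moreover have "x * (1 + M / x) = x + M" using x by (simp add: distrib_left)
  ultimately show False using x by linarith
qed

text \<open>With Im s nonzero, one exponential grows and the other decays along either half of the
  imaginary axis, so each half isolates one coefficient.\<close>

lemma exp_combination_bounded_on_imaginary_axis:
  assumes f: "\<And>z. f z = \<alpha> * exp (s * z) + \<beta> * exp (- s * z)"
    and bnd: "\<And>\<theta>. cmod (f (\<i> * of_real \<theta>)) \<le> M" and "Im s \<noteq> 0"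
  shows "\<alpha> = 0 \<and> \<beta> = 0"
proof -
  define y where "y = Im s"
  have y: "y \<noteq> 0" using assms(3) by (simp add: y_def)
  have norms: "cmod (exp (s * (\<i> * of_real \<theta>))) = exp (- y * \<theta>)" "cmod (exp (- s * (\<i> * of_real \<theta>))) = exp (y * \<theta>)" for \<theta>
    by (simp_all add: norm_exp_eq_Re y_def)
  have "cmod \<alpha> * exp \<tau> \<le> M + cmod \<beta>" if "\<tau> \<ge> 0" for \<tau>
  proof -
    \<comment> \<open>Chosen so that exp (s z) has modulus exp tau and exp (- s z) has modulus exp
      (- tau).\<close>
    let ?z = "\<i> * of_real (- \<tau> / y)"
    have "cmod (\<alpha> * exp (s * ?z)) \<le> cmod (f ?z) + cmod (\<beta> * exp (- s * ?z))"
      unfolding f[of ?z] by (metis add_diff_cancel_right' norm_triangle_ineq4)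
    then have "cmod \<alpha> * exp \<tau> \<le> cmod (f ?z) + cmod \<beta> * exp (- \<tau>)"
      unfolding norm_mult norms using y by simp
    also have "\<dots> \<le> M + cmod \<beta> * 1" using that by (intro add_mono bnd mult_left_mono) auto
    finally show ?thesis by simp
  qed
  moreover have "cmod \<beta> * exp \<tau> \<le> M + cmod \<alpha>" if "\<tau> \<ge> 0" for \<tau>
  proof -
    let ?z = "\<i> * of_real (\<tau> / y)"
    have "cmod (\<beta> * exp (- s * ?z)) \<le> cmod (f ?z) + cmod (\<alpha> * exp (s * ?z))"
      unfolding f[of ?z] by (metis add_diff_cancel_left' norm_triangle_ineq4)
    then have "cmod \<beta> * exp \<tau> \<le> cmod (f ?z) + cmod \<alpha> * exp (- \<tau>)"
      unfolding norm_mult norms using y by simp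
    also have "\<dots> \<le> M + cmod \<alpha> * 1" using that by (intro add_mono bnd mult_left_mono) auto
    finally show ?thesis by simp
  qed
  ultimately show ?thesis
    using bounded_exp_coeff_zero[OF _ norm_ge_zero] by (metis norm_eq_zero)
qed

lemma linear_bounded_on_imaginary_axis:
  assumes f: "\<And>z. f z = \<alpha> + \<beta> * z" and bnd: "\<And>\<theta>. cmod (f (\<i> * of_real \<theta>)) \<le> M"
  shows "\<beta> = 0"
proof (rule ccontr)
  assume b: "\<beta> \<noteq> 0"
  define \<theta> where "\<theta> = (M + cmod \<alpha> + 1) / cmod \<beta>"
  have M: "M \<ge> 0" using bnd[of 0] norm_ge_zero order_trans by blast
  have "cmod (\<beta> * (\<i> * of_real \<theta>)) \<le> cmod (f (\<i> * of_real \<theta>)) + cmod \<alpha>"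
    unfolding f by (metis add_diff_cancel_left' norm_triangle_ineq4)
  then have "cmod \<beta> * \<bar>\<theta>\<bar> \<le> M + cmod \<alpha>" using bnd[of \<theta>] by (simp add: norm_mult)
  moreover have "\<bar>\<theta>\<bar> = (M + cmod \<alpha> + 1) / cmod \<beta>" unfolding \<theta>_def using M by simp
  ultimately show False using b by simp
qed

lemma zero_second_deriv_bounded_on_imaginary_axis:
  assumes f: "f holomorphic_on UNIV" and 0: "\<And>z. deriv (deriv f) z = 0"
    and bnd: "\<And>\<theta>. cmod (f (\<i> * of_real \<theta>)) \<le> M"
  shows "deriv f 0 = 0"
proof -
  have D1: "(f has_field_derivative deriv f z) (at z)" for z by (rule holomorphic_has_deriv[OF f])
  have D2: "(deriv f has_field_derivative 0) (at z)" for z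
    using holomorphic_has_deriv[OF holomorphic_deriv[OF f open_UNIV], of z] by (simp only: 0)
  have 1: "deriv f z = deriv f 0" for z by (rule zero_deriv_const[of "deriv f", OF D2])
  have "((\<lambda>z. f z - deriv f 0 * z) has_field_derivative deriv f z - deriv f 0) (at z)" for z
    by (rule DERIV_diff[OF D1 DERIV_cmult_Id])
  then have "((\<lambda>z. f z - deriv f 0 * z) has_field_derivative 0) (at z)" for z
    using 1[of z] by (metis diff_self)
  from zero_deriv_const[OF this] have "f z = f 0 + deriv f 0 * z" for z
    by (metis add.commute diff_add_cancel diff_zero mult_zero_right)
  then show ?thesis using linear_bounded_on_imaginary_axis bnd by blast
qed

text \<open>The energy, in the coordinate \<open>log z\<close>, of all model surfaces: \<open>a = 0\<close> gives
  catenoids and cousins.\<close>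

definition model_energy :: "real \<Rightarrow> real \<Rightarrow> real \<Rightarrow> complex \<Rightarrow> real" where
  "model_energy \<mu> a b z =
     b * (exp (\<mu> * Re z) + (1 + a\<^sup>2) * exp (- \<mu> * Re z) + 2 * a * cos (\<mu> * Im z))"

context entire_pair
begin

text \<open>P is continuous and periodic, hence bounded on the imaginary axis, and so are u and v.
  This rules out the affine solutions at k = 0 and every non-real s; what remains are combinations
  of exp (s z) and exp (- s z) with s > 0, and mu = 2 s.\<close>

lemma energy_of_const_potential:
  assumes pot: "\<And>z. potential u v c z = k"
    and per: "\<And>z. energy u v (z + 2 * of_real pi * \<i>) = energy u v z"
  obtains \<mu> A B C where "\<mu> > 0" "A > 0" "(cmod C)\<^sup>2 < A * B"
    "\<And>z. energy u v z = A * exp (\<mu> * Re z) + B * exp (- \<mu> * Re z) + 2 * Re (C * cis (\<mu> * Im z))"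
proof -
  have ode: "deriv (deriv u) z = (csqrt k)\<^sup>2 * u z" "deriv (deriv v) z = (csqrt k)\<^sup>2 * v z" for z
    by (simp_all add: second_deriv pot)
  obtain M where M: "energy u v (\<i> * of_real \<theta>) \<le> M" for \<theta>
  proof -
    have "compact ((energy u v) ` cbox 0 (Complex 0 (2 * pi)))"
      by (intro compact_continuous_image continuous_on_subset[OF continuous_on_energy[OF u v]]) auto
    then obtain L where L: "\<And>z. z \<in> cbox 0 (Complex 0 (2 * pi)) \<Longrightarrow> energy u v z \<le> L"
      using compact_imp_bounded bounded_real by (metis abs_le_D1 image_eqI)
    have "energy u v (\<i> * of_real \<theta>) \<le> L" for \<theta>
    proof -
      obtain w where "Re w = Re (\<i> * of_real \<theta>)" "Im w \<in> {0..2 * pi}" "energy u v w = energy u v (\<i> * of_real \<theta>)"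
        using periodic_norm_shift[of "energy u v", OF per] by blast
      then show ?thesis using L[of w] by (auto simp: in_cbox_complex_iff)
    qed
    then show ?thesis using that by blast
  qed
  have bu: "cmod (u (\<i> * of_real \<theta>)) \<le> sqrt M" and bv: "cmod (v (\<i> * of_real \<theta>)) \<le> sqrt M" for \<theta>
    using M[of \<theta>] norm_le_sqrt_energy[of "\<i> * of_real \<theta>"] by (meson order_trans real_sqrt_le_mono)+
  have k: "k \<noteq> 0"
  proof
    assume "k = 0"
    note lin = zero_second_deriv_bounded_on_imaginary_axis
    have "deriv u 0 = 0" "deriv v 0 = 0"
      by (rule lin[OF u _ bu], simp add: ode \<open>k = 0\<close>, rule lin[OF v _ bv], simp add: ode \<open>k = 0\<close>)
    then show False using wronskian[of 0] c by (simp add: wronskian_def)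
  qed
  define s where "s = csqrt k"
  have s: "s \<noteq> 0" using k by (simp add: s_def)
  obtain \<alpha> \<beta> where ab: "\<And>z. u z = \<alpha> * exp (s * z) + \<beta> * exp (- s * z)"
    using solve_linear_ode[OF u ode(1)] s unfolding s_def by blast
  obtain \<gamma> \<delta> where gd: "\<And>z. v z = \<gamma> * exp (s * z) + \<delta> * exp (- s * z)"
    using solve_linear_ode[OF v ode(2)] s unfolding s_def by blast
  have "Im s = 0"
  proof (rule ccontr)
    assume "Im s \<noteq> 0"
    then have "\<alpha> = 0 \<and> \<beta> = 0" "\<gamma> = 0 \<and> \<delta> = 0"
      using exp_combination_bounded_on_imaginary_axis[OF ab bu] exp_combination_bounded_on_imaginary_axis[OF gd bv] by auto
    then show False using energy_pos[of 0] by (simp add: energy_def ab gd)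
  qed
  define x where "x = Re s"
  have sx: "s = of_real x" using \<open>Im s = 0\<close> by (simp add: x_def complex_eq_iff)
  have "x \<ge> 0" unfolding x_def s_def using csqrt_principal[of k] by auto
  with s sx have x: "x > 0" by (cases "x = 0") auto
  \<comment> \<open>A, B, C form the Gram matrix of the coefficient vectors (\<alpha>, \<gamma>) and
    (\<beta>, \<delta>). Its determinant is |\<alpha> \<delta> - \<beta> \<gamma>|^2, nonzero
    because the Wronskian is a multiple of \<alpha> \<delta> - \<beta> \<gamma>.\<close>
  define A where "A = (cmod \<alpha>)\<^sup>2 + (cmod \<gamma>)\<^sup>2"
  define B where "B = (cmod \<beta>)\<^sup>2 + (cmod \<delta>)\<^sup>2"
  define C where "C = \<alpha> * cnj \<beta> + \<gamma> * cnj \<delta>"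
  have "\<alpha> * \<delta> - \<beta> * \<gamma> \<noteq> 0"
  proof
    assume 0: "\<alpha> * \<delta> - \<beta> * \<gamma> = 0"
    have "(u has_field_derivative \<alpha> * s - \<beta> * s) (at 0)" "(v has_field_derivative \<gamma> * s - \<delta> * s) (at 0)"
      unfolding ab gd by (rule derivative_eq_intros refl | simp)+
    then have "deriv u 0 = \<alpha> * s - \<beta> * s" "deriv v 0 = \<gamma> * s - \<delta> * s" by (auto intro: DERIV_imp_deriv)
    then have "c = (\<alpha> + \<beta>) * (\<gamma> * s - \<delta> * s) - (\<alpha> * s - \<beta> * s) * (\<gamma> + \<delta>)"
      using wronskian[of 0] by (simp add: wronskian_def ab gd)
    also have "\<dots> = - 2 * s * (\<alpha> * \<delta> - \<beta> * \<gamma>)" by (simp add: algebra_simps)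
    finally have "c = - 2 * s * (\<alpha> * \<delta> - \<beta> * \<gamma>)" .
    then show False using 0 c by simp
  qed
  then have "(cmod (\<alpha> * \<delta> - \<beta> * \<gamma>))\<^sup>2 > 0" by simp
  moreover have "(cmod (\<alpha> * \<delta> - \<beta> * \<gamma>))\<^sup>2 = A * B - (cmod C)\<^sup>2"
  proof -
    have "complex_of_real ((cmod (\<alpha> * \<delta> - \<beta> * \<gamma>))\<^sup>2) = complex_of_real (A * B - (cmod C)\<^sup>2)"
      unfolding A_def B_def C_def of_real_diff of_real_mult of_real_add complex_norm_square
      by (simp add: algebra_simps)
    then show ?thesis by (simp only: of_real_eq_iff)
  qed
  ultimately have ABC: "(cmod C)\<^sup>2 < A * B" by linarith
  have "A \<noteq> 0" using ABC by (metis mult_zero_left not_less zero_le_power2)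
  then have A: "A > 0" unfolding A_def by (simp add: less_le)
  have en: "energy u v z = A * exp (2 * x * Re z) + B * exp (- (2 * x) * Re z) + 2 * Re (C * cis (2 * x * Im z))" for z
  proof -
    let ?e = "exp (s * z)" and ?f = "exp (- s * z)"
    have arg: "s * z + cnj (s * z) = of_real (2 * x * Re z)" "- s * z + cnj (- s * z) = of_real (- (2 * x) * Re z)"
      "s * z + cnj (- s * z) = \<i> * of_real (2 * x * Im z)"
      by (simp_all add: sx complex_eq_iff)
    have ee: "?e * cnj ?e = of_real (exp (2 * x * Re z))" "?f * cnj ?f = of_real (exp (- (2 * x) * Re z))"
      unfolding exp_cnj exp_add[symmetric] arg by (simp_all only: exp_of_real)
    have ef: "?e * cnj ?f = cis (2 * x * Im z)"
      unfolding exp_cnj exp_add[symmetric] arg cis_conv_exp ..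
    have fe: "?f * cnj ?e = cnj (cis (2 * x * Im z))"
      unfolding ef[symmetric] by simp
    have "complex_of_real (energy u v z) = of_real A * (?e * cnj ?e) + of_real B * (?f * cnj ?f)
        + (C * (?e * cnj ?f) + cnj C * (?f * cnj ?e))"
      unfolding energy_complex ab gd A_def B_def C_def of_real_add complex_norm_square
      by (simp add: algebra_simps)
    also have "C * (?e * cnj ?f) + cnj C * (?f * cnj ?e) = of_real (2 * Re (C * cis (2 * x * Im z)))"
      unfolding ef fe by (metis complex_add_cnj complex_cnj_mult)
    finally have "complex_of_real (energy u v z) = of_real (A * exp (2 * x * Re z) + B * exp (- (2 * x) * Re z)
        + 2 * Re (C * cis (2 * x * Im z)))"
      unfolding ee by (simp add: add.assoc)
    then show ?thesis by (simp only: of_real_eq_iff)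
  qed
  show ?thesis by (rule that[of "2 * x" A C B]) (use x A ABC en in simp_all)
qed

text \<open>A translation by \<beta> has two real parameters: the real part balances A against B,
  and the imaginary part rotates C onto the nonnegative axis. If C does not vanish, periodicity of
  its term forces mu to be an integer.\<close>

lemma energy_normal_form:
  assumes pot: "\<And>z. potential u v c z = k"
    and per: "\<And>z. energy u v (z + 2 * of_real pi * \<i>) = energy u v z"
  obtains \<mu> a b \<beta> where "\<mu> > 0" "a \<ge> 0" "b > 0" "a = 0 \<or> \<mu> \<in> \<nat>"
    "\<And>z. energy u v z = model_energy \<mu> a b (z + \<beta>)"
proof -
  obtain \<mu> A B C where m: "\<mu> > 0" "A > 0" "(cmod C)\<^sup>2 < A * B"
    and en: "\<And>z. energy u v z = A * exp (\<mu> * Re z) + B * exp (- \<mu> * Re z) + 2 * Re (C * cis (\<mu> * Im z))"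
    by (rule energy_of_const_potential[OF assms]) (rule that)
  \<comment> \<open>Read off from the model, for which A B = b^2 (1 + a^2) and |C| = a b; both
    quantities are invariant under translation of z, so b^2 = A B - |C|^2.\<close>
  define b where "b = sqrt (A * B - (cmod C)\<^sup>2)"
  define a where "a = cmod C / b"
  define \<beta> where "\<beta> = Complex (ln (A / b) / \<mu>) (Arg C / \<mu>)"
  have b: "b > 0" "b\<^sup>2 = A * B - (cmod C)\<^sup>2" using m by (simp_all add: b_def)
  have eA: "exp (\<mu> * Re (z + \<beta>)) = exp (\<mu> * Re z) * (A / b)" for z
    using m b by (simp add: \<beta>_def distrib_left exp_add)
  have eB: "exp (- \<mu> * Re (z + \<beta>)) = exp (- \<mu> * Re z) * (b / A)" for z
    unfolding mult_minus_left exp_minus eA by (simp add: divide_simps)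
  have cC: "cmod C * cos (\<mu> * Im (z + \<beta>)) = Re (C * cis (\<mu> * Im z))" for z
  proof -
    have "C * cis (\<mu> * Im z) = of_real (cmod C) * cis (Arg C + \<mu> * Im z)"
      by (subst rcis_cmod_Arg[of C, symmetric]) (simp add: rcis_def cis_mult)
    moreover have "\<mu> * Im (z + \<beta>) = Arg C + \<mu> * Im z" using m by (simp add: \<beta>_def distrib_left)
    ultimately show ?thesis by simp
  qed
  have "energy u v z = model_energy \<mu> a b (z + \<beta>)" for z
  proof -
    have "b * (1 + a\<^sup>2) * (b / A) = (b\<^sup>2 + (cmod C)\<^sup>2) / A"
      using b m by (simp add: a_def field_simps power2_eq_square)
    also have "\<dots> = B" using b m by simp
    finally have B: "b * (1 + a\<^sup>2) * (b / A) = B" .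
    have "model_energy \<mu> a b (z + \<beta>) = (b * (A / b)) * exp (\<mu> * Re z) + (b * (1 + a\<^sup>2) * (b / A)) * exp (- \<mu> * Re z)
       + 2 * (b * a) * cos (\<mu> * Im (z + \<beta>))"
      unfolding model_energy_def eA eB by (simp only: distrib_left mult_ac)
    also have "b * (A / b) = A" using b by simp
    also have "b * a = cmod C" using b by (simp add: a_def)
    finally show ?thesis unfolding B en using cC[of z] by (simp add: mult.assoc)
  qed
  moreover have "a = 0 \<or> \<mu> \<in> \<nat>"
  proof -
    have eq: "Re (C * cis (\<mu> * (\<theta> + 2 * pi))) = Re (C * cis (\<mu> * \<theta>))" for \<theta>
      using per[of "Complex 0 \<theta>"] unfolding en by (simp add: algebra_simps)
    have "C * cis (\<mu> * (2 * pi)) = C"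
    proof (rule complex_eqI)
      show "Re (C * cis (\<mu> * (2 * pi))) = Re C" using eq[of 0] by simp
      \<comment> \<open>At the angle pi / (2 mu) the factor \<open>cis\<close> equals i, so the
        equation of real parts there yields the imaginary part.\<close>
      have "cis (\<mu> * (pi / (2 * \<mu>) + 2 * pi)) = \<i> * cis (\<mu> * (2 * pi))"
        using m(1) by (simp add: distrib_left cis_mult[symmetric] del: cis_mult)
      moreover have "cis (\<mu> * (pi / (2 * \<mu>))) = \<i>" using m(1) by simp
      ultimately have "Re (C * (\<i> * cis (\<mu> * (2 * pi)))) = Re (C * \<i>)" using eq[of "pi / (2 * \<mu>)"] by (simp only:)
      then show "Im (C * cis (\<mu> * (2 * pi))) = Im C" by simp
    qed
    then have "C = 0 \<or> cis (\<mu> * (2 * pi)) = 1" by simp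
    moreover have "\<mu> \<in> \<nat>" if "cis (\<mu> * (2 * pi)) = 1"
    proof -
      have "cos (\<mu> * (2 * pi)) = 1" using that by (simp add: complex_eq_iff)
      then obtain n :: int where "\<mu> * (2 * pi) = of_int n * 2 * pi" unfolding cos_one_2pi_int by blast
      then have "\<mu> = of_int n" by simp
      with m(1) have "\<mu> = of_nat (nat n)" by simp
      then show ?thesis by simp
    qed
    ultimately show ?thesis by (auto simp: a_def)
  qed
  moreover have "a \<ge> 0" using b by (simp add: a_def)
  ultimately show ?thesis by (intro that[of \<mu> a b \<beta>] m(1) b(1)) auto
qed

end

text \<open>The two pairs are the lifts of the Weierstrass data used at the two ends.\<close>

theorem periodic_energy_classification:
  assumes entire: "u holomorphic_on UNIV" "v holomorphic_on UNIV" "u' holomorphic_on UNIV" "v' holomorphic_on UNIV"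
    and eq: "\<And>z. energy u' v' z = energy u v z"
    and per: "\<And>z. energy u v (z + 2 * of_real pi * \<i>) = energy u v z"
    and left: "\<And>z. Re z \<le> s \<Longrightarrow> cmod (wronskian u v z) \<le> K"
    and right: "\<And>z. Re z \<ge> t \<Longrightarrow> cmod (wronskian u' v' z) \<le> K"
    and nz: "wronskian u v z0 \<noteq> 0"
    and F: "F \<in> borel_measurable borel" "(\<integral>\<^sup>+z. F z \<partial>lborel) < \<infinity>"
    and curv: "\<And>z. ennreal (4 * (cmod (wronskian u v z))\<^sup>2 / (energy u v z)\<^sup>2) \<le> ennreal (exp (2 * Re z)) * F (exp z)"
  obtains \<mu> a b \<beta> where "\<mu> > 0" "a \<ge> 0" "b > 0" "a = 0 \<or> \<mu> \<in> \<nat>"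
    "\<And>z. energy u v z = model_energy \<mu> a b (z + \<beta>)"
proof -
  let ?T = "\<lambda>z. z + 2 * of_real pi * \<i>"
  have holT: "?T holomorphic_on UNIV" by (intro holomorphic_intros)
  have DT: "(?T has_field_derivative 1) (at z)" for z by (auto intro!: derivative_eq_intros)
  have shift1: "deriv (\<lambda>z. f (?T z)) = (\<lambda>z. deriv f (?T z))" if "f holomorphic_on UNIV" for f
    by (rule ext, subst deriv_compose_UNIV[OF that DT]) simp
  have holW: "wronskian u v holomorphic_on UNIV"
    unfolding wronskian_def[abs_def] by (intro holomorphic_intros holomorphic_deriv entire open_UNIV)
  have enT: "energy (\<lambda>z. u (?T z)) (\<lambda>z. v (?T z)) z = energy u v z" for z
    using per[of z] by (simp add: energy_def)
  note shifted = holomorphic_compose_UNIV[OF entire(1) holT] holomorphic_compose_UNIV[OF entire(2) holT]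
  have "cmod (wronskian u v (?T z)) = cmod (wronskian u v z)" for z
    using norm_wronskian_eq[OF shifted entire(1,2) open_UNIV UNIV_I enT, of z]
    by (simp add: wronskian_def shift1 entire)
  \<comment> \<open>The bound at the right end concerns the other pair; equal energies give
    Wronskians of equal modulus.\<close>
  moreover have "cmod (wronskian u v z) \<le> K" if "Re z \<ge> t" for z
    using right[OF that] norm_wronskian_eq[OF entire(3,4,1,2) open_UNIV UNIV_I eq, of z] by simp
  ultimately obtain c where W: "\<And>z. wronskian u v z = c"
    using periodic_bounded_imp_const[OF holW, of s K t] left by blast
  have c: "c \<noteq> 0" using nz W by simp
  interpret entire_pair u v c by unfold_locales (use entire W c in auto)
  have pot_per: "potential u v c (?T z) = potential u v c z" for z
  proof -
    have "energy_zz u v (?T z) = energy_zz u v z"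
      using energy_zz_eq[OF shifted entire(1,2) open_UNIV UNIV_I enT, of z]
      by (simp add: energy_zz_def shift1 entire holomorphic_deriv)
    then show ?thesis using energy_pos[of z] by (simp add: energy_zz_eq_potential per)
  qed
  interpret periodic_pair u v by unfold_locales (use entire energy_pos per in auto)
  obtain B where B: "(\<integral>\<^sup>+z. F z \<partial>lborel) = ennreal B" "B \<ge> 0"
    using F(2) by (cases "\<integral>\<^sup>+z. F z \<partial>lborel") auto
  \<comment> \<open>The factor 5 is the one of \<open>integral_strip_le\<close>.\<close>
  interpret finite_curvature_pair u v c "5 * B"
  proof unfold_locales
    fix a b :: real assume ab: "a < b"
    have curv': "ennreal (4 * (cmod (wronskian u v (Complex t \<phi>)))\<^sup>2 / (energy u v (Complex t \<phi>))\<^sup>2)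
        \<le> ennreal (exp (2 * t)) * F (exp (Complex t \<phi>))" for t \<phi>
      using curv[of "Complex t \<phi>"] by simp
    show "integral {a..b} (curvature_mean u v) \<le> 5 * B"
      unfolding curvature_mean_def[abs_def]
      by (rule integral_strip_le[OF F(1) eq_refl[OF B(1)] B(2) continuous_curvature _ curv' ab]) simp
  qed (use W c in auto)
  obtain C where "\<And>z. energy u v z \<le> exp (C * (1 + \<bar>Re z\<bar>))" using energy_growth by blast
  then obtain k where "\<And>z. potential u v c z = k" using potential_const pot_per by blast
  then show ?thesis by (rule energy_normal_form) (use per that in blast)+
qed

section \<open>Smooth maps between plane domains\<close>

lemma pd_eqI:
  assumes "(f has_derivative D) (at x)"
  shows "pd e f x = D e"
  unfolding pd_def using frechet_derivative_at[OF assms] by simp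

lemma has_derivative_cong_open:
  assumes "open X" "x \<in> X" "\<And>y. y \<in> X \<Longrightarrow> f y = g y"
  shows "(f has_derivative D) (at x) \<longleftrightarrow> (g has_derivative D) (at x)"
proof
  assume "(f has_derivative D) (at x)"
  then show "(g has_derivative D) (at x)"
    by (rule has_derivative_transform_within_open[OF _ assms])
next
  assume "(g has_derivative D) (at x)"
  then show "(f has_derivative D) (at x)"
    by (rule has_derivative_transform_within_open[OF _ assms(1,2)]) (simp add: assms(3))
qed

text \<open>\<open>pd\<close> selects a derivative by a choice operator and has a value even where
  none exists. Equality of the two derivative predicates therefore gives equality of the values
  without differentiability.\<close>

lemma pd_cong_open:
  assumes "open X" "x \<in> X" "\<And>y. y \<in> X \<Longrightarrow> f y = g y"
  shows "pd e f x = pd e g x"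
proof -
  have "(\<lambda>D. (f has_derivative D) (at x)) = (\<lambda>D. (g has_derivative D) (at x))"
    by (intro ext has_derivative_cong_open[of X x f g]) (use assms in auto)
  then show ?thesis by (simp only: pd_def frechet_derivative_def)
qed

lemma differentiable_cong_open:
  assumes "open X" "x \<in> X" "\<And>y. y \<in> X \<Longrightarrow> f y = g y"
  shows "f differentiable (at x) \<longleftrightarrow> g differentiable (at x)"
proof -
  have "(\<lambda>D. (f has_derivative D) (at x)) = (\<lambda>D. (g has_derivative D) (at x))"
    by (intro ext has_derivative_cong_open[of X x f g]) (use assms in auto)
  then show ?thesis by (simp only: differentiable_def)
qed

lemma Ck_on_cong:
  assumes "open X" "\<And>y. y \<in> X \<Longrightarrow> f y = g y"
  shows "Ck_on k X f \<longleftrightarrow> Ck_on k X g"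
  using assms(2)
proof (induction k arbitrary: f g)
  case 0
  then show ?case by (simp cong: continuous_on_cong)
next
  case (Suc k)
  have "Ck_on k X (pd e f) \<longleftrightarrow> Ck_on k X (pd e g)" for e
    by (rule Suc.IH, rule pd_cong_open[of X]) (simp_all add: Suc.prems \<open>open X\<close>)
  moreover have "f differentiable (at x) \<longleftrightarrow> g differentiable (at x)" if "x \<in> X" for x
    by (rule differentiable_cong_open[of X]) (simp_all add: that Suc.prems \<open>open X\<close>)
  ultimately show ?case by (simp cong: conj_cong ball_cong)
qed

lemma Ck_on_transform:
  assumes "Ck_on k X g" "open X" "\<And>y. y \<in> X \<Longrightarrow> f y = g y"
  shows "Ck_on k X f"
  using Ck_on_cong[of X f g k] assms by simp

lemma Ck_on_subset: "Ck_on k X f \<Longrightarrow> Y \<subseteq> X \<Longrightarrow> Ck_on k Y f"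
  by (induction k arbitrary: f) (auto intro: continuous_on_subset)

lemma Ck_on_Suc_imp: "Ck_on (Suc k) X f \<Longrightarrow> Ck_on k X f"
proof (induction k arbitrary: f)
  case 0
  then show ?case
    by (auto intro!: continuous_at_imp_continuous_on differentiable_imp_continuous_within)
next
  case (Suc k)
  have "Ck_on k X (pd e f)" if "e \<in> coord_basis" for e
    using bspec[OF conjunct2[OF Suc.prems[unfolded Ck_on.simps(2)[of "Suc k"]]] that] by (rule Suc.IH)
  then show ?case
    unfolding Ck_on.simps(2)[of k] using conjunct1[OF Suc.prems[unfolded Ck_on.simps(2)[of "Suc k"]]] by blast
qed

lemma Ck_on_const: "Ck_on k X (\<lambda>x. c)"
proof (induction k arbitrary: c)
  case (Suc k)
  have "pd e (\<lambda>x. c) = (\<lambda>x. 0)" for e by (rule ext, rule pd_eqI) (rule has_derivative_const)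
  then show ?case using Suc by simp
qed simp

lemma Ck_on_bounded_linear_compose:
  assumes "bounded_linear L"
  shows "Ck_on k X f \<Longrightarrow> open X \<Longrightarrow> Ck_on k X (\<lambda>x. L (f x))"
proof (induction k arbitrary: f)
  case 0
  then show ?case
    using bounded_linear.continuous_on[OF assms] by auto
next
  case (Suc k)
  have D: "((\<lambda>x. L (f x)) has_derivative (\<lambda>h. L (frechet_derivative f (at x) h))) (at x)" if "x \<in> X" for x
    using Suc.prems that by (intro bounded_linear.has_derivative[OF assms]) (auto simp: frechet_derivative_works)
  have "Ck_on k X (pd e (\<lambda>x. L (f x)))" if "e \<in> coord_basis" for e
  proof -
    have "Ck_on k X (pd e f)" using Suc.prems that by auto
    then have "Ck_on k X (\<lambda>x. L (pd e f x))" by (rule Suc.IH[OF _ Suc.prems(2)])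
    moreover have "pd e (\<lambda>x. L (f x)) x = L (pd e f x)" if "x \<in> X" for x
      using pd_eqI[OF D[OF that]] by (simp add: pd_def)
    ultimately show ?thesis by (rule Ck_on_transform[OF _ Suc.prems(2)])
  qed
  then show ?case using D by (auto simp: differentiable_def)
qed

lemma Ck_on_add:
  "Ck_on k X f \<Longrightarrow> Ck_on k X g \<Longrightarrow> open X \<Longrightarrow> Ck_on k X (\<lambda>x. f x + g x)"
proof (induction k arbitrary: f g)
  case 0
  then show ?case by (auto intro: continuous_on_add)
next
  case (Suc k)
  have D: "((\<lambda>x. f x + g x) has_derivative (\<lambda>h. frechet_derivative f (at x) h + frechet_derivative g (at x) h)) (at x)"
    if "x \<in> X" for x
    using Suc.prems that by (intro has_derivative_add) (auto simp: frechet_derivative_works)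
  have "Ck_on k X (pd e (\<lambda>x. f x + g x))" if "e \<in> coord_basis" for e
  proof -
    have "Ck_on k X (pd e f)" "Ck_on k X (pd e g)" using Suc.prems that by auto
    then have "Ck_on k X (\<lambda>x. pd e f x + pd e g x)" by (rule Suc.IH[OF _ _ Suc.prems(3)])
    moreover have "pd e (\<lambda>x. f x + g x) x = pd e f x + pd e g x" if "x \<in> X" for x
      using pd_eqI[OF D[OF that]] by (simp add: pd_def)
    ultimately show ?thesis by (rule Ck_on_transform[OF _ Suc.prems(3)])
  qed
  then show ?case using D by (auto simp: differentiable_def)
qed

lemma Ck_on_scaleR:
  "Ck_on k X f \<Longrightarrow> Ck_on k X g \<Longrightarrow> open X \<Longrightarrow> Ck_on k X (\<lambda>x. f x *\<^sub>R g x)"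
proof (induction k arbitrary: f g)
  case 0
  then show ?case by (auto intro: continuous_on_scaleR)
next
  case (Suc k)
  have D: "((\<lambda>x. f x *\<^sub>R g x) has_derivative
      (\<lambda>h. f x *\<^sub>R frechet_derivative g (at x) h + frechet_derivative f (at x) h *\<^sub>R g x)) (at x)"
    if "x \<in> X" for x
    using Suc.prems that by (intro has_derivative_scaleR) (auto simp: frechet_derivative_works)
  have "Ck_on k X (pd e (\<lambda>x. f x *\<^sub>R g x))" if "e \<in> coord_basis" for e
  proof -
    have "Ck_on k X (\<lambda>x. f x *\<^sub>R pd e g x + pd e f x *\<^sub>R g x)"
      using Suc.prems that Ck_on_Suc_imp[OF Suc.prems(1)] Ck_on_Suc_imp[OF Suc.prems(2)]
      by (intro Ck_on_add Suc.IH) auto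
    moreover have "pd e (\<lambda>x. f x *\<^sub>R g x) x = f x *\<^sub>R pd e g x + pd e f x *\<^sub>R g x" if "x \<in> X" for x
      using pd_eqI[OF D[OF that]] by (simp add: pd_def)
    ultimately show ?thesis by (rule Ck_on_transform[OF _ Suc.prems(3)])
  qed
  then show ?case using D by (auto simp: differentiable_def)
qed

text \<open>\<open>Ck_on\<close> speaks of the directions 1 and i only; the chain rule
  differentiates in the direction \<open>pd e g x\<close>, which is resolved here into these
  two.\<close>

lemma pd_linear:
  assumes "f differentiable (at x)"
  shows "pd h f x = Re h *\<^sub>R pd 1 f x + Im h *\<^sub>R pd \<i> f x"
proof -
  interpret bounded_linear "frechet_derivative f (at x)"
    using assms frechet_derivative_works has_derivative_bounded_linear by blast
  have "h = Re h *\<^sub>R 1 + Im h *\<^sub>R \<i>" by (simp add: complex_eq_iff)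
  then have "frechet_derivative f (at x) h = frechet_derivative f (at x) (Re h *\<^sub>R 1 + Im h *\<^sub>R \<i>)"
    by (rule arg_cong)
  also have "\<dots> = Re h *\<^sub>R frechet_derivative f (at x) 1 + Im h *\<^sub>R frechet_derivative f (at x) \<i>"
    by (simp only: add scaleR)
  finally show ?thesis unfolding pd_def .
qed

lemma pd_compose:
  assumes "g differentiable (at x)" "f differentiable (at (g x))"
  shows "pd e (\<lambda>x. f (g x)) x = pd (pd e g x) f (g x)"
    and "(\<lambda>x. f (g x)) differentiable (at x)"
proof -
  have "((\<lambda>x. f (g x)) has_derivative (\<lambda>h. frechet_derivative f (at (g x)) (frechet_derivative g (at x) h))) (at x)"
    by (rule has_derivative_compose[OF assms[unfolded frechet_derivative_works]])
  from pd_eqI[OF this] show "pd e (\<lambda>x. f (g x)) x = pd (pd e g x) f (g x)" by (simp add: pd_def)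
  show "(\<lambda>x. f (g x)) differentiable (at x)"
    using differentiable_chain_at[OF assms] unfolding o_def .
qed

text \<open>Induction on k through the chain rule: a derivative of the composition is a combination
  of \<open>pd 1 f\<close> and \<open>pd \<i> f\<close> composed with g, with the components of
  \<open>pd e g\<close> as coefficients.\<close>

lemma Ck_on_compose:
  fixes g :: "complex \<Rightarrow> complex"
  assumes "open X" "open Y" "g ` X \<subseteq> Y"
  shows "Ck_on k Y f \<Longrightarrow> Ck_on k X g \<Longrightarrow> Ck_on k X (\<lambda>x. f (g x))"
proof (induction k arbitrary: f)
  case 0
  then show ?case using continuous_on_compose2[of Y f X g] assms(3) by auto
next
  case (Suc k)
  have diff: "f differentiable (at (g x))" "g differentiable (at x)" if "x \<in> X" for x
    using Suc.prems assms(3) that by auto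
  have "Ck_on k X (pd e (\<lambda>x. f (g x)))" if e: "e \<in> coord_basis" for e
  proof -
    have g: "Ck_on k X g" by (rule Ck_on_Suc_imp) (rule Suc.prems)
    have pdg: "Ck_on k X (pd e g)" using Suc.prems e by auto
    have "Ck_on k Y (pd 1 f)" "Ck_on k Y (pd \<i> f)" using Suc.prems(1) by simp_all
    note pdf = this[THEN Suc.IH, OF g]
    have "Ck_on k X (\<lambda>x. Re (pd e g x) *\<^sub>R pd 1 f (g x) + Im (pd e g x) *\<^sub>R pd \<i> f (g x))"
      by (rule Ck_on_add[OF Ck_on_scaleR[OF Ck_on_bounded_linear_compose[OF bounded_linear_Re pdg assms(1)] pdf(1) assms(1)]
          Ck_on_scaleR[OF Ck_on_bounded_linear_compose[OF bounded_linear_Im pdg assms(1)] pdf(2) assms(1)] assms(1)])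
    moreover have "pd e (\<lambda>x. f (g x)) x = Re (pd e g x) *\<^sub>R pd 1 f (g x) + Im (pd e g x) *\<^sub>R pd \<i> f (g x)"
      if "x \<in> X" for x
      using pd_compose(1)[OF diff(2)[OF that] diff(1)[OF that]] pd_linear[OF diff(1)[OF that], of "pd e g x"] by simp
    ultimately show ?thesis by (rule Ck_on_transform[OF _ assms(1)])
  qed
  then show ?case using pd_compose(2)[OF diff(2) diff(1)] by auto
qed

lemma smooth_on_compose:
  fixes g :: "complex \<Rightarrow> complex"
  assumes "open X" "open Y" "g ` X \<subseteq> Y" "smooth_on Y f" "smooth_on X g"
  shows "smooth_on X (\<lambda>x. f (g x))"
  unfolding smooth_on_def
proof
  show "Ck_on k X (\<lambda>x. f (g x))" for k
    using Ck_on_compose[OF assms(1-3), of k f] assms(4,5) unfolding smooth_on_def by blast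
qed

lemma smooth_on_cong:
  assumes "open X" "\<And>y. y \<in> X \<Longrightarrow> f y = g y"
  shows "smooth_on X f \<longleftrightarrow> smooth_on X g"
  unfolding smooth_on_def using Ck_on_cong[of X f g, OF assms] by (simp only:)

lemma smooth_on_subset: "smooth_on X f \<Longrightarrow> Y \<subseteq> X \<Longrightarrow> smooth_on Y f"
  unfolding smooth_on_def by (intro allI, rule Ck_on_subset, erule spec)

lemma smooth_on_bounded_linear:
  assumes "bounded_linear L"
  shows "smooth_on X L"
proof -
  have "Ck_on k X L" for k
  proof (cases k)
    case 0
    then show ?thesis using linear_continuous_on[OF assms] by simp
  next
    case (Suc j)
    have D: "(L has_derivative L) (at x)" for x by (rule bounded_linear_imp_has_derivative[OF assms])
    have "pd e L = (\<lambda>x. L e)" for e by (rule ext) (rule pd_eqI[OF D])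
    then show ?thesis using D Suc Ck_on_const by (auto simp: differentiable_def)
  qed
  then show ?thesis by (simp add: smooth_on_def)
qed

lemma smooth_on_differentiable: "smooth_on X f \<Longrightarrow> x \<in> X \<Longrightarrow> f differentiable (at x)"
  unfolding smooth_on_def by (drule spec[of _ "Suc 0"]) auto

lemma smooth_on_imp_continuous_on: "smooth_on X f \<Longrightarrow> continuous_on X f"
  unfolding smooth_on_def by (drule spec[of _ 0]) (simp only: Ck_on.simps)

lemma smooth_on_imp_continuous_on_pd: "smooth_on X f \<Longrightarrow> e \<in> coord_basis \<Longrightarrow> continuous_on X (pd e f)"
  unfolding smooth_on_def by (drule spec[of _ "Suc 0"]) auto

section \<open>The model surfaces\<close>

text \<open>The parameters (mu, a, b) of \<open>model_energy\<close>. On admissible parameters they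
  separate the families: cousins exclude mu = 1, and the third family has a > 0.\<close>

fun model_data :: "model_params \<Rightarrow> real \<times> real \<times> real" where
  "model_data (Catenoid a) = (1, 0, a)"
| "model_data (Catenoid_Cousin \<mu> a) = (\<mu>, 0, a)"
| "model_data (Third_Family n a b) = (real n, a, b)"

lemma model_data_inject:
  "admissible m \<Longrightarrow> admissible m' \<Longrightarrow> model_data m = model_data m' \<Longrightarrow> m = m'"
  by (cases m; cases m') auto

lemma model_data_admissible:
  "admissible m \<Longrightarrow> model_data m = (\<mu>, a, b) \<Longrightarrow> \<mu> > 0 \<and> a \<ge> 0 \<and> b > 0"
  by (cases m) auto

lemma model_data_exists:
  assumes "\<mu> > 0" "a \<ge> 0" "b > 0" "a = 0 \<or> \<mu> \<in> \<nat>"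
  obtains m where "admissible m" "model_data m = (\<mu>, a, b)"
proof (cases "a = 0")
  case True
  show ?thesis
  proof (cases "\<mu> = 1")
    case True
    then show ?thesis using that[of "Catenoid b"] \<open>a = 0\<close> assms by simp
  next
    case False
    then show ?thesis using that[of "Catenoid_Cousin \<mu> b"] \<open>a = 0\<close> assms by simp
  qed
next
  case False
  then obtain n where n: "\<mu> = real n" using assms by (auto simp: Nats_def)
  then have "n \<ge> 1" using assms(1) by (cases n) auto
  then show ?thesis using that[of "Third_Family n a b"] n False assms by simp
qed

abbreviation model_density :: "model_params \<Rightarrow> complex \<Rightarrow> real" where
  "model_density m \<equiv> weierstrass_factor (model_g m) (model_\<alpha> m)"

lemma weierstrass_factor_scaled:
  "weierstrass_factor g \<alpha> z * r\<^sup>2 = (cmod (\<alpha> z) * (1 + (cmod (g z))\<^sup>2) * r)\<^sup>2 / 4"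
  by (simp add: weierstrass_factor_def power_mult_distrib)

text \<open>For w = exp z one has |dw| = exp (Re z) |dz|, so the left side is the density of the
  metric in the coordinate log w. In each family the square root of the density is half the
  energy.\<close>

lemma model_density_exp:
  assumes m: "admissible m" "model_data m = (\<mu>, a, b)"
  shows "model_density m (exp z) * (exp (Re z))\<^sup>2 = (model_energy \<mu> a b z)\<^sup>2 / 4"
proof -
  have "cmod (model_\<alpha> m (exp z)) * (1 + (cmod (model_g m (exp z)))\<^sup>2) * exp (Re z) = model_energy \<mu> a b z"
  proof (cases m)
    case (Catenoid c)
    have "cmod (exp z powi - 2) = exp (- 2 * Re z)"
      by (simp add: norm_power_int norm_inverse norm_power norm_exp_eq_Re power_int_minus exp_minus exp_double)
    moreover have "exp (- 2 * Re z) * exp (Re z) = exp (- Re z)" "exp (- 2 * Re z) * (exp (Re z))\<^sup>2 * exp (Re z) = exp (Re z)"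
      by (simp_all add: power2_eq_square flip: exp_add)
    ultimately show ?thesis using m Catenoid
      by (simp add: model_energy_def norm_mult norm_exp_eq_Re algebra_simps)
  next
    case (Catenoid_Cousin \<nu> c)
    have "cmod (exp z powr of_real \<mu>) = exp (\<mu> * Re z)"
      "cmod (exp z powr of_real (- \<mu> - 1)) = exp ((- \<mu> - 1) * Re z)"
      by (simp_all add: norm_powr_real_powr' norm_exp_eq_Re powr_def del: of_real_minus of_real_diff)
    moreover have "exp ((- \<mu> - 1) * Re z) * exp (Re z) = exp (- \<mu> * Re z)"
      "exp ((- \<mu> - 1) * Re z) * (exp (\<mu> * Re z))\<^sup>2 * exp (Re z) = exp (\<mu> * Re z)"
      by (simp_all add: power2_eq_square algebra_simps flip: exp_add)
    ultimately show ?thesis using m Catenoid_Cousin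
      by (simp add: model_energy_def norm_mult distrib_left mult.assoc del: of_real_minus of_real_diff)
         (simp add: algebra_simps)
  next
    case (Third_Family n c d)
    let ?E = "exp (real n * Re z)"
    have g: "(cmod (exp z ^ n + of_real a))\<^sup>2 = ?E\<^sup>2 + a\<^sup>2 + 2 * a * ?E * cos (real n * Im z)"
    proof -
      have "exp z ^ n = exp (of_nat n * z)" by (simp add: exp_of_nat_mult)
      then have "(cmod (exp z ^ n + of_real a))\<^sup>2
          = (?E * cos (real n * Im z) + a)\<^sup>2 + (?E * sin (real n * Im z))\<^sup>2"
        by (simp add: cmod_power2 Re_exp Im_exp)
      also have "\<dots> = ?E\<^sup>2 * ((sin (real n * Im z))\<^sup>2 + (cos (real n * Im z))\<^sup>2) + a\<^sup>2 + 2 * a * ?E * cos (real n * Im z)"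
        by algebra
      finally show ?thesis by simp
    qed
    have "cmod (exp z powi (- int n - 1)) = exp (Re z) powi (- int (Suc n))"
    proof -
      have "- int n - 1 = - int (Suc n)" by simp
      then show ?thesis by (simp only: norm_power_int norm_exp_eq_Re)
    qed
    also have "\<dots> = inverse (exp (Re z) ^ Suc n)" by (simp only: power_int_minus power_int_of_nat)
    also have "\<dots> = exp (- real n * Re z) * exp (- Re z)"
      by (simp add: exp_minus exp_of_nat_mult)
    finally have \<alpha>: "cmod (exp z powi (- int n - 1)) * exp (Re z) = exp (- real n * Re z)"
      by (simp add: mult.assoc flip: exp_add)
    have "exp (- real n * Re z) * ?E = 1" "exp (- real n * Re z) * ?E\<^sup>2 = ?E"
      by (simp_all add: power2_eq_square flip: exp_add)
    then have *: "exp (- real n * Re z) * (1 + (?E\<^sup>2 + a\<^sup>2 + 2 * a * ?E * cos (real n * Im z)))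
        = ?E + (1 + a\<^sup>2) * exp (- real n * Re z) + 2 * a * cos (real n * Im z)"
      by algebra
    have m': "m = Third_Family n a b" "\<mu> = real n" "b > 0" using m Third_Family by auto
    have "cmod (model_\<alpha> m (exp z)) * (1 + (cmod (model_g m (exp z)))\<^sup>2) * exp (Re z)
        = b * ((cmod (exp z powi (- int n - 1)) * exp (Re z)) * (1 + (cmod (exp z ^ n + of_real a))\<^sup>2))"
      using m' by (simp only: model_\<alpha>.simps model_g.simps norm_mult norm_of_real abs_of_pos mult_ac)
    then show ?thesis unfolding \<alpha> g * model_energy_def m'(2) .
  qed
  then show ?thesis by (simp only: weierstrass_factor_scaled)
qed

text \<open>The lifted pair of a model: u^2 = b exp (- mu z) is the coefficient of \<eta> in the
  coordinate log, and v / u = exp (mu z) + a is g.\<close>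

definition model_u :: "real \<Rightarrow> real \<Rightarrow> complex \<Rightarrow> complex" where
  "model_u \<mu> b z = of_real (sqrt b) * exp (- (of_real (\<mu> / 2)) * z)"

definition model_v :: "real \<Rightarrow> real \<Rightarrow> real \<Rightarrow> complex \<Rightarrow> complex" where
  "model_v \<mu> a b z = of_real (sqrt b) * (exp (of_real (\<mu> / 2) * z) + of_real a * exp (- (of_real (\<mu> / 2)) * z))"

lemma holomorphic_model: "model_u \<mu> b holomorphic_on X" "model_v \<mu> a b holomorphic_on X"
  unfolding model_u_def[abs_def] model_v_def[abs_def] by (intro holomorphic_intros)+

lemma deriv_model:
  "deriv (model_u \<mu> b) = (\<lambda>z. - of_real (\<mu> / 2) * model_u \<mu> b z)"
  "deriv (model_v \<mu> a b) = (\<lambda>z. of_real (\<mu> / 2) * (model_v \<mu> a b z - 2 * of_real a * model_u \<mu> b z))"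
  unfolding model_u_def[abs_def] model_v_def[abs_def]
  by (rule ext, rule DERIV_imp_deriv, (rule derivative_eq_intros refl)+, simp add: algebra_simps)+

lemma deriv2_model:
  "deriv (deriv (model_u \<mu> b)) z = of_real (\<mu>\<^sup>2 / 4) * model_u \<mu> b z"
  "deriv (deriv (model_v \<mu> a b)) z = of_real (\<mu>\<^sup>2 / 4) * model_v \<mu> a b z"
proof -
  have D: "(model_u \<mu> b has_field_derivative deriv (model_u \<mu> b) z) (at z)"
    "(model_v \<mu> a b has_field_derivative deriv (model_v \<mu> a b) z) (at z)"
    by (intro holomorphic_has_deriv holomorphic_model)+
  show "deriv (deriv (model_u \<mu> b)) z = of_real (\<mu>\<^sup>2 / 4) * model_u \<mu> b z"
    unfolding deriv_model(1)
    by (rule DERIV_imp_deriv, rule DERIV_cmult[OF D(1), THEN DERIV_cong]) (simp add: deriv_model power2_eq_square)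
  have "((\<lambda>z. of_real (\<mu> / 2) * (model_v \<mu> a b z - 2 * of_real a * model_u \<mu> b z)) has_field_derivative
      of_real (\<mu> / 2) * (deriv (model_v \<mu> a b) z - 2 * of_real a * deriv (model_u \<mu> b) z)) (at z)"
    by (intro DERIV_cmult DERIV_diff D)
  then have "deriv (deriv (model_v \<mu> a b)) z
      = of_real (\<mu> / 2) * (deriv (model_v \<mu> a b) z - 2 * of_real a * deriv (model_u \<mu> b) z)"
    unfolding deriv_model(2)[of \<mu> a b] by (rule DERIV_imp_deriv)
  also have "\<dots> = of_real (\<mu>\<^sup>2 / 4) * model_v \<mu> a b z"
    unfolding deriv_model by (simp add: power2_eq_square algebra_simps)
  finally show "deriv (deriv (model_v \<mu> a b)) z = of_real (\<mu>\<^sup>2 / 4) * model_v \<mu> a b z" .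
qed

lemma model_exp_mult: "exp (of_real \<mu> * z) * exp (- of_real \<mu> * z) = (1 :: complex)"
  by (simp flip: exp_add)

lemma energy_model:
  assumes "b > 0"
  shows "energy (model_u \<mu> b) (model_v \<mu> a b) z = model_energy \<mu> a b z"
proof -
  let ?x = "\<mu> / 2 * Re z" and ?y = "\<mu> / 2 * Im z"
  have 1: "(cmod (model_u \<mu> b z))\<^sup>2 = b * exp (- \<mu> * Re z)"
    using assms by (simp add: model_u_def norm_mult power_mult_distrib norm_exp_eq_Re flip: exp_double)
  have "(cmod (model_v \<mu> a b z))\<^sup>2 = b * (cmod (exp (of_real (\<mu> / 2) * z) + of_real a * exp (- (of_real (\<mu> / 2)) * z)))\<^sup>2"
    using assms by (simp add: model_v_def norm_mult power_mult_distrib)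
  also have "(cmod (exp (of_real (\<mu> / 2) * z) + of_real a * exp (- (of_real (\<mu> / 2)) * z)))\<^sup>2
      = (exp ?x * cos ?y + a * (exp (- ?x) * cos ?y))\<^sup>2 + (exp ?x * sin ?y - a * (exp (- ?x) * sin ?y))\<^sup>2"
    unfolding cmod_power2 by (simp add: Re_exp Im_exp)
  also have "\<dots> = (exp ?x)\<^sup>2 * ((cos ?y)\<^sup>2 + (sin ?y)\<^sup>2) + a\<^sup>2 * (exp (- ?x))\<^sup>2 * ((cos ?y)\<^sup>2 + (sin ?y)\<^sup>2)
      + 2 * a * (exp ?x * exp (- ?x)) * ((cos ?y)\<^sup>2 - (sin ?y)\<^sup>2)"
    by algebra
  also have "(cos ?y)\<^sup>2 - (sin ?y)\<^sup>2 = cos (\<mu> * Im z)" using cos_double[of ?y] by simp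
  also have "(exp ?x)\<^sup>2 = exp (\<mu> * Re z)" by (simp flip: exp_double)
  also have "(exp (- ?x))\<^sup>2 = exp (- \<mu> * Re z)" by (simp flip: exp_double)
  finally have 2: "(cmod (model_v \<mu> a b z))\<^sup>2 = b * (exp (\<mu> * Re z) + a\<^sup>2 * exp (- \<mu> * Re z) + 2 * a * cos (\<mu> * Im z))"
    by (simp flip: exp_add)
  show ?thesis unfolding energy_def 1 2 model_energy_def by (simp add: algebra_simps)
qed

lemma wronskian_model:
  assumes "b > 0"
  shows "wronskian (model_u \<mu> b) (model_v \<mu> a b) z = of_real (b * \<mu>)"
proof -
  have "wronskian (model_u \<mu> b) (model_v \<mu> a b) z
      = of_real \<mu> * (of_real (sqrt b) * of_real (sqrt b)) * (exp (of_real (\<mu> / 2) * z) * exp (- of_real (\<mu> / 2) * z))"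
    unfolding wronskian_def deriv_model unfolding model_u_def model_v_def by (simp add: algebra_simps)
  also have "of_real (sqrt b) * of_real (sqrt b) = (of_real b :: complex)"
    using assms by (simp flip: of_real_mult)
  finally show ?thesis unfolding model_exp_mult by simp
qed

lemma model_energy_pos: "b > 0 \<Longrightarrow> \<mu> > 0 \<Longrightarrow> model_energy \<mu> a b z > 0"
  using energy_pos_if_wronskian[of "model_u \<mu> b" "model_v \<mu> a b" z]
  by (simp add: wronskian_model energy_model)

lemma energy_zz_model:
  "b > 0 \<Longrightarrow> energy_zz (model_u \<mu> b) (model_v \<mu> a b) z = of_real (\<mu>\<^sup>2 / 4 * model_energy \<mu> a b z)"
  by (simp add: energy_zz_def deriv2_model flip: energy_model) (simp add: energy_complex algebra_simps)

text \<open>Stems from comparing y + q / y with x + p / x at x = 1 and x = 2, for y = e x and for y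
  = e / x. In the first case e = 1 follows, in the second q = e = p.\<close>

lemma exp_coeffs_unique:
  fixes e p q :: real
  assumes e: "e > 0" and 1: "e + q / e = 1 + p"
  shows "2 * e + q / (2 * e) = 2 + p / 2 \<Longrightarrow> q = p" "e / 2 + q / (e / 2) = 2 + p / 2 \<Longrightarrow> q = p"
proof -
  have "e * (e + q / e) = e * e + q" using e by (simp add: distrib_left)
  then have q: "e * e + q = e + e * p" using 1 by (simp add: distrib_left)
  show "q = p" if "2 * e + q / (2 * e) = 2 + p / 2"
  proof -
    have "4 * (e * e) + q = e * (2 * e + q / (2 * e)) * 2" using e by (simp add: distrib_left)
    also have "\<dots> = 4 * e + e * p" unfolding that by (simp add: distrib_left)
    finally have "4 * (e * e) + q = 4 * e + e * p" .
    with q have "e * e = e" by linarith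
    then have "e = 1" using e by simp
    then show ?thesis using q by simp
  qed
  show "q = p" if "e / 2 + q / (e / 2) = 2 + p / 2"
  proof -
    have "e * e + 4 * q = e * (e / 2 + q / (e / 2)) * 2" using e by (simp add: distrib_left)
    also have "\<dots> = 4 * e + e * p" unfolding that by (simp add: distrib_left)
    finally have "e * e + 4 * q = 4 * e + e * p" .
    with q have "q = e" "e * e = e * p" by linarith+
    then show ?thesis using e by simp
  qed
qed

text \<open>Equal energies share |W|, which is b mu, and P_zz, which is mu^2 / 4 times P. This
  identifies mu and b; the parameter a is recovered from the part of the energy without the
  cosine.\<close>

lemma model_energy_eq_affine:
  assumes pos: "\<mu> > 0" "a \<ge> 0" "b > 0" "\<mu>' > 0" "a' \<ge> 0" "b' > 0" and \<sigma>: "\<sigma> = 1 \<or> \<sigma> = -1"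
    and eq: "\<And>z. model_energy \<mu>' a' b' (of_real \<sigma> * z + \<beta>) = model_energy \<mu> a b z"
  shows "(\<mu>, a, b) = (\<mu>', a', b')"
proof -
  let ?f = "\<lambda>z. of_real \<sigma> * z + \<beta>" and ?u = "model_u \<mu>' b'" and ?v = "model_v \<mu>' a' b'"
  have hol: "?f holomorphic_on UNIV" by (intro holomorphic_intros)
  have Df: "(?f has_field_derivative of_real \<sigma>) (at z)" for z by (auto intro!: derivative_eq_intros)
  have d: "deriv (\<lambda>z. w (?f z)) z = deriv w (?f z) * of_real \<sigma>" if "w holomorphic_on UNIV" for w z
    by (rule deriv_compose_UNIV[OF that Df])
  have d2: "deriv (deriv (\<lambda>z. w (?f z))) z = deriv (deriv w) (?f z)" if w: "w holomorphic_on UNIV" for w z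
  proof -
    have "(deriv w has_field_derivative deriv (deriv w) (?f z)) (at (?f z))"
      by (rule holomorphic_has_deriv[OF holomorphic_deriv[OF w open_UNIV]])
    from DERIV_cmult_right[OF DERIV_chain2[OF this Df], of "of_real \<sigma>"]
    have "((\<lambda>z. deriv w (?f z) * of_real \<sigma>) has_field_derivative deriv (deriv w) (?f z)) (at z)"
      using \<sigma> by auto
    then show ?thesis unfolding d[OF w, abs_def] by (rule DERIV_imp_deriv)
  qed
  have en: "energy (\<lambda>z. ?u (?f z)) (\<lambda>z. ?v (?f z)) z = energy (model_u \<mu> b) (model_v \<mu> a b) z" for z
    using eq[of z] pos by (simp add: energy_compose[of ?u ?f ?v] energy_model)
  note h = holomorphic_compose_UNIV[OF holomorphic_model(1) hol] holomorphic_compose_UNIV[OF holomorphic_model(2) hol]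
  have "cmod (wronskian ?u ?v (?f 0) * of_real \<sigma>) = cmod (wronskian (model_u \<mu> b) (model_v \<mu> a b) 0)"
    using norm_wronskian_eq[OF h(1,2) holomorphic_model open_UNIV UNIV_I en, of 0]
    unfolding wronskian_def d[OF holomorphic_model(1)] d[OF holomorphic_model(2)] by (simp add: algebra_simps)
  then have bmu: "b' * \<mu>' = b * \<mu>"
    using pos \<sigma> by (auto simp: wronskian_model norm_mult)
  have "energy_zz ?u ?v (?f 0) = energy_zz (model_u \<mu> b) (model_v \<mu> a b) 0"
    using energy_zz_eq[OF h(1,2) holomorphic_model open_UNIV UNIV_I en, of 0]
    unfolding energy_zz_def d2[OF holomorphic_model(1)] d2[OF holomorphic_model(2)] .
  then have "\<mu>'\<^sup>2 / 4 * model_energy \<mu> a b 0 = \<mu>\<^sup>2 / 4 * model_energy \<mu> a b 0"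
    using pos eq[of 0] unfolding energy_zz_model[OF pos(3)] energy_zz_model[OF pos(6)] of_real_eq_iff by simp
  then have "\<mu>'\<^sup>2 = \<mu>\<^sup>2" using model_energy_pos[OF pos(3,1), of a 0] by simp
  then have mu: "\<mu>' = \<mu>" using pos by (simp add: power2_eq_iff)
  then have b: "b' = b" using bmu pos by simp
  \<comment> \<open>Translation by half a period of the cosine, pi / mu, reverses its sign, so that
    the sum retains the exponentials alone. The sign \<sigma> fits the shift to the affine
    map.\<close>
  have sum: "model_energy \<mu> x b z + model_energy \<mu> x b (z + \<i> * of_real (\<sigma> * (pi / \<mu>)))
      = 2 * b * (exp (\<mu> * Re z) + (1 + x\<^sup>2) * exp (- \<mu> * Re z))" for x z
  proof -
    have "\<mu> * (Im z + \<sigma> * (pi / \<mu>)) = \<mu> * Im z + \<sigma> * pi" using pos by (simp add: field_simps)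
    then have "cos (\<mu> * Im (z + \<i> * of_real (\<sigma> * (pi / \<mu>)))) = - cos (\<mu> * Im z)"
      using \<sigma> by (auto simp: cos_diff)
    then show ?thesis by (simp add: model_energy_def algebra_simps)
  qed
  have sq: "exp (\<mu> * (\<sigma> * t + Re \<beta>)) + (1 + a'\<^sup>2) * exp (- \<mu> * (\<sigma> * t + Re \<beta>))
      = exp (\<mu> * t) + (1 + a\<^sup>2) * exp (- \<mu> * t)" for t
  proof -
    have "?f (of_real t) + \<i> * of_real (\<sigma> * (pi / \<mu>)) = ?f (of_real t + \<i> * of_real (pi / \<mu>))"
      by (simp add: algebra_simps)
    moreover have "of_real t + \<i> * of_real (\<sigma> * (pi / \<mu>)) = of_real t + of_real \<sigma> * (\<i> * of_real (pi / \<mu>))" by simp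
    moreover have "model_energy \<mu> a b (of_real t + \<i> * of_real (pi / \<mu>)) = model_energy \<mu> a b (of_real t + \<i> * of_real (\<sigma> * (pi / \<mu>)))"
      using \<sigma> pos by (auto simp: model_energy_def)
    ultimately have "2 * b * (exp (\<mu> * Re (?f (of_real t))) + (1 + a'\<^sup>2) * exp (- \<mu> * Re (?f (of_real t))))
        = 2 * b * (exp (\<mu> * Re (of_real t :: complex)) + (1 + a\<^sup>2) * exp (- \<mu> * Re (of_real t :: complex)))"
      unfolding sum[symmetric] using eq unfolding mu b by metis
    then show ?thesis using pos by simp
  qed
  have "1 + a'\<^sup>2 = 1 + a\<^sup>2"
  proof -
    define e where "e = exp (\<mu> * Re \<beta>)"
    have e: "e > 0" by (simp add: e_def)
    \<comment> \<open>Substituting t = ln x / mu; \<open>x powr \<sigma>\<close> covers x and 1 / x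
      at once.\<close>
    have pq: "x powr \<sigma> * e + (1 + a'\<^sup>2) / (x powr \<sigma> * e) = x + (1 + a\<^sup>2) / x" if "x > 0" for x
    proof -
      have "exp (\<mu> * (\<sigma> * (ln x / \<mu>) + Re \<beta>)) = x powr \<sigma> * e"
        using pos that by (simp add: powr_def e_def distrib_left exp_add)
      moreover have "\<mu> * (ln x / \<mu>) = ln x" using pos by simp
      ultimately show ?thesis using sq[of "ln x / \<mu>"] that unfolding mult_minus_left exp_minus
        by (simp only: exp_ln divide_inverse)
    qed
    show ?thesis
    proof (cases "\<sigma> = 1")
      case True
      then have "2 powr \<sigma> * e = 2 * e" "1 powr \<sigma> * e = e" by simp_all
      then have "e + (1 + a'\<^sup>2) / e = 1 + (1 + a\<^sup>2)" "2 * e + (1 + a'\<^sup>2) / (2 * e) = 2 + (1 + a\<^sup>2) / 2"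
        using pq[of 1] pq[of 2] by (simp_all only: zero_less_one zero_less_numeral simp_thms div_by_1)
      then show ?thesis by (rule exp_coeffs_unique(1)[OF e])
    next
      case False
      with \<sigma> have s: "\<sigma> = - 1" by simp
      have "2 powr \<sigma> * e = e / 2" "1 powr \<sigma> * e = e" unfolding s by (simp_all add: powr_minus_divide)
      then have "e + (1 + a'\<^sup>2) / e = 1 + (1 + a\<^sup>2)" "e / 2 + (1 + a'\<^sup>2) / (e / 2) = 2 + (1 + a\<^sup>2) / 2"
        using pq[of 1] pq[of 2] by (simp_all only: zero_less_one zero_less_numeral simp_thms div_by_1)
      then show ?thesis by (rule exp_coeffs_unique(2)[OF e])
    qed
  qed
  then have "a' = a" using pos by (simp add: power2_eq_iff_nonneg)
  then show ?thesis using mu b by simp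
qed

section \<open>The model surfaces are mutually non-isometric\<close>

abbreviation plane_chart :: "complex set \<Rightarrow> complex chart" where
  "plane_chart D \<equiv> (D, \<lambda>z. z)"

lemma param_of_right: "y \<in> range_of c \<Longrightarrow> coord_of c (param_of c y) = y"
  and param_of_in: "y \<in> range_of c \<Longrightarrow> param_of c y \<in> dom_of c"
  unfolding param_of_def by (simp_all add: f_inv_into_f inv_into_into)

lemma coordinate_patch_inj: "coordinate_patch M c \<Longrightarrow> inj_on (coord_of c) (dom_of c)"
  unfolding coordinate_patch_def homeomorphism_def by (metis inj_on_def)

lemma param_of_left:
  "coordinate_patch M c \<Longrightarrow> p \<in> dom_of c \<Longrightarrow> param_of c (coord_of c p) = p"
  unfolding param_of_def by (rule inv_into_f_f[OF coordinate_patch_inj])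

lemma param_of_plane_chart: "y \<in> D \<Longrightarrow> param_of (plane_chart D) y = y"
  using param_of_right[of y "plane_chart D"] by simp

lemma coordinate_patch_plane_chart:
  assumes "open D"
  shows "coordinate_patch D (plane_chart D)"
  using assms unfolding coordinate_patch_def
  by (auto simp: homeomorphism_def param_of_plane_chart image_iff cong: continuous_on_cong)

lemma pd_ident: "pd e (\<lambda>z. z) x = e"
  by (rule pd_eqI) (rule has_derivative_ident)

lemma pd_param_of_plane_chart:
  assumes "open D" "x \<in> D"
  shows "pd e (param_of (plane_chart D)) x = e"
  using pd_cong_open[of D x "param_of (plane_chart D)" "\<lambda>z. z" e] assms pd_ident
  by (simp add: param_of_plane_chart)

lemma oriented_compatible_refl_plane_chart:
  assumes "open D"
  shows "oriented_compatible (plane_chart D) (plane_chart D)"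
proof -
  let ?c = "plane_chart D"
  have tr: "transition ?c ?c y = y" if "y \<in> D" for y
    using that by (simp add: transition_def param_of_plane_chart)
  have "smooth_on D (transition ?c ?c)"
    using smooth_on_cong[of D "transition ?c ?c" "\<lambda>z. z"] tr assms
      smooth_on_bounded_linear[OF bounded_linear_ident] by simp
  moreover have "jac_det (transition ?c ?c) x > 0" if "x \<in> D" for x
    using pd_cong_open[of D x "transition ?c ?c" "\<lambda>z. z"] tr assms that
    by (simp add: jac_det_def pd_ident)
  ultimately show ?thesis by (simp add: oriented_compatible_def)
qed

lemma plane_chart_in_atlas:
  assumes "open D"
  shows "plane_chart D \<in> atlas (conformal_plane_domain D \<rho>)"
  using coordinate_patch_plane_chart[OF assms] oriented_compatible_refl_plane_chart[OF assms]
  by (simp add: conformal_plane_domain_def)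

lemma met_plane_chart:
  assumes "open D" "x \<in> D"
  shows "met (conformal_plane_domain D \<rho>) (plane_chart D) x u v = \<rho> x * (u \<bullet> v)"
  using assms by (simp add: conformal_plane_domain_def pd_param_of_plane_chart param_of_plane_chart)

section \<open>Conformal maps of the punctured plane\<close>

lemma conformal_map_dichotomy:
  fixes A B :: complex
  assumes "cmod A = cmod B" "A \<bullet> B = 0"
  shows "B = \<i> * A \<or> B = - \<i> * A"
proof -
  have eq: "(Re A)\<^sup>2 + (Im A)\<^sup>2 = (Re B)\<^sup>2 + (Im B)\<^sup>2"
    using assms(1) by (metis cmod_power2)
  have ip: "Re A * Re B + Im A * Im B = 0" using assms(2) by (simp add: inner_complex_def)
  have "(Re B + Im A) * (Re B - Im A) * ((Re A)\<^sup>2 + (Im A)\<^sup>2) = 0"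
    "(Im B - Re A) * (Im B + Re A) * ((Re A)\<^sup>2 + (Im A)\<^sup>2) = 0"
    using eq ip by algebra+
  show ?thesis
  proof (cases "A = 0")
    case True
    then show ?thesis using assms(1) by simp
  next
    case False
    then have "(Re A)\<^sup>2 + (Im A)\<^sup>2 \<noteq> 0" by (simp add: complex_eq_iff sum_power2_eq_zero_iff)
    then have "Re B = - Im A \<or> Re B = Im A" "Im B = Re A \<or> Im B = - Re A"
      using \<open>(Re B + Im A) * (Re B - Im A) * ((Re A)\<^sup>2 + (Im A)\<^sup>2) = 0\<close>
        \<open>(Im B - Re A) * (Im B + Re A) * ((Re A)\<^sup>2 + (Im A)\<^sup>2) = 0\<close> by auto
    then show ?thesis using ip by (auto simp: complex_eq_iff)
  qed
qed

lemma has_field_derivative_of_pd: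
  assumes "F differentiable (at x)" "pd \<i> F x = \<i> * pd 1 F x"
  shows "(F has_field_derivative pd 1 F x) (at x)"
proof -
  have "(F has_derivative frechet_derivative F (at x)) (at x)"
    using assms(1) by (simp add: frechet_derivative_works)
  moreover have "frechet_derivative F (at x) = (\<lambda>h. pd 1 F x * h)"
  proof
    fix h
    show "frechet_derivative F (at x) h = pd 1 F x * h"
      using pd_linear[OF assms(1), of h] assms(2)
      by (simp add: pd_def scaleR_conv_of_real complex_eq_iff algebra_simps)
  qed
  ultimately show ?thesis by (simp add: has_field_derivative_def)
qed

text \<open>The two Cauchy-Riemann alternatives are closed conditions, as the derivatives are
  continuous, and exclude each other, as \<open>pd 1 F x\<close> is nonzero. Connectedness of the
  punctured plane selects one of them globally.\<close>

lemma conformal_on_punctured_plane: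
  assumes diff: "\<And>x. x \<in> - {0} \<Longrightarrow> F differentiable (at x)"
    and cont: "\<And>e. e \<in> coord_basis \<Longrightarrow> continuous_on (- {0}) (pd e F)"
    and conf: "\<And>x. x \<in> - {0} \<Longrightarrow> pd 1 F x \<noteq> 0 \<and> (pd \<i> F x = \<i> * pd 1 F x \<or> pd \<i> F x = - \<i> * pd 1 F x)"
  shows "F holomorphic_on - {0} \<or> (\<lambda>z. cnj (F z)) holomorphic_on - {0}"
proof -
  let ?X = "{x \<in> - {0}. pd \<i> F x = \<i> * pd 1 F x}" and ?Y = "{x \<in> - {0}. pd \<i> F x = - \<i> * pd 1 F x}"
  have oD: "open (- {0 :: complex})" by auto
  have c1: "continuous_on (- {0}) (\<lambda>x. pd \<i> F x - \<i> * pd 1 F x)"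
    and c2: "continuous_on (- {0}) (\<lambda>x. pd \<i> F x - - \<i> * pd 1 F x)"
    using cont by (auto intro!: continuous_intros)
  have cl: "closedin (top_of_set (- {0})) ?X" "closedin (top_of_set (- {0})) ?Y"
    using continuous_closedin_preimage_constant[OF c1, of 0] continuous_closedin_preimage_constant[OF c2, of 0]
    by (simp_all only: right_minus_eq)
  have un: "?X \<union> ?Y = - {0}" using conf by blast
  have "\<i> * pd 1 F x \<noteq> - \<i> * pd 1 F x" if "x \<in> - {0}" for x
    using conf[OF that] by (simp add: eq_neg_iff_add_eq_0)
  then have dis: "?X \<inter> ?Y = {}" by force
  have "connected (- {0 :: complex})"
    by (rule connected_punctured_universe) simp
  then have "?X = {} \<or> ?Y = {}"
    unfolding connected_closedin_eq using cl un dis by blast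
  then show ?thesis
  proof
    assume "?Y = {}"
    then have "pd \<i> F x = \<i> * pd 1 F x" if "x \<in> - {0}" for x using conf[OF that] that by blast
    then have "F holomorphic_on - {0}"
      unfolding holomorphic_on_open[OF oD] using has_field_derivative_of_pd[OF diff] by blast
    then show ?thesis ..
  next
    assume "?X = {}"
    then have anti: "pd \<i> F x = - \<i> * pd 1 F x" if "x \<in> - {0}" for x using conf[OF that] that by blast
    have "((\<lambda>z. cnj (F z)) has_field_derivative cnj (pd 1 F x)) (at x)" if "x \<in> - {0}" for x
    proof -
      have D: "((\<lambda>z. cnj (F z)) has_derivative (\<lambda>h. cnj (frechet_derivative F (at x) h))) (at x)"
        using diff[OF that] by (intro has_derivative_cnj) (simp add: frechet_derivative_works)
      have p: "pd e (\<lambda>z. cnj (F z)) x = cnj (pd e F x)" for e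
        using pd_eqI[OF D] by (simp add: pd_def)
      have "((\<lambda>z. cnj (F z)) has_field_derivative pd 1 (\<lambda>z. cnj (F z)) x) (at x)"
        by (rule has_field_derivative_of_pd) (use D anti[OF that] p in \<open>auto simp: differentiable_def\<close>)
      then show ?thesis by (simp add: p)
    qed
    then have "(\<lambda>z. cnj (F z)) holomorphic_on - {0}" unfolding holomorphic_on_open[OF oD] by blast
    then show ?thesis ..
  qed
qed

lemma model_energy_cnj: "model_energy \<mu> a b (cnj z) = model_energy \<mu> a b z"
  by (simp add: model_energy_def)

lemma model_density_pos:
  assumes "admissible m" "z \<noteq> 0"
  shows "model_density m z > 0"
proof -
  obtain \<mu> a b where d: "model_data m = (\<mu>, a, b)" by (cases "model_data m") auto
  have "model_density m (exp (Ln z)) * (exp (Re (Ln z)))\<^sup>2 > 0"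
    unfolding model_density_exp[OF assms(1) d]
    using model_energy_pos[of b \<mu> a "Ln z"] model_data_admissible[OF assms(1) d] by simp
  then show ?thesis using assms(2) by (simp add: zero_less_mult_iff)
qed

lemma model_density_cnj:
  assumes "admissible m" "z \<noteq> 0"
  shows "model_density m (cnj z) = model_density m z"
proof -
  obtain \<mu> a b where d: "model_data m = (\<mu>, a, b)" by (cases "model_data m") auto
  have "model_density m (exp (cnj (Ln z))) * (exp (Re (cnj (Ln z))))\<^sup>2 = model_density m (exp (Ln z)) * (exp (Re (Ln z)))\<^sup>2"
    unfolding model_density_exp[OF assms(1) d] model_energy_cnj ..
  then show ?thesis using assms(2) by (simp add: exp_cnj[symmetric])
qed

text \<open>A conformal injection lifts to an entire \<open>f\<close> with \<open>exp (f z) = G (exp z)\<close>, and the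
  rigidity of the Wronskian makes \<open>f'\<close> have constant modulus.\<close>

lemma holomorphic_isometry_imp_eq:
  assumes m: "admissible m" "admissible m'"
    and G: "G holomorphic_on - {0}" "inj_on G (- {0})" "\<And>z. z \<noteq> 0 \<Longrightarrow> G z \<noteq> 0"
    and met: "\<And>z. z \<noteq> 0 \<Longrightarrow> model_density m z = model_density m' (G z) * (cmod (deriv G z))\<^sup>2"
  shows "m = m'"
proof -
  obtain \<mu> a b where d: "model_data m = (\<mu>, a, b)" by (cases "model_data m") auto
  obtain \<mu>' a' b' where d': "model_data m' = (\<mu>', a', b')" by (cases "model_data m'") auto
  note pos = model_data_admissible[OF m(1) d] model_data_admissible[OF m(2) d']
  have "exp ` UNIV \<subseteq> - {0 :: complex}" by auto
  from holomorphic_on_compose_gen[OF holomorphic_on_exp[of UNIV] G(1) this]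
  have Ge: "(\<lambda>z. G (exp z)) holomorphic_on UNIV" by (simp add: o_def)
  obtain f where f: "f holomorphic_on UNIV" "\<And>z. G (exp z) = exp (f z)"
    using contractible_imp_holomorphic_log[OF Ge] G(3) by (metis UNIV_I contractible_UNIV exp_not_eq_zero)
  have Df: "(f has_field_derivative deriv f z) (at z)" for z by (rule holomorphic_has_deriv[OF f(1)])
  have dG: "deriv G (exp z) * exp z = exp (f z) * deriv f z" for z
  proof -
    have "(G has_field_derivative deriv G (exp z)) (at (exp z))"
      by (rule holomorphic_derivI[OF G(1)]) auto
    from DERIV_chain2[OF this DERIV_exp]
    have "((\<lambda>z. exp (f z)) has_field_derivative deriv G (exp z) * exp z) (at z)" unfolding f(2) .
    then show ?thesis using DERIV_unique DERIV_chain2[OF DERIV_exp Df] by blast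
  qed
  have P: "model_energy \<mu> a b z = model_energy \<mu>' a' b' (f z) * cmod (deriv f z)" for z
  proof -
    have n: "cmod (deriv G (exp z)) * exp (Re z) = exp (Re (f z)) * cmod (deriv f z)"
      using arg_cong[OF dG[of z], of cmod] by (simp add: norm_mult norm_exp_eq_Re)
    have "(model_energy \<mu> a b z)\<^sup>2 / 4 = model_density m' (exp (f z)) * (cmod (deriv G (exp z)))\<^sup>2 * (exp (Re z))\<^sup>2"
      using met[of "exp z"] unfolding model_density_exp[OF m(1) d, symmetric] f(2) by simp
    also have "\<dots> = model_density m' (exp (f z)) * (cmod (deriv G (exp z)) * exp (Re z))\<^sup>2"
      by (simp add: power_mult_distrib)
    also have "\<dots> = model_density m' (exp (f z)) * (exp (Re (f z)))\<^sup>2 * (cmod (deriv f z))\<^sup>2"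
      unfolding n by (simp add: power_mult_distrib)
    also have "\<dots> = (model_energy \<mu>' a' b' (f z) * cmod (deriv f z))\<^sup>2 / 4"
      unfolding model_density_exp[OF m(2) d'] by (simp add: power_mult_distrib)
    finally have "(model_energy \<mu> a b z)\<^sup>2 = (model_energy \<mu>' a' b' (f z) * cmod (deriv f z))\<^sup>2" by simp
    then show ?thesis using model_energy_pos[of b \<mu> a z] model_energy_pos[of b' \<mu>' a' "f z"] pos
      by (simp add: power2_eq_iff_nonneg)
  qed
  have nz: "deriv f z \<noteq> 0" for z using P[of z] model_energy_pos[of b \<mu> a z] pos by auto
  have holf': "deriv f holomorphic_on UNIV" by (rule holomorphic_deriv[OF f(1) open_UNIV])
  \<comment> \<open>Spinor pairs transform as half-densities: a square root of f' is the factor that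
    makes (u o f, v o f) into a pair with the energy of \<open>m\<close>.\<close>
  obtain h where h: "h holomorphic_on UNIV" "\<And>z. deriv f z = (h z)\<^sup>2"
    using contractible_imp_holomorphic_sqrt[OF holf'] nz by (metis UNIV_I contractible_UNIV)
  let ?u = "model_u \<mu>' b'" and ?v = "model_v \<mu>' a' b'"
  let ?U = "\<lambda>z. ?u (f z) * h z" and ?V = "\<lambda>z. ?v (f z) * h z"
  have holUV: "?U holomorphic_on UNIV" "?V holomorphic_on UNIV"
    by (intro holomorphic_on_mult holomorphic_compose_UNIV[OF holomorphic_model(1) f(1)]
        holomorphic_compose_UNIV[OF holomorphic_model(2) f(1)] h(1))+
  have en: "energy ?U ?V z = energy (model_u \<mu> b) (model_v \<mu> a b) z" for z
  proof -
    have "energy ?U ?V z = energy ?u ?v (f z) * (cmod (h z))\<^sup>2"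
      by (simp add: energy_def norm_mult power_mult_distrib algebra_simps)
    then show ?thesis using P[of z] h(2)[of z] pos by (simp add: energy_model norm_power)
  qed
  have W: "wronskian ?U ?V z = wronskian ?u ?v (f z) * (deriv f z)\<^sup>2" for z
  proof -
    have D: "((\<lambda>z. w (f z) * h z) has_field_derivative w (f z) * deriv h z + deriv w (f z) * deriv f z * h z) (at z)"
      if "w holomorphic_on UNIV" for w
      by (rule DERIV_mult'[OF DERIV_chain2[OF holomorphic_has_deriv[OF that] Df] holomorphic_has_deriv[OF h(1)]])
    show ?thesis unfolding wronskian_def D[OF holomorphic_model(1), THEN DERIV_imp_deriv]
        D[OF holomorphic_model(2), THEN DERIV_imp_deriv]
      by (simp add: h(2) power2_eq_square algebra_simps)
  qed
  \<comment> \<open>The Wronskian of the transformed pair gains the factor f'^2, whereas both model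
    Wronskians are constant; equality of moduli fixes |f'|.\<close>
  have mod: "(cmod (deriv f z))\<^sup>2 = b * \<mu> / (b' * \<mu>')" for z
  proof -
    have "cmod (of_real (b' * \<mu>') * (deriv f z)\<^sup>2) = cmod (of_real (b * \<mu>))"
      using norm_wronskian_eq[OF holUV holomorphic_model open_UNIV UNIV_I en, of z] pos
      unfolding W by (simp only: wronskian_model)
    then show ?thesis using pos by (simp add: norm_mult norm_power field_simps)
  qed
  have "bounded (range (deriv f))"
    unfolding bounded_iff by (intro exI[of _ "sqrt (b * \<mu> / (b' * \<mu>'))"]) (auto intro!: real_le_rsqrt simp: mod)
  then obtain l where l: "\<And>z. deriv f z = l"
    using Liouville_theorem[OF holf'] by (auto simp: constant_on_def)
  have faff: "f z = l * z + f 0" for z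
  proof -
    have "((\<lambda>z. f z - l * z) has_field_derivative l - l) (at z)" for z
      using DERIV_diff[OF Df DERIV_cmult_Id[of l]] by (simp only: l)
    then have "f z - l * z = f 0 - l * 0" by (intro zero_deriv_const[of "\<lambda>z. f z - l * z"]) simp
    then show ?thesis by (simp add: algebra_simps)
  qed
  have l0: "l \<noteq> 0" using nz l by simp
  have inj: "\<exists>n::int. x - y = of_int (2 * n) * of_real pi * \<i>" if "exp (f x) = exp (f y)" for x y
  proof -
    have "G (exp x) = G (exp y)" using that f(2) by simp
    then have "exp x = exp y" using G(2) by (auto simp: inj_on_def)
    then obtain n :: int where "x = y + of_real (of_int (2 * n) * pi) * \<i>" unfolding exp_eq by blast
    then show ?thesis by (intro exI[of _ n]) simp
  qed
  \<comment> \<open>f is now affine with slope l. Since exp (f z) is a function of exp z, l is an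
    integer; injectivity of G makes 1 / l an integer as well, so l is 1 or - 1.\<close>
  have "exp (f (2 * of_real pi * \<i>)) = exp (f 0)"
    using f(2)[of "2 * of_real pi * \<i>"] f(2)[of 0] by simp
  then obtain k :: int where "f (2 * of_real pi * \<i>) = f 0 + of_real (of_int (2 * k) * pi) * \<i>"
    unfolding exp_eq by blast
  then have lk: "l = of_int k" unfolding faff[of "2 * of_real pi * \<i>"] by (simp add: complex_eq_iff)
  have "exp (f (2 * of_real pi * \<i> / l)) = exp (f 0)"
    unfolding faff[of "2 * of_real pi * \<i> / l"] using l0 by (simp add: exp_add)
  from inj[OF this] obtain n :: int where "2 * of_real pi * \<i> / l = of_int (2 * n) * of_real pi * \<i>" by auto
  then have "of_int (k * n) = (1 :: complex)" using l0 unfolding lk by (simp add: field_simps)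
  then have "k * n = 1" by (metis of_int_eq_1_iff)
  then have "k = 1 \<or> k = -1" by (rule pos_zmult_eq_1_iff_lemma)
  then obtain \<sigma> :: real where \<sigma>: "\<sigma> = 1 \<or> \<sigma> = -1" "l = of_real \<sigma>"
    using lk by (metis of_int_1 of_int_minus of_real_1 of_real_minus)
  have "(\<mu>, a, b) = (\<mu>', a', b')"
  proof (rule model_energy_eq_affine[OF _ _ _ _ _ _ \<sigma>(1)])
    show "model_energy \<mu>' a' b' (of_real \<sigma> * z + f 0) = model_energy \<mu> a b z" for z
      using P[of z] \<sigma> unfolding l faff[of z] by auto
  qed (use pos in auto)
  then show ?thesis using model_data_inject[OF m] d d' by simp
qed

theorem isometric_models_imp_eq:
  assumes m: "admissible m" "admissible m'"
    and iso: "isometric (model_surface m) (model_surface m')"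
  shows "m = m'"
proof -
  let ?D = "- {0 :: complex}" and ?c = "plane_chart (- {0})"
  have oD: "open ?D" by auto
  obtain F F' where F: "smooth_map (model_surface m) (model_surface m') F"
    "\<forall>p\<in>pts (model_surface m). F' (F p) = p" "metric_preserving (model_surface m) (model_surface m') F"
    using iso unfolding isometric_def by blast
  have pts: "pts (model_surface m) = ?D" for m by (simp add: model_surface_def conformal_plane_domain_def)
  have ch: "?c \<in> atlas (model_surface m)" for m
    unfolding model_surface_def by (rule plane_chart_in_atlas[OF oD])
  have FD: "F x \<noteq> 0" if "x \<noteq> 0" for x
    using F(1) that unfolding smooth_map_def pts by auto
  let ?f = "coord_of ?c \<circ> F \<circ> param_of ?c"
  have dom: "coord_of ?c ` (dom_of ?c \<inter> F -` dom_of ?c) = ?D" using FD by auto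
  have fF: "?f y = F y" if "y \<in> ?D" for y using that by (simp add: param_of_plane_chart)
  have "smooth_on ?D ?f"
    using F(1) ch[of m] ch[of m'] dom unfolding smooth_map_def by metis
  then have sm: "smooth_on ?D F" using smooth_on_cong[of ?D ?f F] oD fF by simp
  have pdf: "pd e ?f x = pd e F x" if "x \<in> ?D" for e x
    using pd_cong_open[of ?D x ?f F] oD that fF by simp
  have met: "model_density m x * (u \<bullet> v) = model_density m' (F x) * (pd u F x \<bullet> pd v F x)"
    if x: "x \<noteq> 0" for x u v
  proof -
    have "met (model_surface m) ?c x u v = met (model_surface m') ?c (?f x) (pd u ?f x) (pd v ?f x)"
      using F(3) ch[of m] ch[of m'] dom x unfolding metric_preserving_def Let_def by blast
    moreover have "x \<in> ?D" "F x \<in> ?D" using x FD[OF x] by auto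
    ultimately show ?thesis
      by (simp only: fF pdf model_surface_def met_plane_chart[OF oD])
  qed
  \<comment> \<open>Comparing the metrics on the vector pairs (1, 1), (i, i) and (1, i) shows that
    the derivative of F maps 1 and i to orthogonal vectors of equal length.\<close>
  have conf: "pd 1 F x \<noteq> 0 \<and> (pd \<i> F x = \<i> * pd 1 F x \<or> pd \<i> F x = - \<i> * pd 1 F x)
      \<and> model_density m x = model_density m' (F x) * (cmod (pd 1 F x))\<^sup>2" if x: "x \<noteq> 0" for x
  proof -
    note pos = model_density_pos[OF m(1) x] model_density_pos[OF m(2) FD[OF x]]
    have 1: "model_density m x = model_density m' (F x) * (cmod (pd 1 F x))\<^sup>2"
      "model_density m x = model_density m' (F x) * (cmod (pd \<i> F x))\<^sup>2"
      using met[OF x, of 1 1] met[OF x, of \<i> \<i>] by (simp_all add: dot_square_norm)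
    have 2: "pd 1 F x \<bullet> pd \<i> F x = 0" using met[OF x, of 1 \<i>] pos by simp
    have "(cmod (pd 1 F x))\<^sup>2 = (cmod (pd \<i> F x))\<^sup>2" using 1 pos by simp
    then have "cmod (pd 1 F x) = cmod (pd \<i> F x)" by simp
    from conformal_map_dichotomy[OF this 2] 1 pos show ?thesis by auto
  qed
  have inj: "inj_on F ?D" using F(2) unfolding pts by (metis inj_on_def)
  have diff: "F differentiable (at x)" if "x \<in> ?D" for x by (rule smooth_on_differentiable[OF sm that])
  have "F holomorphic_on ?D \<or> (\<lambda>z. cnj (F z)) holomorphic_on ?D"
    by (rule conformal_on_punctured_plane) (use diff smooth_on_imp_continuous_on_pd[OF sm] conf in auto)
  then show ?thesis
  proof
    assume hol: "F holomorphic_on ?D"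
    have "deriv F z = pd 1 F z" if "z \<noteq> 0" for z
      using pd_eqI[OF has_derivative_holomorphic[OF hol oD], of z 1] that by simp
    then show ?thesis by (intro holomorphic_isometry_imp_eq[OF m hol inj]) (use FD conf in auto)
  next
    assume hol: "(\<lambda>z. cnj (F z)) holomorphic_on ?D"
    have d: "cmod (deriv (\<lambda>z. cnj (F z)) z) = cmod (pd 1 F z)" if "z \<noteq> 0" for z
    proof -
      have "((\<lambda>z. cnj (F z)) has_derivative (\<lambda>h. cnj (frechet_derivative F (at z) h))) (at z)"
        using diff that by (intro has_derivative_cnj) (simp add: frechet_derivative_works)
      moreover have "((\<lambda>z. cnj (F z)) has_derivative (\<lambda>h. deriv (\<lambda>z. cnj (F z)) z * h)) (at z)"
        using has_derivative_holomorphic[OF hol oD] that by simp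
      ultimately have "(\<lambda>h. cnj (frechet_derivative F (at z) h)) = (\<lambda>h. deriv (\<lambda>z. cnj (F z)) z * h)"
        by (rule has_derivative_unique)
      from fun_cong[OF this, of 1] have "deriv (\<lambda>z. cnj (F z)) z = cnj (pd 1 F z)" by (simp add: pd_def)
      then show ?thesis by simp
    qed
    have "inj_on (\<lambda>z. cnj (F z)) ?D" using inj by (simp add: inj_on_def)
    then show ?thesis
      by (intro holomorphic_isometry_imp_eq[OF m hol]) (use FD conf d model_density_cnj[OF m(2)] in auto)
  qed
qed

section \<open>Curvature in a global conformal chart\<close>

lemma one_ne_ii [simp]: "(1 :: complex) \<noteq> \<i>" "\<i> \<noteq> 1"
  by (simp_all add: complex_eq_iff)

lemma sum_coord_basis: "(\<Sum>m\<in>coord_basis. f m) = f 1 + f \<i>"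
  by simp

text \<open>A metric exp (2 phi) |dz|^2 whose phi is ln P up to a constant, so that the derivatives
  of ln P computed above serve as those of phi.\<close>

locale conformal_patch =
  fixes G :: metric_tensor and \<rho> :: "complex \<Rightarrow> real" and u v :: "complex \<Rightarrow> complex" and X
  assumes X: "open X" and u: "u holomorphic_on X" and v: "v holomorphic_on X"
    and pos: "\<And>x. x \<in> X \<Longrightarrow> energy u v x > 0"
    and rho: "\<And>x. x \<in> X \<Longrightarrow> \<rho> x = (energy u v x)\<^sup>2 / 4"
    and G: "\<And>x a b. x \<in> X \<Longrightarrow> G x a b = \<rho> x * (a \<bullet> b)"
begin

lemma rho_pos: "x \<in> X \<Longrightarrow> \<rho> x > 0"
  unfolding rho using pos[of x] by simp

lemma G_basis:
  assumes "x \<in> X"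
  shows "G x 1 1 = \<rho> x" "G x \<i> \<i> = \<rho> x" "G x 1 \<i> = 0" "G x \<i> 1 = 0"
  using G[OF assms] by (simp_all add: inner_complex_def)

lemma pd_rho:
  assumes x: "x \<in> X"
  shows "pd 1 \<rho> x = 2 * \<rho> x * log_energy_x u v x" "pd \<i> \<rho> x = 2 * \<rho> x * log_energy_y u v x"
proof -
  note De = has_derivative_energy[OF u v X x]
  have D: "(\<rho> has_derivative (\<lambda>h. (1 / 4) * (energy u v x * (2 * Re (energy_z u v x * h))
      + 2 * Re (energy_z u v x * h) * energy u v x))) (at x)"
    by (rule has_derivative_transform_within_open[OF has_derivative_mult_right[OF has_derivative_mult[OF De De]] X x])
       (simp add: rho power2_eq_square)
  show "pd 1 \<rho> x = 2 * \<rho> x * log_energy_x u v x" "pd \<i> \<rho> x = 2 * \<rho> x * log_energy_y u v x"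
    unfolding pd_eqI[OF D] rho[OF x] log_energy_x_def log_energy_y_def using pos[OF x]
    by (simp_all add: power2_eq_square)
qed

lemma pd_G:
  assumes x: "x \<in> X"
  shows "pd e (\<lambda>y. G y 1 1) x = pd e \<rho> x" "pd e (\<lambda>y. G y \<i> \<i>) x = pd e \<rho> x"
    "pd e (\<lambda>y. G y 1 \<i>) x = 0" "pd e (\<lambda>y. G y \<i> 1) x = 0"
proof -
  have 0: "pd e (\<lambda>y. 0 :: real) x = 0" by (rule pd_eqI) (rule has_derivative_const)
  show "pd e (\<lambda>y. G y 1 1) x = pd e \<rho> x" "pd e (\<lambda>y. G y \<i> \<i>) x = pd e \<rho> x"
    "pd e (\<lambda>y. G y 1 \<i>) x = 0" "pd e (\<lambda>y. G y \<i> 1) x = 0"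
    using pd_cong_open[OF X x, of "\<lambda>y. G y 1 1" \<rho> e] pd_cong_open[OF X x, of "\<lambda>y. G y \<i> \<i>" \<rho> e]
      pd_cong_open[OF X x, of "\<lambda>y. G y 1 \<i>" "\<lambda>y. 0" e] pd_cong_open[OF X x, of "\<lambda>y. G y \<i> 1" "\<lambda>y. 0" e]
      G_basis 0 by simp_all
qed

lemma metric_det: "x \<in> X \<Longrightarrow> metric_det G x = (\<rho> x)\<^sup>2"
  by (simp add: metric_det_def G_basis power2_eq_square)

lemma metric_inv_G:
  assumes x: "x \<in> X"
  shows "metric_inv G x 1 1 = 1 / \<rho> x" "metric_inv G x \<i> \<i> = 1 / \<rho> x"
    "metric_inv G x 1 \<i> = 0" "metric_inv G x \<i> 1 = 0"
  using rho_pos[OF x] by (simp_all add: metric_inv_def metric_det[OF x] G_basis[OF x] power2_eq_square)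

text \<open>For exp (2 phi) |dz|^2 the Christoffel symbols are the first derivatives of phi up to
  sign.\<close>

lemma christoffel_G:
  assumes x: "x \<in> X"
  shows "christoffel G 1 \<i> \<i> x = - log_energy_x u v x" "christoffel G 1 1 1 x = log_energy_x u v x"
    "christoffel G 1 1 \<i> x = log_energy_y u v x" "christoffel G 1 \<i> 1 x = log_energy_y u v x"
    "christoffel G \<i> \<i> \<i> x = log_energy_y u v x" "christoffel G \<i> 1 \<i> x = log_energy_x u v x"
  using rho_pos[OF x]
  by (simp_all add: christoffel_def sum_coord_basis metric_inv_G[OF x] pd_G[OF x] pd_rho[OF x])

lemma pd_log_energy:
  assumes x: "x \<in> X"
  shows "pd 1 (log_energy_x u v) x = log_energy_xx u v x" "pd \<i> (log_energy_y u v) x = log_energy_yy u v x"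
proof -
  obtain b where D: "(log_energy_x u v has_derivative (\<lambda>h. log_energy_xx u v x * Re h + b * Im h)) (at x)"
    using has_derivative_log_energy_x[OF u v X x pos[OF x]] by auto
  show "pd 1 (log_energy_x u v) x = log_energy_xx u v x" using pd_eqI[OF D] by simp
  obtain b where D: "(log_energy_y u v has_derivative (\<lambda>h. b * Re h + log_energy_yy u v x * Im h)) (at x)"
    using has_derivative_log_energy_y[OF u v X x pos[OF x]] by auto
  show "pd \<i> (log_energy_y u v) x = log_energy_yy u v x" using pd_eqI[OF D] by simp
qed

text \<open>The classical formula that K is minus the Laplacian of ln P divided by \<rho>: the
  quadratic terms in the Christoffel symbols cancel, and the component l = i drops out because G is
  diagonal.\<close>

lemma gauss_coord_conformal:
  assumes x: "x \<in> X"
  shows "gauss_coord G x = - (4 * (cmod (wronskian u v x))\<^sup>2 / (energy u v x)\<^sup>2) / \<rho> x"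
proof -
  have D: "(log_energy_x u v) differentiable (at x)"
    using has_derivative_log_energy_x[OF u v X x pos[OF x]] unfolding differentiable_def by auto
  have neg: "pd 1 (\<lambda>y. - log_energy_x u v y) x = - pd 1 (log_energy_x u v) x"
    using pd_eqI[OF has_derivative_minus[OF D[unfolded frechet_derivative_works]]] by (simp add: pd_def)
  have "pd 1 (christoffel G 1 \<i> \<i>) x = - log_energy_xx u v x"
    using pd_cong_open[OF X x, of "christoffel G 1 \<i> \<i>" "\<lambda>y. - log_energy_x u v y" 1]
      christoffel_G(1) neg pd_log_energy[OF x] by simp
  moreover have "pd \<i> (christoffel G 1 1 \<i>) x = log_energy_yy u v x"
    using pd_cong_open[OF X x, of "christoffel G 1 1 \<i>" "log_energy_y u v" \<i>]
      christoffel_G(3) pd_log_energy[OF x] by simp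
  ultimately have "curvature_component G 1 x = - (log_energy_xx u v x + log_energy_yy u v x)"
    by (simp add: curvature_component_def sum_coord_basis christoffel_G[OF x])
  then show ?thesis
    unfolding laplacian_log_energy[OF pos[OF x]] gauss_coord_def sum_coord_basis metric_det[OF x] G_basis[OF x]
    using rho_pos[OF x] by (simp add: power2_eq_square)
qed

end

text \<open>The pair \<open>u, v\<close> lives in the coordinate \<open>log z\<close>; the half-densities
  \<open>u / z powr (1/2)\<close> and \<open>v / z powr (1/2)\<close> express the same metric near a point of the punctured plane.\<close>

lemma gauss_coord_punctured_plane:
  assumes hu: "u holomorphic_on UNIV" and hv: "v holomorphic_on UNIV" and hpos: "\<And>z. energy u v z > 0"
    and hen: "\<And>z. energy u v z = 2 * sqrt (\<rho> (exp z)) * exp (Re z)"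
    and hG: "\<And>x a b. x \<noteq> 0 \<Longrightarrow> G x a b = \<rho> x * (a \<bullet> b)" and hrho: "\<And>x. x \<noteq> 0 \<Longrightarrow> \<rho> x > 0"
  shows "\<bar>gauss_coord G (exp \<zeta>)\<bar> * \<rho> (exp \<zeta>) * exp (2 * Re \<zeta>)
       = 4 * (cmod (wronskian u v \<zeta>))\<^sup>2 / (energy u v \<zeta>)\<^sup>2"
proof -
  define z0 where "z0 = exp \<zeta>"
  have z0: "z0 \<noteq> 0" by (simp add: z0_def)
  define X where "X = {z. z / z0 \<notin> \<real>\<^sub>\<le>\<^sub>0}"
  \<comment> \<open>The branch of the logarithm near \<open>z0\<close> that takes the value
    \<open>\<zeta>\<close> at \<open>z0\<close>.\<close>
  let ?l = "\<lambda>z. Ln (z / z0) + \<zeta>"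
  let ?e = "\<lambda>z. exp (- ?l z / 2)"
  let ?u = "\<lambda>z. u (?l z) * ?e z" and ?v = "\<lambda>z. v (?l z) * ?e z"
  have "open ((\<lambda>z. z / z0) -` (- \<real>\<^sub>\<le>\<^sub>0))"
    by (intro open_vimage) (auto intro!: continuous_intros simp: z0 closed_nonpos_Reals_complex)
  then have X: "open X" by (simp add: X_def vimage_def Compl_eq)
  have z0X: "z0 \<in> X" using z0 by (simp add: X_def)
  have nz: "z \<noteq> 0" if "z \<in> X" for z using that by (auto simp: X_def)
  have el: "exp (?l z) = z" if "z \<in> X" for z using nz[OF that] z0 by (simp add: exp_add z0_def)
  have holl: "?l holomorphic_on X" using z0 by (auto intro!: holomorphic_intros simp: X_def)
  have hol: "?u holomorphic_on X" "?v holomorphic_on X"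
    by (intro holomorphic_on_mult holomorphic_compose_UNIV[OF hu holl] holomorphic_compose_UNIV[OF hv holl]
        holomorphic_on_exp' holomorphic_intros holl; simp)+
  have en': "energy ?u ?v z = energy u v (?l z) * exp (- Re (?l z))" for z
  proof -
    have "(cmod (?e z))\<^sup>2 = exp (- Re (?l z))"
      unfolding norm_exp_eq_Re by (simp flip: exp_double)
    then show ?thesis unfolding energy_def norm_mult power_mult_distrib by (simp only: distrib_right)
  qed
  have en2: "energy ?u ?v z = 2 * sqrt (\<rho> z)" if "z \<in> X" for z
    unfolding en' hen el[OF that] by (simp add: mult.assoc flip: exp_add)
  interpret conformal_patch G \<rho> ?u ?v X
  proof
    show "energy ?u ?v x > 0" if "x \<in> X" for x unfolding en' using hpos by simp
    show "\<rho> x = (energy ?u ?v x)\<^sup>2 / 4" if "x \<in> X" for x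
      unfolding en2[OF that] using hrho[OF nz[OF that]] by (simp add: power_mult_distrib)
    show "G x a b = \<rho> x * (a \<bullet> b)" if "x \<in> X" for x a b by (rule hG[OF nz[OF that]])
  qed (fact X hol)+
  have l0: "?l z0 = \<zeta>" using z0 by simp
  have Dl: "(?l has_field_derivative 1 / z0) (at z0)"
    using z0 by (auto intro!: derivative_eq_intros)
  have De: "(?e has_field_derivative - (1 / z0) / 2 * ?e z0) (at z0)"
    by (rule derivative_eq_intros Dl refl | simp)+
  have D: "((\<lambda>z. f (?l z) * ?e z) has_field_derivative
      f \<zeta> * (- (1 / z0) / 2 * ?e z0) + deriv f \<zeta> * (1 / z0) * ?e z0) (at z0)" if "f holomorphic_on UNIV" for f
    using DERIV_mult'[OF DERIV_chain2[OF holomorphic_has_deriv[OF that] Dl] De] unfolding l0 .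
  have ee: "?e z0 * ?e z0 = inverse z0"
    unfolding l0 exp_add[symmetric] by (simp add: z0_def exp_minus)
  \<comment> \<open>The common factor \<open>?e\<close> enters squared, since its own derivative
    cancels in the Wronskian; the chain rule adds 1 / z0.\<close>
  have "wronskian ?u ?v z0 = wronskian u v \<zeta> * (?e z0 * ?e z0) / z0"
    unfolding wronskian_def D[OF hu, THEN DERIV_imp_deriv] D[OF hv, THEN DERIV_imp_deriv] l0
    by (simp add: algebra_simps diff_divide_distrib)
  then have "cmod (wronskian ?u ?v z0) = cmod (wronskian u v \<zeta> * inverse z0 / z0)"
    unfolding ee by (rule arg_cong)
  then have "cmod (wronskian ?u ?v z0) = cmod (wronskian u v \<zeta>) / (cmod z0)\<^sup>2"
    by (simp only: norm_mult norm_divide norm_inverse power2_eq_square divide_inverse inverse_mult_distrib mult.assoc)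
  moreover have "cmod z0 = exp (Re \<zeta>)" by (simp add: z0_def)
  ultimately have W: "cmod (wronskian ?u ?v z0) = cmod (wronskian u v \<zeta>) / (exp (Re \<zeta>))\<^sup>2" by simp
  have E: "energy ?u ?v z0 = energy u v \<zeta> / exp (Re \<zeta>)" unfolding en' l0 by (simp add: exp_minus divide_inverse)
  have r: "\<rho> z0 > 0" by (rule hrho[OF z0])
  have kr: "\<bar>gauss_coord G z0\<bar> * \<rho> z0 = 4 * (cmod (wronskian ?u ?v z0))\<^sup>2 / (energy ?u ?v z0)\<^sup>2"
    unfolding gauss_coord_conformal[OF z0X] using r by (simp add: abs_mult)
  have "\<bar>gauss_coord G z0\<bar> * \<rho> z0 * exp (2 * Re \<zeta>) = 4 * (cmod (wronskian u v \<zeta>))\<^sup>2 / (energy u v \<zeta>)\<^sup>2"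
  proof -
    have "4 * (w / r\<^sup>2)\<^sup>2 / (p / r)\<^sup>2 * r\<^sup>2 = 4 * w\<^sup>2 / p\<^sup>2" if "r \<noteq> 0" for w p r :: real
      using that by (simp add: power_divide) (simp add: power2_eq_square power4_eq_xxxx)
    then show ?thesis unfolding kr W E exp_double by simp
  qed
  then show ?thesis by (simp add: z0_def)
qed

text \<open>The chart covers the surface, so the area measure is transported to the density \<rho>
  on the punctured plane, and integrability of K with it. F is built from K rather than from
  \<open>gauss_coord\<close>, since K comes with measurability.\<close>

lemma total_curvature_in_chart:
  fixes S :: "'a::{t2_space,second_countable_topology} surface"
  assumes S: "riemannian_surface S" and fin: "finite_total_curvature S"
    and c: "c \<in> atlas S" "dom_of c = pts S" "range_of c = - {0}"
    and met: "\<And>x a b. x \<noteq> 0 \<Longrightarrow> met S c x a b = \<rho> x * (a \<bullet> b)" and rho: "\<And>x. x \<noteq> 0 \<Longrightarrow> \<rho> x > 0"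
    and cont: "continuous_on (- {0}) \<rho>"
  obtains F where "F \<in> borel_measurable borel" "(\<integral>\<^sup>+z. F z \<partial>lborel) < \<infinity>"
    "\<And>z. z \<noteq> 0 \<Longrightarrow> F z = ennreal (\<bar>gauss_coord (met S c) z\<bar> * \<rho> z)"
proof -
  let ?\<Phi> = "coord_of c" and ?T = "param_of c" and ?D = "- {0 :: complex}"
  obtain A K where A: "area_measure S A" and K: "gauss_curvature S K" "integrable A K"
    using fin unfolding finite_total_curvature_def by blast
  have patch: "coordinate_patch (pts S) c" using S c(1) unfolding riemannian_surface_def by blast
  have hom: "homeomorphism (pts S) ?D ?\<Phi> ?T" using patch c unfolding coordinate_patch_def by simp
  have setsA: "sets A = sets (restrict_space borel (pts S))"
    and emA: "\<And>B. B \<in> sets A \<Longrightarrow> B \<subseteq> pts S \<Longrightarrow>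
        emeasure A B = (\<integral>\<^sup>+x\<in>?\<Phi> ` B. ennreal (sqrt (metric_det (met S c) x)) \<partial>lborel)"
    using A c(1,2) unfolding area_measure_def by auto
  have spA: "space A = pts S" using sets_eq_imp_space_eq[OF setsA] by (simp add: space_restrict_space)
  let ?L = "restrict_space borel ?D"
  have Phi: "?\<Phi> \<in> measurable A ?L"
  proof (rule measurable_restrict_space2)
    show "?\<Phi> \<in> space A \<rightarrow> ?D" using hom spA by (auto simp: homeomorphism_def)
    have "?\<Phi> \<in> borel_measurable (restrict_space borel (pts S))"
      by (rule borel_measurable_continuous_on_restrict) (use hom in \<open>simp add: homeomorphism_def\<close>)
    then show "?\<Phi> \<in> borel_measurable A" using measurable_cong_sets[OF setsA refl] by blast
  qed
  have T: "?T \<in> measurable ?L A"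
  proof -
    have "?T \<in> measurable ?L (restrict_space borel (pts S))"
    proof (rule measurable_restrict_space2)
      show "?T \<in> space ?L \<rightarrow> pts S" using hom by (auto simp: homeomorphism_def space_restrict_space)
      show "?T \<in> borel_measurable ?L"
        by (rule borel_measurable_continuous_on_restrict) (use hom in \<open>simp add: homeomorphism_def\<close>)
    qed
    then show ?thesis using measurable_cong_sets[OF refl setsA] by blast
  qed
  have Km [measurable]: "K \<in> borel_measurable A" using K(2) by (rule borel_measurable_integrable)
  have KT: "(\<lambda>z. K (?T z)) \<in> borel_measurable ?L" using measurable_compose[OF T Km] .
  have rhoM: "\<rho> \<in> borel_measurable ?L" by (rule borel_measurable_continuous_on_restrict[OF cont])
  let ?F = "\<lambda>z. ennreal (\<bar>K (?T z)\<bar> * \<rho> z) * indicator ?D z"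
  have FM: "(\<lambda>z. ennreal (\<bar>K (?T z)\<bar> * \<rho> z)) \<in> borel_measurable ?L" using KT rhoM by measurable
  have D: "?D \<in> sets borel" by simp
  have FB: "?F \<in> borel_measurable borel"
    using FM D by (subst (asm) borel_measurable_restrict_space_iff_ennreal) auto
  have sdet: "sqrt (metric_det (met S c) x) = \<rho> x" if "x \<noteq> 0" for x
    using rho[OF that] by (simp add: metric_det_def met[OF that] inner_complex_def)
  let ?R = "restrict_space lborel ?D"
  have setsR: "sets ?R = sets ?L" by (rule sets_restrict_space_cong) simp
  have rhoR: "(\<lambda>z. ennreal (\<rho> z)) \<in> borel_measurable ?R"
    using rhoM measurable_cong_sets[OF setsR refl] by (auto intro!: measurable_compose[OF _ measurable_ennreal])
  have dis: "distr A ?L ?\<Phi> = density ?R (\<lambda>z. ennreal (\<rho> z))"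
  proof (rule measure_eqI)
    fix B assume B: "B \<in> sets (distr A ?L ?\<Phi>)"
    then have B': "B \<in> sets ?L" by simp
    then have BD: "B \<subseteq> ?D" using sets.sets_into_space[OF B'] by (simp add: space_restrict_space)
    have im: "?\<Phi> ` (?\<Phi> -` B \<inter> space A) = B"
    proof (intro equalityI subsetI)
      fix b assume b: "b \<in> B"
      then have "?T b \<in> pts S" "?\<Phi> (?T b) = b" using hom BD by (auto simp: homeomorphism_def)
      then show "b \<in> ?\<Phi> ` (?\<Phi> -` B \<inter> space A)" using b spA by (intro image_eqI[of _ _ "?T b"]) auto
    qed auto
    have "emeasure (distr A ?L ?\<Phi>) B = emeasure A (?\<Phi> -` B \<inter> space A)" by (rule emeasure_distr[OF Phi B'])
    also have "\<dots> = (\<integral>\<^sup>+x\<in>B. ennreal (sqrt (metric_det (met S c) x)) \<partial>lborel)"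
      using emA[OF measurable_sets[OF Phi B']] spA unfolding im by simp
    also have "\<dots> = (\<integral>\<^sup>+x. (ennreal (\<rho> x) * indicator B x) * indicator ?D x \<partial>lborel)"
      by (rule nn_integral_cong) (use BD sdet in \<open>auto simp: indicator_def\<close>)
    also have "\<dots> = (\<integral>\<^sup>+x. ennreal (\<rho> x) * indicator B x \<partial>?R)"
      by (rule nn_integral_restrict_space[symmetric]) simp
    also have "\<dots> = emeasure (density ?R (\<lambda>z. ennreal (\<rho> z))) B"
      by (rule emeasure_density[symmetric, OF rhoR]) (use B' setsR in simp)
    finally show "emeasure (distr A ?L ?\<Phi>) B = emeasure (density ?R (\<lambda>z. ennreal (\<rho> z))) B" .
  qed (simp add: setsR)
  have KTm: "(\<lambda>z. ennreal \<bar>K (?T z)\<bar>) \<in> borel_measurable ?L" using KT by measurable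
  have "(\<integral>\<^sup>+z. ?F z \<partial>lborel) = (\<integral>\<^sup>+z. ennreal (\<bar>K (?T z)\<bar> * \<rho> z) \<partial>?R)"
    by (rule nn_integral_restrict_space[symmetric]) simp
  also have "\<dots> = (\<integral>\<^sup>+z. ennreal (\<rho> z) * ennreal \<bar>K (?T z)\<bar> \<partial>?R)"
  proof (rule nn_integral_cong)
    fix z assume "z \<in> space ?R"
    then have "z \<noteq> 0" by (simp add: space_restrict_space)
    then show "ennreal (\<bar>K (?T z)\<bar> * \<rho> z) = ennreal (\<rho> z) * ennreal \<bar>K (?T z)\<bar>"
      using rho[of z] by (simp add: ennreal_mult mult.commute)
  qed
  also have "\<dots> = (\<integral>\<^sup>+z. ennreal \<bar>K (?T z)\<bar> \<partial>density ?R (\<lambda>z. ennreal (\<rho> z)))"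
    by (rule nn_integral_density[symmetric, OF rhoR]) (use KTm measurable_cong_sets[OF setsR refl] in blast)
  also have "\<dots> = (\<integral>\<^sup>+p. ennreal \<bar>K (?T (?\<Phi> p))\<bar> \<partial>A)"
    unfolding dis[symmetric] by (rule nn_integral_distr[OF Phi]) (use KTm in simp)
  also have "\<dots> = (\<integral>\<^sup>+p. ennreal \<bar>K p\<bar> \<partial>A)"
    by (rule nn_integral_cong) (use hom spA in \<open>simp add: homeomorphism_def\<close>)
  also have "\<dots> < \<infinity>" using K(2) by (simp add: integrable_iff_bounded)
  finally have fin: "(\<integral>\<^sup>+z. ?F z \<partial>lborel) < \<infinity>" .
  show ?thesis
  proof (rule that[OF FB fin])
    fix z :: complex assume z: "z \<noteq> 0"
    have "?T z \<in> pts S" "?\<Phi> (?T z) = z" using hom z by (auto simp: homeomorphism_def)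
    then have "K (?T z) = gauss_coord (met S c) z"
      using K(1) c(1,2) unfolding gauss_curvature_def by metis
    then show "?F z = ennreal (\<bar>gauss_coord (met S c) z\<bar> * \<rho> z)" using z by simp
  qed
qed

section \<open>Lifting Weierstrass data to the logarithmic cover\<close>

lemma covering_space_compose_homeomorphism:
  assumes cov: "covering_space C p S" and hom: "homeomorphism S T f f'"
  shows "covering_space C (\<lambda>x. f (p x)) T"
proof
  have pS: "p ` C = S" using cov by (rule covering_space_imp_surjective)
  have f: "continuous_on S f" "f ` S = T" "continuous_on T f'" "f' ` T = S" "\<And>x. x \<in> S \<Longrightarrow> f' (f x) = x"
    "\<And>y. y \<in> T \<Longrightarrow> f (f' y) = y"
    using hom by (auto simp: homeomorphism_def)
  show "continuous_on C (\<lambda>x. f (p x))"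
    using continuous_on_compose2[OF f(1) covering_space_imp_continuous[OF cov]] pS by auto
  show "(\<lambda>x. f (p x)) ` C = T" using pS f(2) by (simp add: image_image[symmetric])
  fix x assume x: "x \<in> T"
  then have "f' x \<in> S" using f(4) by auto
  then obtain U v where U: "f' x \<in> U" "openin (top_of_set S) U" "\<Union>v = C \<inter> p -` U"
    "\<forall>u\<in>v. openin (top_of_set C) u" "pairwise disjnt v" "\<forall>u\<in>v. \<exists>q. homeomorphism u U p q"
    using cov unfolding covering_space_def by (metis (no_types, lifting))
  have US: "U \<subseteq> S" using U(2) by (rule openin_imp_subset)
  show "\<exists>V. x \<in> V \<and> openin (top_of_set T) V \<and> (\<exists>v. \<Union>v = C \<inter> (\<lambda>x. f (p x)) -` V \<and>
      (\<forall>u\<in>v. openin (top_of_set C) u) \<and> pairwise disjnt v \<and> (\<forall>u\<in>v. \<exists>q. homeomorphism u V (\<lambda>x. f (p x)) q))"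
  proof (intro exI[of _ "f ` U"] conjI exI[of _ v])
    show "x \<in> f ` U" using U(1) f(6)[OF x] by (metis imageI)
    show "openin (top_of_set T) (f ` U)" by (rule homeomorphism_imp_open_map[OF hom U(2)])
    have "f (p y) \<in> f ` U \<longleftrightarrow> p y \<in> U" if "y \<in> C" for y
    proof
      assume "f (p y) \<in> f ` U"
      then obtain z where "z \<in> U" "f (p y) = f z" by auto
      moreover have "p y \<in> S" using that pS by auto
      ultimately show "p y \<in> U" using f(5)[of "p y"] f(5)[of z] US by auto
    qed auto
    then show "\<Union>v = C \<inter> (\<lambda>x. f (p x)) -` (f ` U)" using U(3) by auto
    show "\<forall>u\<in>v. \<exists>q. homeomorphism u (f ` U) (\<lambda>x. f (p x)) q"
    proof
      fix u assume "u \<in> v"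
      then obtain q where q: "homeomorphism u U p q" using U(6) by blast
      have "homeomorphism U (f ` U) f f'" by (rule homeomorphism_of_subsets[OF hom US]) (use US in auto)
      from homeomorphism_compose[OF q this]
      show "\<exists>q. homeomorphism u (f ` U) (\<lambda>x. f (p x)) q" by (auto simp: o_def)
    qed
  qed (use U in auto)
qed

text \<open>Transfers data from an arbitrary covering domain to the standard cover exp. The lift
  exists because the plane is simply connected, and it is holomorphic because locally it is exp
  followed by an inverse branch of p.\<close>

lemma lift_exp_through_holomorphic_covering:
  assumes \<Omega>: "open \<Omega>" and cov: "covering_space \<Omega> p (- {0})" and p: "p holomorphic_on \<Omega>"
  obtains L where "L holomorphic_on UNIV" "\<And>z. L z \<in> \<Omega>" "\<And>z. p (L z) = exp z"
proof -
  obtain L where L: "continuous_on UNIV L" "L \<in> UNIV \<rightarrow> \<Omega>" "\<And>y. y \<in> UNIV \<Longrightarrow> p (L y) = exp y"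
    by (rule covering_space_lift[OF cov, of UNIV exp])
       (auto intro: continuous_intros convex_imp_simply_connected convex_imp_locally_path_connected)
  have "L field_differentiable at z" for z
  proof -
    have "L z \<in> \<Omega>" using L(2) by auto
    obtain T U q where T: "L z \<in> T" "openin (top_of_set \<Omega>) T" "homeomorphism T U p q"
      using covering_space_local_homeomorphism[OF cov \<open>L z \<in> \<Omega>\<close>] by metis
    have oT: "open T" "T \<subseteq> \<Omega>" using T(2) \<Omega> by (auto simp: openin_open_eq openin_imp_subset)
    have inj: "inj_on p T" using T(3) by (metis homeomorphism_def inj_on_def)
    obtain g where g: "g holomorphic_on (p ` T)" "\<And>w. w \<in> T \<Longrightarrow> g (p w) = w"
      using holomorphic_has_inverse[OF holomorphic_on_subset[OF p oT(2)] oT(1) inj] by metis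
    have "open (p ` T)"
      using open_mapping_thm3[OF holomorphic_on_subset[OF p oT(2)] oT(1) inj] .
    have oV: "open (L -` T)" using L(1) oT(1) by (simp add: open_vimage)
    have "exp ` (L -` T) \<subseteq> p ` T" using L(3) by (auto simp flip: L(3))
    from holomorphic_on_compose_gen[OF holomorphic_on_exp g(1) this]
    have "(\<lambda>y. g (exp y)) holomorphic_on (L -` T)" by (simp add: o_def)
    moreover have "g (exp y) = L y" if "y \<in> L -` T" for y
      using g(2)[of "L y"] L(3)[of y] that by simp
    ultimately have "L holomorphic_on (L -` T)" by (rule holomorphic_transform)
    then show ?thesis using oV T(1) holomorphic_on_imp_differentiable_at by (metis vimageI)
  qed
  then have "L holomorphic_on UNIV" by (simp add: holomorphic_on_def)
  then show ?thesis using that L by auto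
qed

text \<open>The zeros of \<open>\<alpha>\<close> compensate the poles of \<open>g\<close> to even order, so \<open>\<alpha> = u\<^sup>2\<close> and
  \<open>g = v / u\<close> with entire \<open>u\<close> and \<open>v\<close>. Instead of counting orders it suffices to know that
  \<open>P = \<bar>\<alpha>\<bar> (1 + \<bar>g\<bar>\<^sup>2)\<close> extends to a positive continuous function.\<close>

lemma spinor_representation:
  assumes g: "g nicely_meromorphic_on UNIV" and \<alpha>: "\<alpha> holomorphic_on UNIV"
    and P: "continuous_on UNIV P" "\<And>z. P z > 0"
    and eq: "\<And>z. \<not> is_pole g z \<Longrightarrow> P z = cmod (\<alpha> z) * (1 + (cmod (g z))\<^sup>2)"
  obtains u v where "u holomorphic_on UNIV" "v holomorphic_on UNIV" "\<And>z. energy u v z = P z"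
    "\<And>z. \<not> is_pole g z \<Longrightarrow> wronskian u v z = deriv g z * \<alpha> z"
    "\<And>z. eventually (\<lambda>w. \<not> is_pole g w) (at z)"
proof -
  obtain h f1 f2 where h: "h holomorphic_on UNIV" "f1 holomorphic_on UNIV" "f2 holomorphic_on UNIV"
    "\<And>z. f1 z = 0 \<longleftrightarrow> \<not> is_pole g z \<and> g z = 0" "\<And>z. f2 z = 0 \<longleftrightarrow> is_pole g z"
    "\<And>z. h z \<noteq> 0" "\<And>z. g z = h z * f1 z / f2 z"
    using weierstrass_factorization_meromorphic_UNIV[OF g] by metis
  have ev: "eventually (\<lambda>w. \<not> is_pole g w) (at z)" for z
  proof -
    have "isolated_singularity_at g z"
      using g by (auto simp: nicely_meromorphic_on_def meromorphic_on_altdef)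
    then obtain r where r: "r > 0" "g analytic_on ball z r - {z}"
      by (auto simp: isolated_singularity_at_def)
    have "\<not> is_pole g w" if "w \<in> ball z r - {z}" for w
      using analytic_at_imp_no_pole[OF analytic_on_subset[OF r(2)]] that by auto
    then show ?thesis unfolding eventually_at using r(1) by (intro exI[of _ r]) (auto simp: dist_commute)
  qed
  \<comment> \<open>The energy of the provisional pair formed by the denominator and the numerator
    of g in its Weierstrass factorization. It is positive because f1 and f2 have no common
    zero.\<close>
  define N where "N = (\<lambda>z. (cmod (f2 z))\<^sup>2 + (cmod (h z * f1 z))\<^sup>2)"
  have Npos: "N z > 0" for z
  proof (cases "f2 z = 0")
    case True
    then have "f1 z \<noteq> 0" using h(4,5) by blast
    then show ?thesis using h(6)[of z] by (simp add: N_def True)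
  next
    case False
    then show ?thesis by (simp add: N_def add_pos_nonneg)
  qed
  have Ncont: "continuous_on UNIV N"
    unfolding N_def by (intro continuous_intros holomorphic_on_imp_continuous_on h)
  \<comment> \<open>Off the poles of g, |R| equals P / N, which is continuous and positive
    everywhere. So R extends to an entire function without zeros, which has a holomorphic square
    root k; multiplying the provisional pair by k corrects its energy from N to P.\<close>
  define R where "R = (\<lambda>z. \<alpha> z / (f2 z)\<^sup>2)"
  have RN: "cmod (R z) * N z = P z" if "\<not> is_pole g z" for z
  proof -
    have f2: "f2 z \<noteq> 0" using that h(5) by blast
    have "N z = (cmod (f2 z))\<^sup>2 * (1 + (cmod (g z))\<^sup>2)"
      using f2 unfolding h(7)[of z] by (simp add: N_def norm_divide power_divide distrib_left)
    then show ?thesis unfolding eq[OF that] using f2 by (simp add: R_def norm_divide norm_power)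
  qed
  have "\<alpha> analytic_on UNIV" "(\<lambda>z. (f2 z)\<^sup>2) analytic_on UNIV"
    using \<alpha> h(3) by (auto intro!: holomorphic_intros simp: analytic_on_open)
  then have "R meromorphic_on UNIV"
    unfolding R_def by (intro meromorphic_on_divide analytic_on_imp_meromorphic_on)
  then have nice: "remove_sings R nicely_meromorphic_on UNIV" by (rule remove_sings_nicely_meromorphic)
  let ?R = "remove_sings R"
  have Ran: "R analytic_on {z}" if "\<not> is_pole g z" for z
    unfolding R_def using that h(5)[of z] \<alpha> h(3)
    by (intro analytic_intros) (auto simp: analytic_at intro: exI[of _ UNIV])
  have Req: "?R z = R z" if "\<not> is_pole g z" for z
    by (rule remove_sings_at_analytic[OF Ran[OF that]])
  have evR: "eventually (\<lambda>w. cmod (?R w) = P w / N w) (at z)" for z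
    using ev[of z]
  proof eventually_elim
    case (elim w)
    then show ?case using RN[OF elim] Npos[of w] Req[OF elim] by (simp add: field_simps)
  qed
  have contPN: "isCont (\<lambda>w. P w / N w) z" for z
    using P(1) Ncont Npos[of z] by (auto simp: continuous_on_eq_continuous_at intro!: continuous_intros)
  have lim: "((\<lambda>w. cmod (?R w)) \<longlongrightarrow> P z / N z) (at z)" for z
    using contPN[of z] tendsto_cong[OF evR[of z]] by (simp add: isCont_def)
  have nopole: "\<not> is_pole ?R z" for z
  proof
    assume "is_pole ?R z"
    then have "filterlim (\<lambda>w. cmod (?R w)) at_top (at z)"
      unfolding is_pole_def by (rule filterlim_at_infinity_imp_norm_at_top)
    then show False using lim[of z] not_tendsto_and_filterlim_at_infinity[OF _ lim[of z]]
      by (metis at_neq_bot filterlim_at_top_imp_at_infinity)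
  qed
  have Rhol: "?R holomorphic_on UNIV"
  proof -
    have "?R analytic_on {z}" for z
      by (rule nicely_meromorphic_on_imp_analytic_at[OF nice UNIV_I nopole])
    then show ?thesis using analytic_imp_holomorphic analytic_on_analytic_at by blast
  qed
  have RN': "cmod (?R z) * N z = P z" for z
  proof -
    have "isCont (\<lambda>w. cmod (?R w)) z"
      using holomorphic_on_imp_continuous_on[OF Rhol] by (auto simp: continuous_on_eq_continuous_at intro!: continuous_intros)
    then have "cmod (?R z) = P z / N z" using tendsto_unique[OF _ _ lim[of z]] by (simp add: isCont_def)
    then show ?thesis using Npos[of z] by simp
  qed
  have "?R z \<noteq> 0" for z using RN'[of z] P(2)[of z] by auto
  then obtain k where k: "k holomorphic_on UNIV" "\<And>z. ?R z = (k z)\<^sup>2"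
    using contractible_imp_holomorphic_sqrt[OF Rhol contractible_UNIV] by (metis UNIV_I)
  let ?u = "\<lambda>z. f2 z * k z" and ?v = "\<lambda>z. h z * f1 z * k z"
  show ?thesis
  proof (rule that[of ?u ?v])
    show hu: "?u holomorphic_on UNIV" and hv: "?v holomorphic_on UNIV"
      by (intro holomorphic_intros h k)+
    show "energy ?u ?v z = P z" for z
    proof -
      have "energy ?u ?v z = (cmod (k z))\<^sup>2 * N z"
        by (simp add: energy_def N_def norm_mult power_mult_distrib distrib_left mult_ac)
      also have "(cmod (k z))\<^sup>2 = cmod (?R z)" by (simp add: k(2) norm_power)
      finally show ?thesis using RN'[of z] by simp
    qed
    show "wronskian ?u ?v z = deriv g z * \<alpha> z" if np: "\<not> is_pole g z" for z
    proof -
      have f2: "f2 z \<noteq> 0" using np h(5) by blast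
      have gan: "g analytic_on {z}" by (rule nicely_meromorphic_on_imp_analytic_at[OF g UNIV_I np])
      then have Dg: "(g has_field_derivative deriv g z) (at z)"
        by (simp add: analytic_on_imp_differentiable_at field_differentiable_derivI)
      have Du: "(?u has_field_derivative deriv ?u z) (at z)" by (rule holomorphic_has_deriv[OF hu])
      have "\<forall>\<^sub>F w in nhds z. f2 w \<noteq> 0"
      proof -
        have "open (f2 -` (- {0}))"
          using holomorphic_on_imp_continuous_on[OF h(3)] by (intro open_vimage) auto
        then have "\<forall>\<^sub>F w in nhds z. w \<in> f2 -` (- {0})" using f2 by (intro eventually_nhds_in_open) auto
        then show ?thesis by simp
      qed
      then have "\<forall>\<^sub>F w in nhds z. ?v w = g w * ?u w"
        by eventually_elim (simp add: h(7))
      then have "(?v has_field_derivative g z * deriv ?u z + deriv g z * ?u z) (at z)"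
        using DERIV_mult'[OF Dg Du] by (subst DERIV_cong_ev[OF refl _ refl]) auto
      then have dv: "deriv ?v z = g z * deriv ?u z + deriv g z * ?u z" by (rule DERIV_imp_deriv)
      have vz: "?v z = g z * ?u z" using f2 by (simp add: h(7))
      have "wronskian ?u ?v z = ?u z * (g z * deriv ?u z + deriv g z * ?u z) - deriv ?u z * (g z * ?u z)"
        unfolding wronskian_def dv vz ..
      also have "\<dots> = deriv g z * (f2 z)\<^sup>2 * (k z)\<^sup>2"
        by (simp add: power2_eq_square algebra_simps)
      also have "\<dots> = deriv g z * (f2 z)\<^sup>2 * R z" using k(2)[of z] Req[OF np] by simp
      also have "\<dots> = deriv g z * \<alpha> z" using f2 by (simp add: R_def)
      finally show ?thesis .
    qed
  qed (rule ev)
qed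

section \<open>The classification\<close>

text \<open>The isometry is the global chart followed by multiplication by \<kappa>.
  \<open>smooth_map\<close> quantifies over all charts of both atlases; every coordinate expression
  is factored through the global chart of S and the identity chart of the target.\<close>

lemma isometric_conformal_plane_domain:
  fixes S :: "'a::{t2_space,second_countable_topology} surface"
  assumes S: "riemannian_surface S"
    and c: "c \<in> atlas S" "dom_of c = pts S" "range_of c = - {0}"
    and met: "\<And>x a b. x \<noteq> 0 \<Longrightarrow> met S c x a b = \<rho> x * (a \<bullet> b)"
    and \<kappa>: "\<kappa> \<noteq> 0" and scale: "\<And>x. x \<noteq> 0 \<Longrightarrow> \<rho> x = \<sigma> (\<kappa> * x) * (cmod \<kappa>)\<^sup>2"
  shows "isometric S (conformal_plane_domain (- {0}) \<sigma>)"
proof -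
  let ?D = "- {0 :: complex}" and ?\<Phi> = "coord_of c" and ?\<Psi> = "param_of c"
  let ?T = "conformal_plane_domain ?D \<sigma>" and ?pl = "plane_chart (- {0})"
  let ?F = "\<lambda>p. \<kappa> * ?\<Phi> p" and ?F' = "\<lambda>z. ?\<Psi> (z / \<kappa>)"
  have oD: "open ?D" by auto
  have patchS: "coordinate_patch (pts S) c'" if "c' \<in> atlas S" for c'
    using S that unfolding riemannian_surface_def by blast
  have compat: "oriented_compatible c' c''" if "c' \<in> atlas S" "c'' \<in> atlas S" for c' c''
    using S that unfolding riemannian_surface_def by blast
  have hom: "homeomorphism (pts S) ?D ?\<Phi> ?\<Psi>"
    using patchS[OF c(1)] c unfolding coordinate_patch_def by simp
  have PhiD: "?\<Phi> p \<noteq> 0" "?\<Psi> (?\<Phi> p) = p" if "p \<in> pts S" for p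
    using hom that by (auto simp: homeomorphism_def)
  have PsiS: "?\<Psi> z \<in> pts S" "?\<Phi> (?\<Psi> z) = z" if "z \<noteq> 0" for z
    using hom that by (auto simp: homeomorphism_def)
  have ptsT: "pts ?T = ?D" by (simp add: conformal_plane_domain_def)
  have T: "coordinate_patch ?D d" "oriented_compatible d ?pl" "oriented_compatible ?pl d" if "d \<in> atlas ?T" for d
    using that by (simp_all add: conformal_plane_domain_def)
  have dom_d: "dom_of d \<subseteq> ?D" "open (dom_of d)" "open (range_of d)" if "d \<in> atlas ?T" for d
    using T(1)[OF that] oD unfolding coordinate_patch_def
    by (auto simp: openin_open_eq dest: openin_imp_subset)
  have dom_c: "dom_of c' \<subseteq> pts S" "open (range_of c')" "openin (top_of_set (pts S)) (dom_of c')"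
    if "c' \<in> atlas S" for c'
    using patchS[OF that] unfolding coordinate_patch_def by (auto dest: openin_imp_subset)
  have tr_to: "smooth_on (range_of c') (transition c' c)" if c': "c' \<in> atlas S" for c'
  proof -
    have "dom_of c' \<inter> dom_of c = dom_of c'" using dom_c(1)[OF c'] c(2) by blast
    then show ?thesis using compat[OF c' c(1)] unfolding oriented_compatible_def by simp
  qed
  have tr_from: "smooth_on (?\<Phi> ` dom_of c') (transition c c')" if c': "c' \<in> atlas S" for c'
  proof -
    have "dom_of c \<inter> dom_of c' = dom_of c'" using dom_c(1)[OF c'] c(2) by blast
    then show ?thesis using compat[OF c(1) c'] unfolding oriented_compatible_def by simp
  qed
  have pl_to: "smooth_on (dom_of d) (transition ?pl d)" if d: "d \<in> atlas ?T" for d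
  proof -
    have "dom_of ?pl \<inter> dom_of d = dom_of d" using dom_d(1)[OF d] by auto
    then show ?thesis using T(3)[OF d] unfolding oriented_compatible_def by simp
  qed
  have pl_from: "smooth_on (range_of d) (transition d ?pl)" if d: "d \<in> atlas ?T" for d
  proof -
    have "dom_of d \<inter> dom_of ?pl = dom_of d" using dom_d(1)[OF d] by auto
    then show ?thesis using T(2)[OF d] unfolding oriented_compatible_def by simp
  qed
  have mult: "smooth_on X (\<lambda>x. k * f x)" if "smooth_on X f" "open X" for X and k :: complex and f :: "complex \<Rightarrow> complex"
  proof -
    have "smooth_on UNIV (\<lambda>x. k * x)" by (rule smooth_on_bounded_linear[OF bounded_linear_mult_right])
    from smooth_on_compose[OF that(2) open_UNIV subset_UNIV this that(1)] show ?thesis .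
  qed
  let ?f = "\<lambda>c' d. coord_of d \<circ> ?F \<circ> param_of c'"
  let ?X = "\<lambda>c' d. coord_of c' ` (dom_of c' \<inter> ?F -` dom_of d)"
  have X: "open (?X c' d)" "?X c' d \<subseteq> range_of c'"
      "\<And>x. x \<in> ?X c' d \<Longrightarrow> \<kappa> * transition c' c x \<in> dom_of d"
      "\<And>x. x \<in> ?X c' d \<Longrightarrow> ?f c' d x = transition ?pl d (\<kappa> * transition c' c x)"
    if c': "c' \<in> atlas S" and d: "d \<in> atlas ?T" for c' d
  proof -
    have eq: "?X c' d = range_of c' \<inter> (\<lambda>x. \<kappa> * transition c' c x) -` dom_of d"
    proof (intro equalityI subsetI)
      fix x assume "x \<in> ?X c' d"
      then obtain p where p: "p \<in> dom_of c'" "\<kappa> * ?\<Phi> p \<in> dom_of d" "x = coord_of c' p" by auto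
      then show "x \<in> range_of c' \<inter> (\<lambda>x. \<kappa> * transition c' c x) -` dom_of d"
        using param_of_left[OF patchS[OF c'] p(1)] by (simp add: transition_def)
    next
      fix x assume x: "x \<in> range_of c' \<inter> (\<lambda>x. \<kappa> * transition c' c x) -` dom_of d"
      then have "param_of c' x \<in> dom_of c'" "coord_of c' (param_of c' x) = x"
        using param_of_in[of x c'] param_of_right[of x c'] by auto
      then show "x \<in> ?X c' d" using x by (intro image_eqI[of _ _ "param_of c' x"]) (auto simp: transition_def)
    qed
    have "continuous_on (range_of c') (\<lambda>x. \<kappa> * transition c' c x)"
      by (rule smooth_on_imp_continuous_on[OF mult[OF tr_to[OF c'] dom_c(2)[OF c']]])
    then show "open (?X c' d)" unfolding eq
      by (rule continuous_open_preimage[OF _ dom_c(2)[OF c'] dom_d(2)[OF d]])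
    show "?X c' d \<subseteq> range_of c'" unfolding eq by blast
    fix x assume x: "x \<in> ?X c' d"
    then show 1: "\<kappa> * transition c' c x \<in> dom_of d" unfolding eq by blast
    have "\<kappa> * transition c' c x \<in> ?D" using 1 dom_d(1)[OF d] by blast
    then show "?f c' d x = transition ?pl d (\<kappa> * transition c' c x)"
      using param_of_plane_chart[of "\<kappa> * transition c' c x" ?D] by (simp add: transition_def)
  qed
  have smF: "smooth_on (?X c' d) (\<lambda>x. \<kappa> * transition c' c x)" "smooth_on (?X c' d) (?f c' d)"
    if c': "c' \<in> atlas S" and d: "d \<in> atlas ?T" for c' d
  proof -
    show 1: "smooth_on (?X c' d) (\<lambda>x. \<kappa> * transition c' c x)"
      by (rule mult[OF smooth_on_subset[OF tr_to[OF c'] X(2)[OF c' d]] X(1)[OF c' d]])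
    have "(\<lambda>x. \<kappa> * transition c' c x) ` ?X c' d \<subseteq> dom_of d" using X(3)[OF c' d] by blast
    from smooth_on_compose[OF X(1)[OF c' d] dom_d(2)[OF d] this pl_to[OF d] 1]
    show "smooth_on (?X c' d) (?f c' d)"
      using smooth_on_cong[of "?X c' d" "?f c' d" "\<lambda>x. transition ?pl d (\<kappa> * transition c' c x)"]
        X(1)[OF c' d] X(4)[OF c' d] by blast
  qed
  have F: "smooth_map S ?T ?F"
    unfolding smooth_map_def ptsT
  proof (intro conjI ballI)
    show "continuous_on (pts S) ?F"
      by (intro continuous_intros) (use hom in \<open>simp add: homeomorphism_def\<close>)
    show "?F ` pts S \<subseteq> ?D" using PhiD(1) \<kappa> by auto
  qed (rule smF(2))
  have F': "smooth_map ?T S ?F'"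
    unfolding smooth_map_def ptsT
  proof (intro conjI ballI)
    have "continuous_on ?D ?\<Psi>" using hom by (simp add: homeomorphism_def)
    then show "continuous_on ?D ?F'"
      by (rule continuous_on_compose2) (use \<kappa> in \<open>auto intro!: continuous_intros\<close>)
    show "?F' ` ?D \<subseteq> pts S"
    proof (intro image_subsetI)
      fix z assume "z \<in> ?D"
      then have "z / \<kappa> \<in> ?D" using \<kappa> by simp
      then show "?F' z \<in> pts S" using PsiS(1) by simp
    qed
    fix d c' assume d: "d \<in> atlas ?T" and c': "c' \<in> atlas S"
    let ?Y = "?\<Phi> ` dom_of c'" and ?g = "\<lambda>x. (1 / \<kappa>) * transition d ?pl x"
    let ?X' = "coord_of d ` (dom_of d \<inter> ?F' -` dom_of c')"
    have oY: "open ?Y"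
      using homeomorphism_imp_open_map[OF hom dom_c(3)[OF c']] oD by (simp add: openin_open_eq)
    have iff: "?\<Psi> y \<in> dom_of c' \<longleftrightarrow> y \<in> ?Y" if "y \<noteq> 0" for y
    proof
      assume "?\<Psi> y \<in> dom_of c'"
      then show "y \<in> ?Y" using PsiS(2)[OF that] by (metis imageI)
    next
      assume "y \<in> ?Y"
      then show "?\<Psi> y \<in> dom_of c'" using PhiD(2) dom_c(1)[OF c'] by auto
    qed
    have param_d: "param_of d x \<in> dom_of d" "coord_of d (param_of d x) = x" "param_of d x \<noteq> 0"
      if "x \<in> range_of d" for x
      using param_of_in[OF that] param_of_right[OF that] dom_d(1)[OF d] by auto
    have eq: "?X' = range_of d \<inter> ?g -` ?Y"
    proof (intro equalityI subsetI)
      fix x assume "x \<in> ?X'"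
      then obtain z where z: "z \<in> dom_of d" "?\<Psi> (z / \<kappa>) \<in> dom_of c'" "x = coord_of d z" by auto
      have "z \<noteq> 0" using z(1) dom_d(1)[OF d] by auto
      then have "z / \<kappa> \<in> ?Y" using iff[of "z / \<kappa>"] z(2) \<kappa> by simp
      then show "x \<in> range_of d \<inter> ?g -` ?Y"
        using param_of_left[OF T(1)[OF d] z(1)] z by (simp add: transition_def)
    next
      fix x assume x: "x \<in> range_of d \<inter> ?g -` ?Y"
      then have "?\<Psi> (param_of d x / \<kappa>) \<in> dom_of c'"
        using iff[of "param_of d x / \<kappa>"] param_d(3)[of x] \<kappa> by (simp add: transition_def)
      then show "x \<in> ?X'" using x param_d[of x] by (intro image_eqI[of _ _ "param_of d x"]) auto
    qed
    have sg: "smooth_on (range_of d) ?g" by (rule mult[OF pl_from[OF d] dom_d(3)[OF d]])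
    have oX: "open ?X'" unfolding eq
      by (rule continuous_open_preimage[OF smooth_on_imp_continuous_on[OF sg] dom_d(3)[OF d] oY])
    have sub: "?X' \<subseteq> range_of d" "?g ` ?X' \<subseteq> ?Y" unfolding eq by blast+
    have "(coord_of c' \<circ> ?F' \<circ> param_of d) x = transition c c' (?g x)" for x
      by (simp add: transition_def)
    then show "smooth_on ?X' (coord_of c' \<circ> ?F' \<circ> param_of d)"
      using smooth_on_cong[of ?X' "coord_of c' \<circ> ?F' \<circ> param_of d" "\<lambda>x. transition c c' (?g x)"] oX
        smooth_on_compose[OF oX oY sub(2) tr_from[OF c'] smooth_on_subset[OF sg sub(1)]] by blast
  qed
  have "metric_preserving S ?T ?F"
    unfolding metric_preserving_def Let_def
  proof (intro ballI allI)
    fix c' d x a b assume c': "c' \<in> atlas S" and d: "d \<in> atlas ?T" and x: "x \<in> ?X c' d"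
    let ?\<tau> = "transition c' c" and ?f' = "?f c' d"
    have xr: "x \<in> range_of c'" using X(2)[OF c' d] x by blast
    have tx: "?\<tau> x \<noteq> 0"
      using PhiD(1) param_of_in[OF xr] dom_c(1)[OF c'] by (auto simp: transition_def)
    have dt: "?\<tau> differentiable (at x)" by (rule smooth_on_differentiable[OF tr_to[OF c'] xr])
    have df: "?f' differentiable (at x)" by (rule smooth_on_differentiable[OF smF(2)[OF c' d] x])
    have fx: "?f' x \<in> range_of d" "param_of d (?f' x) = \<kappa> * ?\<tau> x"
    proof -
      have 1: "\<kappa> * ?\<tau> x \<in> dom_of d" by (rule X(3)[OF c' d x])
      have 2: "?f' x = coord_of d (\<kappa> * ?\<tau> x)" by (simp add: transition_def)
      show "?f' x \<in> range_of d" using 1 2 by (metis imageI)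
      show "param_of d (?f' x) = \<kappa> * ?\<tau> x" unfolding 2 by (rule param_of_left[OF T(1)[OF d] 1])
    qed
    have pf: "param_of d (?f' y) = \<kappa> * ?\<tau> y" if "y \<in> ?X c' d" for y
      using param_of_left[OF T(1)[OF d] X(3)[OF c' d that]] by (simp add: transition_def)
    have dp: "param_of d differentiable (at (?f' x))"
    proof -
      have "transition d ?pl = param_of d" by (simp add: transition_def fun_eq_iff)
      then show ?thesis using smooth_on_differentiable[OF pl_from[OF d] fx(1)] by simp
    qed
    \<comment> \<open>The target metric in the chart d is defined through the derivative of
      \<open>param_of d\<close>, and \<open>param_of d\<close> undoes the coordinate expression down
      to \<kappa> times a transition map of S.\<close>
    have pd: "pd (pd e ?f' x) (param_of d) (?f' x) = \<kappa> * pd e ?\<tau> x" for e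
    proof -
      have "pd (pd e ?f' x) (param_of d) (?f' x) = pd e (\<lambda>y. param_of d (?f' y)) x"
        by (rule pd_compose(1)[OF df dp, symmetric])
      also have "\<dots> = pd e (\<lambda>y. \<kappa> * ?\<tau> y) x" by (rule pd_cong_open[OF X(1)[OF c' d] x pf])
      also have "\<dots> = \<kappa> * pd e ?\<tau> x"
        using pd_eqI[OF has_derivative_mult_right[OF dt[unfolded frechet_derivative_works]], of e \<kappa>]
        by (simp add: pd_def)
      finally show ?thesis .
    qed
    have "coord_of c' ` (dom_of c' \<inter> dom_of c) = range_of c'"
      using dom_c(1)[OF c'] c(2) by (metis inf.absorb1)
    then have xc: "x \<in> coord_of c' ` (dom_of c' \<inter> dom_of c)" using xr by simp
    have "\<forall>c\<in>atlas S. \<forall>d\<in>atlas S. \<forall>x \<in> coord_of c ` (dom_of c \<inter> dom_of d). \<forall>u v. met S c x u v =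
        met S d (transition c d x) (pd u (transition c d) x) (pd v (transition c d) x)"
      using S unfolding riemannian_surface_def by (elim conjE)
    from this[THEN bspec, OF c', THEN bspec, OF c(1), THEN bspec, OF xc]
    have "met S c' x a b = met S c (?\<tau> x) (pd a ?\<tau> x) (pd b ?\<tau> x)" by simp
    also have "\<dots> = \<sigma> (\<kappa> * ?\<tau> x) * ((cmod \<kappa>)\<^sup>2 * (pd a ?\<tau> x \<bullet> pd b ?\<tau> x))"
      unfolding met[OF tx] scale[OF tx] by simp
    also have "(cmod \<kappa>)\<^sup>2 * (pd a ?\<tau> x \<bullet> pd b ?\<tau> x) = (\<kappa> * pd a ?\<tau> x) \<bullet> (\<kappa> * pd b ?\<tau> x)"
      unfolding cmod_power2 inner_complex_def by (simp add: power2_eq_square algebra_simps)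
    also have "\<sigma> (\<kappa> * ?\<tau> x) * ((\<kappa> * pd a ?\<tau> x) \<bullet> (\<kappa> * pd b ?\<tau> x))
        = met ?T d (?f' x) (pd a ?f' x) (pd b ?f' x)"
      by (simp only: conformal_plane_domain_def surface.simps fx(2) pd)
    finally show "met S c' x a b = met ?T d (?f' x) (pd a ?f' x) (pd b ?f' x)" .
  qed
  moreover have "\<forall>p\<in>pts S. ?F' (?F p) = p" using PhiD(2) \<kappa> by simp
  moreover have "\<forall>q\<in>pts ?T. ?F (?F' q) = q" using PsiS(2) \<kappa> by (simp add: ptsT)
  ultimately show ?thesis unfolding isometric_def using F F' by blast
qed

text \<open>The data are pulled back along a lift L of exp and then split by
  \<open>spinor_representation\<close>. The resulting energy is twice the conformal factor in the
  coordinate log, so it depends on the metric alone and not on the chosen data.\<close>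

lemma weierstrass_data_lift:
  fixes S :: "'a::{t2_space,second_countable_topology} surface"
  assumes wd: "weierstrass_data S \<Omega> \<pi> g \<alpha>"
    and c: "c \<in> holomorphic_charts S" "dom_of c = pts S" "range_of c = - {0}" "coordinate_patch (pts S) c"
    and met: "\<And>x a b. x \<noteq> 0 \<Longrightarrow> met S c x a b = \<rho> x * (a \<bullet> b)" and rho: "\<And>x. x \<noteq> 0 \<Longrightarrow> \<rho> x > 0"
    and cont: "continuous_on (- {0}) \<rho>"
  obtains u v L where "u holomorphic_on UNIV" "v holomorphic_on UNIV"
    "\<And>z. energy u v z = 2 * sqrt (\<rho> (exp z)) * exp (Re z)"
    "L holomorphic_on UNIV" "\<And>z. L z \<in> \<Omega>" "\<And>z. coord_of c (\<pi> (L z)) = exp z"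
    "\<And>z. \<not> is_pole g (L z) \<Longrightarrow> wronskian u v z = deriv g (L z) * \<alpha> (L z) * (deriv L z)\<^sup>2"
    "\<And>z. eventually (\<lambda>w. \<not> is_pole g (L w)) (at z)"
proof -
  define p where "p = coord_of c \<circ> \<pi>"
  have \<Omega>: "open \<Omega>" and cov: "covering_space \<Omega> \<pi> (pts S)"
    and g: "g nicely_meromorphic_on \<Omega>" and \<alpha>: "\<alpha> holomorphic_on \<Omega>"
    and fac: "\<And>z a b. z \<in> \<Omega> \<inter> \<pi> -` dom_of c \<Longrightarrow> \<not> is_pole g z \<Longrightarrow>
        met S c (coord_of c (\<pi> z)) (pd a p z) (pd b p z) = weierstrass_factor g \<alpha> z * (a \<bullet> b)"
    using wd c(1) unfolding weierstrass_data_def universal_cover_def p_def holomorphic_charts_def by auto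
  have piS: "\<pi> z \<in> pts S" if "z \<in> \<Omega>" for z using covering_space_imp_surjective[OF cov] that by auto
  have "p holomorphic_on (\<Omega> \<inter> \<pi> -` dom_of c)"
    using wd c(1) unfolding weierstrass_data_def universal_cover_def p_def by auto
  moreover have "\<Omega> \<inter> \<pi> -` dom_of c = \<Omega>" using piS c(2) by auto
  ultimately have p: "p holomorphic_on \<Omega>" by simp
  have hom: "homeomorphism (pts S) (- {0}) (coord_of c) (param_of c)"
    using c(2-4) unfolding coordinate_patch_def by simp
  have covp: "covering_space \<Omega> p (- {0})"
    using covering_space_compose_homeomorphism[OF cov hom] by (simp add: p_def o_def)
  obtain L where L: "L holomorphic_on UNIV" "\<And>z. L z \<in> \<Omega>" "\<And>z. p (L z) = exp z"
    using lift_exp_through_holomorphic_covering[OF \<Omega> covp p] by blast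
  have DL: "(L has_field_derivative deriv L z) (at z)" for z by (rule holomorphic_has_deriv[OF L(1)])
  have Dp: "(p has_field_derivative deriv p (L z)) (at (L z))" for z by (rule holomorphic_derivI[OF p \<Omega> L(2)])
  have dpL: "deriv p (L z) * deriv L z = exp z" for z
    using DERIV_unique[OF DERIV_chain2[OF Dp DL, unfolded L(3)] DERIV_exp] .
  have contL: "isCont L z" for z using DL[of z] by (rule DERIV_isCont)
  have gan: "g analytic_on {L z}" if "\<not> is_pole g (L z)" for z
    by (rule nicely_meromorphic_on_imp_analytic_at[OF g L(2) that])
  have Lan: "L analytic_on A" for A using L(1) by (meson analytic_on_open analytic_on_subset open_UNIV subset_UNIV)
  let ?G = "\<lambda>z. g (L z)"
  have Gan: "?G analytic_on {z}" if "\<not> is_pole g (L z)" for z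
    using analytic_on_compose[OF Lan[of "{z}"], of g] gan[OF that] by (simp add: o_def)
  have pole: "is_pole ?G z \<longleftrightarrow> is_pole g (L z)" for z
  proof
    assume "is_pole ?G z"
    then show "is_pole g (L z)" using Gan[of z] analytic_at_imp_no_pole by blast
  next
    assume "is_pole g (L z)"
    moreover have "L \<midarrow>z\<rightarrow> L z" using contL[of z] by (simp add: isCont_def)
    \<comment> \<open>L separates z from nearby points because its image under p, which is exp,
      does; so L w approaches the pole without meeting it.\<close>
    moreover have "eventually (\<lambda>w. L w \<noteq> L z) (at z)"
      unfolding eventually_at
    proof (intro exI[of _ "2 * pi"] conjI ballI impI)
      fix w assume w: "w \<noteq> z \<and> dist w z < 2 * pi"
      then have "\<bar>Im w - Im z\<bar> < 2 * pi" using abs_Im_le_cmod[of "w - z"] by (simp add: dist_norm)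
      then have "exp w \<noteq> exp z" using w exp_complex_eqI by blast
      then show "L w \<noteq> L z" using L(3) by metis
    qed simp
    ultimately show "is_pole ?G z" by (rule is_pole_compose)
  qed
  have "g meromorphic_on \<Omega>" and gcases: "\<And>z. z \<in> \<Omega> \<Longrightarrow> is_pole g z \<and> g z = 0 \<or> g \<midarrow>z\<rightarrow> g z"
    using g by (auto simp: nicely_meromorphic_on_def)
  then have Gmero: "?G meromorphic_on UNIV"
    by (intro meromorphic_on_compose[OF _ Lan[of UNIV]]) (use L(2) in auto)
  have Gnice: "?G nicely_meromorphic_on UNIV"
    unfolding nicely_meromorphic_on_def
  proof (intro conjI Gmero ballI)
    fix z
    show "is_pole ?G z \<and> ?G z = 0 \<or> ?G \<midarrow>z\<rightarrow> ?G z"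
    proof (cases "is_pole g (L z)")
      case True
      then have "\<not> g \<midarrow>L z\<rightarrow> g (L z)" using not_tendsto_and_filterlim_at_infinity[of "at (L z)" g] unfolding is_pole_def by auto
      then show ?thesis using True gcases[OF L(2)] pole by blast
    next
      case False
      then have "isCont ?G z" using analytic_at_imp_isCont[OF Gan] by blast
      then show ?thesis by (simp add: isCont_def)
    qed
  qed
  let ?A = "\<lambda>z. \<alpha> (L z) * deriv L z"
  have "\<alpha> \<circ> L holomorphic_on UNIV"
    by (rule holomorphic_on_compose_gen[OF L(1) \<alpha>]) (use L(2) in auto)
  then have A: "?A holomorphic_on UNIV"
    using holomorphic_deriv[OF L(1) open_UNIV] by (intro holomorphic_on_mult) (simp_all add: o_def)
  let ?P = "\<lambda>z. 2 * sqrt (\<rho> (exp z)) * exp (Re z)"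
  have Pc: "continuous_on UNIV ?P"
    by (intro continuous_intros continuous_on_compose2[OF cont continuous_on_exp[OF continuous_on_id]]) auto
  have Pp: "?P z > 0" for z using rho[of "exp z"] by simp
  have eq: "?P z = cmod (?A z) * (1 + (cmod (?G z))\<^sup>2)" if np: "\<not> is_pole ?G z" for z
  proof -
    have pd: "pd 1 p (L z) = deriv p (L z)"
      using pd_eqI[OF has_derivative_holomorphic[OF p \<Omega> L(2)]] by simp
    have "\<rho> (exp z) * (cmod (deriv p (L z)))\<^sup>2 = weierstrass_factor g \<alpha> (L z)"
      using fac[of "L z" 1 1] L(2)[of z] piS[OF L(2)[of z]] c(2) np[unfolded pole] L(3)[of z]
      unfolding pd by (simp add: p_def met dot_square_norm)
    then have "\<rho> (exp z) * (cmod (deriv p (L z)))\<^sup>2 * (cmod (deriv L z))\<^sup>2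
        = (cmod (\<alpha> (L z)) * (1 + (cmod (g (L z)))\<^sup>2) * cmod (deriv L z))\<^sup>2 / 4"
      unfolding weierstrass_factor_scaled[symmetric] by simp
    moreover have "(cmod (deriv p (L z)))\<^sup>2 * (cmod (deriv L z))\<^sup>2 = (exp (Re z))\<^sup>2"
      unfolding power_mult_distrib[symmetric] norm_mult[symmetric] dpL by simp
    ultimately have "4 * (\<rho> (exp z) * (exp (Re z))\<^sup>2) = (cmod (?A z) * (1 + (cmod (?G z))\<^sup>2))\<^sup>2"
      by (simp add: norm_mult mult.assoc) (simp add: mult_ac)
    moreover have "(?P z)\<^sup>2 = 4 * (\<rho> (exp z) * (exp (Re z))\<^sup>2)"
      using rho[of "exp z"] by (simp add: power_mult_distrib)
    ultimately have "(?P z)\<^sup>2 = (cmod (?A z) * (1 + (cmod (?G z))\<^sup>2))\<^sup>2" by simp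
    then show ?thesis by (rule power2_eq_imp_eq) (use Pp[of z] in \<open>auto intro: less_imp_le\<close>)
  qed
  obtain u v where uv: "u holomorphic_on UNIV" "v holomorphic_on UNIV" "\<And>z. energy u v z = ?P z"
    "\<And>z. \<not> is_pole ?G z \<Longrightarrow> wronskian u v z = deriv ?G z * ?A z"
    "\<And>z. eventually (\<lambda>w. \<not> is_pole ?G w) (at z)"
    using spinor_representation[OF Gnice A Pc Pp eq] by metis
  show ?thesis
  proof (rule that[OF uv(1,2,3) L(1,2)])
    show "coord_of c (\<pi> (L z)) = exp z" for z using L(3)[of z] by (simp add: p_def)
    show "wronskian u v z = deriv g (L z) * \<alpha> (L z) * (deriv L z)\<^sup>2" if "\<not> is_pole g (L z)" for z
    proof -
      have "(g has_field_derivative deriv g (L z)) (at (L z))"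
        using gan[OF that] by (simp add: analytic_on_imp_differentiable_at field_differentiable_derivI)
      then have "deriv ?G z = deriv g (L z) * deriv L z" by (intro DERIV_imp_deriv DERIV_chain2[OF _ DL])
      then show ?thesis using uv(4)[of z] that pole[of z] by (simp add: power2_eq_square)
    qed
    show "eventually (\<lambda>w. \<not> is_pole g (L w)) (at z)" for z using uv(5)[of z] pole by simp
  qed
qed

text \<open>Here \<open>\<epsilon> = 1\<close> for the end at \<open>0\<close> and \<open>\<epsilon> = -1\<close> for the end at infinity.\<close>

lemma wronskian_at_catenoidal_end:
  fixes \<epsilon> :: complex
  assumes u: "u holomorphic_on UNIV" and v: "v holomorphic_on UNIV" and L: "L holomorphic_on UNIV" "\<And>z. L z \<in> \<Omega>"
    and W: "\<And>z. \<not> is_pole g (L z) \<Longrightarrow> wronskian u v z = deriv g (L z) * \<alpha> (L z) * (deriv L z)\<^sup>2"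
    and ev: "\<And>z. eventually (\<lambda>w. \<not> is_pole g (L w)) (at z)"
    and wL: "\<And>z. w (\<pi> (L z)) = exp (\<epsilon> * z)" and \<epsilon>: "\<epsilon>\<^sup>2 = 1"
    and hol: "(w \<circ> \<pi>) holomorphic_on \<Omega>" "open \<Omega>"
    and q: "r > 0" "q holomorphic_on (ball 0 r - {0})" "is_pole q 0" "zorder q 0 = - 2"
    and hopf: "\<And>z. z \<in> \<Omega> \<Longrightarrow> 0 < cmod (w (\<pi> z)) \<Longrightarrow> cmod (w (\<pi> z)) < r \<Longrightarrow> \<not> is_pole g z \<Longrightarrow>
        deriv g z * \<alpha> z = q (w (\<pi> z)) * (deriv (w \<circ> \<pi>) z)\<^sup>2"
  shows "(\<exists>s K. \<forall>z. Re (\<epsilon> * z) \<le> s \<longrightarrow> cmod (wronskian u v z) \<le> K) \<and> (\<exists>z. wronskian u v z \<noteq> 0)"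
proof -
  define h where "h = zor_poly q 0"
  obtain r' where r': "r' > 0" "cball 0 r' \<subseteq> ball (0 :: complex) r" "h holomorphic_on cball 0 r'"
    "\<forall>x\<in>cball 0 r' - {0}. q x = h x / x\<^sup>2 \<and> h x \<noteq> 0"
  proof -
    have "0 \<in> ball (0 :: complex) r" using q(1) by simp
    from zorder_exist_pole[OF q(2) open_ball this q(3)] obtain ra where ra: "ra > 0" "cball 0 ra \<subseteq> ball (0 :: complex) r"
      "zor_poly q 0 holomorphic_on cball 0 ra"
      "\<forall>w\<in>cball 0 ra - {0}. q w = zor_poly q 0 w / (w - 0) ^ nat (- zorder q 0) \<and> zor_poly q 0 w \<noteq> 0"
      by (elim conjE exE) (rule that)
    have e: "(x - 0) ^ nat (- zorder q 0) = x\<^sup>2" for x :: complex unfolding q(4) by simp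
    show ?thesis by (rule that[OF ra(1,2)]) (use ra(3,4) in \<open>simp_all only: h_def e\<close>)
  qed
  have "bounded (h ` cball 0 r')"
    by (intro compact_imp_bounded compact_continuous_image holomorphic_on_imp_continuous_on r'(3)) simp
  then obtain K where "\<forall>y\<in>h ` cball 0 r'. cmod y \<le> K" unfolding bounded_iff by blast
  then have K: "cmod (h x) \<le> K" if "x \<in> cball 0 r'" for x using that by blast
  \<comment> \<open>In the variable x = exp (\<epsilon> z) one has dx^2 = x^2 dz^2, as \<epsilon>^2
    = 1, and this x^2 cancels the double pole of q. The Wronskian becomes h, holomorphic on the
    closed disc and nonzero off its centre.\<close>
  have Wh: "wronskian u v z = h (exp (\<epsilon> * z)) \<and> exp (\<epsilon> * z) \<in> cball 0 r' - {0}"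
    if np: "\<not> is_pole g (L z)" and z: "Re (\<epsilon> * z) < ln r'" for z
  proof -
    let ?x = "exp (\<epsilon> * z)"
    have "cmod ?x < r'" using z r'(1) by (simp add: norm_exp_eq_Re) (metis exp_less_cancel_iff exp_ln)
    then have x: "?x \<in> cball 0 r' - {0}" by simp
    then have "?x \<in> ball 0 r" using r'(2) by blast
    then have xr: "cmod ?x < r" by simp
    have "((w \<circ> \<pi>) has_field_derivative deriv (w \<circ> \<pi>) (L z)) (at (L z))"
      by (rule holomorphic_derivI[OF hol L(2)])
    from DERIV_chain2[OF this holomorphic_has_deriv[OF L(1)]]
    have "((\<lambda>z. exp (\<epsilon> * z)) has_field_derivative deriv (w \<circ> \<pi>) (L z) * deriv L z) (at z)"
      by (simp add: wL)
    moreover have "((\<lambda>z. exp (\<epsilon> * z)) has_field_derivative ?x * \<epsilon>) (at z)"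
      by (auto intro!: derivative_eq_intros)
    ultimately have d: "deriv (w \<circ> \<pi>) (L z) * deriv L z = ?x * \<epsilon>" by (rule DERIV_unique)
    have "wronskian u v z = q ?x * (deriv (w \<circ> \<pi>) (L z))\<^sup>2 * (deriv L z)\<^sup>2"
      using W[OF np] hopf[OF L(2), of z] np xr by (simp add: wL)
    also have "\<dots> = q ?x * (deriv (w \<circ> \<pi>) (L z) * deriv L z)\<^sup>2" by (simp add: power_mult_distrib)
    also have "\<dots> = q ?x * ?x\<^sup>2" unfolding d power_mult_distrib \<epsilon> by simp
    also have "\<dots> = h ?x" using r'(4) x by simp
    finally show ?thesis using x by simp
  qed
  have holW: "wronskian u v holomorphic_on UNIV"
    unfolding wronskian_def[abs_def] by (intro holomorphic_intros holomorphic_deriv u v open_UNIV)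
  \<comment> \<open>The formula for the Wronskian holds off the poles of g o L. These are isolated,
    so any open condition near z can be tested at a point that is not a pole.\<close>
  have nonpole: "\<exists>y. \<not> is_pole g (L y) \<and> Re (\<epsilon> * y) < ln r' \<and> Q y"
    if "Re (\<epsilon> * z) < ln r'" "eventually Q (at z)" for z Q
  proof -
    have "open ((\<lambda>y. Re (\<epsilon> * y)) -` {..<ln r'})" by (intro open_vimage continuous_intros open_lessThan)
    then have "eventually (\<lambda>y. y \<in> (\<lambda>y. Re (\<epsilon> * y)) -` {..<ln r'}) (at z)"
      by (rule eventually_at_in_open') (use that(1) in simp)
    with ev[of z] that(2) have "eventually (\<lambda>y. \<not> is_pole g (L y) \<and> Re (\<epsilon> * y) < ln r' \<and> Q y) (at z)"
      by eventually_elim auto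
    then show ?thesis by (rule eventually_happens'[OF at_neq_bot])
  qed
  have bound: "cmod (wronskian u v z) \<le> K" if z: "Re (\<epsilon> * z) \<le> ln r' - 1" for z
  proof (rule ccontr)
    assume "\<not> ?thesis"
    moreover have "isCont (\<lambda>z. cmod (wronskian u v z)) z"
      using holomorphic_on_imp_continuous_on[OF holW] by (auto simp: continuous_on_eq_continuous_at intro!: continuous_intros)
    ultimately have "eventually (\<lambda>y. K < cmod (wronskian u v y)) (at z)"
      by (intro order_tendstoD(1)[of _ "cmod (wronskian u v z)"]) (auto simp: isCont_def)
    then obtain y where "\<not> is_pole g (L y)" "Re (\<epsilon> * y) < ln r'" "K < cmod (wronskian u v y)"
      using nonpole[of z "\<lambda>y. K < cmod (wronskian u v y)"] z by auto
    with Wh[of y] K[of "exp (\<epsilon> * y)"] show False by simp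
  qed
  have "\<epsilon> \<noteq> 0" using \<epsilon> by auto
  then have "Re (\<epsilon> * (of_real (ln r' - 1) / \<epsilon>)) < ln r'" by simp
  from nonpole[OF this always_eventually, of "\<lambda>_. True"]
  obtain y where "\<not> is_pole g (L y)" "Re (\<epsilon> * y) < ln r'" by blast
  then have "wronskian u v y \<noteq> 0" using Wh[of y] r'(4) by auto
  with bound show ?thesis by blast
qed

text \<open>Each end supplies a universal cover and Weierstrass data of its own. Both lifts have the
  energy prescribed by the metric, which is what allows the bounds on the two Wronskians to be
  combined.\<close>

theorem catenoidal_annulus_isometric_to_model:
  fixes S :: "'a::{t2_space,second_countable_topology} surface"
  assumes S: "riemannian_surface S" and biholo: "biholomorphic_onto S (pts S) \<Phi> (- {0})"
    and fin: "finite_total_curvature S"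
    and ends: "catenoidal_end S \<Phi>" "catenoidal_end S (\<lambda>p. inverse (\<Phi> p))"
  obtains m where "admissible m" "isometric S (model_surface m)"
proof -
  let ?c = "(pts S, \<Phi>)"
  have chart: "?c \<in> holomorphic_charts S" and im: "\<Phi> ` pts S = - {0}"
    using biholo unfolding biholomorphic_onto_def by auto
  then have atl: "?c \<in> atlas S" and c2: "dom_of ?c = pts S" and c3: "range_of ?c = - {0}"
    by (auto simp: holomorphic_charts_def)
  have patch: "coordinate_patch (pts S) ?c" using S atl unfolding riemannian_surface_def by blast
  obtain \<rho> where \<rho>: "\<forall>x\<in>range_of ?c. \<forall>a b. met S ?c x a b = \<rho> x * (a \<bullet> b)"
    using chart unfolding holomorphic_charts_def by blast
  then have met: "\<And>x a b. x \<noteq> 0 \<Longrightarrow> met S ?c x a b = \<rho> x * (a \<bullet> b)" unfolding c3 by blast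
  have rho: "\<rho> x > 0" if "x \<noteq> 0" for x
  proof -
    have "x \<in> range_of ?c" unfolding c3 using that by simp
    then have "met S ?c x 1 1 > 0" using S atl unfolding riemannian_surface_def by (meson one_neq_zero)
    then show ?thesis using met[OF that, of 1 1] by simp
  qed
  have "smooth_on (range_of ?c) (\<lambda>x. met S ?c x 1 1)" using S atl unfolding riemannian_surface_def by blast
  then have "continuous_on (- {0}) (\<lambda>x. met S ?c x 1 1)" unfolding c3 by (rule smooth_on_imp_continuous_on)
  then have cont: "continuous_on (- {0}) \<rho>" by (rule continuous_on_eq) (simp add: met)
  note lift = weierstrass_data_lift[OF _ chart c2 c3 patch met rho cont]
  obtain \<Omega>1 \<pi>1 g1 \<alpha>1 r1 q1 where e1: "weierstrass_data S \<Omega>1 \<pi>1 g1 \<alpha>1" "r1 > 0"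
    "q1 holomorphic_on (ball 0 r1 - {0})" "is_pole q1 0" "zorder q1 0 = - 2"
    "\<And>z. z \<in> \<Omega>1 \<Longrightarrow> 0 < cmod (\<Phi> (\<pi>1 z)) \<Longrightarrow> cmod (\<Phi> (\<pi>1 z)) < r1 \<Longrightarrow> \<not> is_pole g1 z \<Longrightarrow>
        deriv g1 z * \<alpha>1 z = q1 (\<Phi> (\<pi>1 z)) * (deriv (\<Phi> \<circ> \<pi>1) z)\<^sup>2"
    using ends(1) unfolding catenoidal_end_def by auto
  obtain \<Omega>2 \<pi>2 g2 \<alpha>2 r2 q2 where e2: "weierstrass_data S \<Omega>2 \<pi>2 g2 \<alpha>2" "r2 > 0"
    "q2 holomorphic_on (ball 0 r2 - {0})" "is_pole q2 0" "zorder q2 0 = - 2"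
    "\<And>z. z \<in> \<Omega>2 \<Longrightarrow> 0 < cmod (inverse (\<Phi> (\<pi>2 z))) \<Longrightarrow> cmod (inverse (\<Phi> (\<pi>2 z))) < r2 \<Longrightarrow> \<not> is_pole g2 z \<Longrightarrow>
        deriv g2 z * \<alpha>2 z = q2 (inverse (\<Phi> (\<pi>2 z))) * (deriv ((\<lambda>p. inverse (\<Phi> p)) \<circ> \<pi>2) z)\<^sup>2"
    using ends(2) unfolding catenoidal_end_def by auto
  obtain u v L where uv: "u holomorphic_on UNIV" "v holomorphic_on UNIV"
    "\<And>z. energy u v z = 2 * sqrt (\<rho> (exp z)) * exp (Re z)"
    "L holomorphic_on UNIV" "\<And>z. L z \<in> \<Omega>1" "\<And>z. coord_of ?c (\<pi>1 (L z)) = exp z"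
    "\<And>z. \<not> is_pole g1 (L z) \<Longrightarrow> wronskian u v z = deriv g1 (L z) * \<alpha>1 (L z) * (deriv L z)\<^sup>2"
    "\<And>z. eventually (\<lambda>w. \<not> is_pole g1 (L w)) (at z)"
    by (rule lift[OF e1(1)], assumption, assumption) (rule that)
  obtain u' v' L' where uv': "u' holomorphic_on UNIV" "v' holomorphic_on UNIV"
    "\<And>z. energy u' v' z = 2 * sqrt (\<rho> (exp z)) * exp (Re z)"
    "L' holomorphic_on UNIV" "\<And>z. L' z \<in> \<Omega>2" "\<And>z. coord_of ?c (\<pi>2 (L' z)) = exp z"
    "\<And>z. \<not> is_pole g2 (L' z) \<Longrightarrow> wronskian u' v' z = deriv g2 (L' z) * \<alpha>2 (L' z) * (deriv L' z)\<^sup>2"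
    "\<And>z. eventually (\<lambda>w. \<not> is_pole g2 (L' w)) (at z)"
    by (rule lift[OF e2(1)], assumption, assumption) (rule that)
  have holp: "(\<Phi> \<circ> \<pi>) holomorphic_on \<Omega>" "open \<Omega>" "\<And>z. z \<in> \<Omega> \<Longrightarrow> \<Phi> (\<pi> z) \<noteq> 0"
    if "weierstrass_data S \<Omega> \<pi> g \<alpha>" for \<Omega> \<pi> g \<alpha>
  proof -
    have uc: "universal_cover S \<Omega> \<pi>" using that unfolding weierstrass_data_def by blast
    then have "covering_space \<Omega> \<pi> (pts S)" unfolding universal_cover_def by blast
    then have pi: "\<pi> ` \<Omega> = pts S" by (rule covering_space_imp_surjective)
    have "(coord_of ?c \<circ> \<pi>) holomorphic_on (\<Omega> \<inter> \<pi> -` dom_of ?c)"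
      using uc chart unfolding universal_cover_def by blast
    moreover have "\<Omega> \<inter> \<pi> -` dom_of ?c = \<Omega>" using pi by auto
    ultimately show "(\<Phi> \<circ> \<pi>) holomorphic_on \<Omega>" by simp
    show "open \<Omega>" using uc unfolding universal_cover_def by blast
    show "\<Phi> (\<pi> z) \<noteq> 0" if "z \<in> \<Omega>" for z using im pi that by auto
  qed
  have "(\<exists>s K. \<forall>z. Re (1 * z) \<le> s \<longrightarrow> cmod (wronskian u v z) \<le> K) \<and> (\<exists>z. wronskian u v z \<noteq> 0)"
    by (rule wronskian_at_catenoidal_end[OF uv(1,2,4,5,7,8) _ _ holp(1,2)[OF e1(1)] e1(2-6)])
       (use uv(6) in simp_all)
  then obtain s K z0 where left: "\<And>z. Re z \<le> s \<Longrightarrow> cmod (wronskian u v z) \<le> K" and nz: "wronskian u v z0 \<noteq> 0"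
    by auto
  have hol2: "((\<lambda>p. inverse (\<Phi> p)) \<circ> \<pi>2) holomorphic_on \<Omega>2"
    using holomorphic_on_inverse[OF holp(1)[OF e2(1)]] holp(3)[OF e2(1)] by (simp add: o_def)
  have "(\<exists>s K. \<forall>z. Re (- 1 * z) \<le> s \<longrightarrow> cmod (wronskian u' v' z) \<le> K) \<and> (\<exists>z. wronskian u' v' z \<noteq> 0)"
    by (rule wronskian_at_catenoidal_end[OF uv'(1,2,4,5,7,8) _ _ hol2 holp(2)[OF e2(1)] e2(2-6)])
       (use uv'(6) in \<open>simp_all add: exp_minus\<close>)
  then obtain t K' where right: "\<And>z. - Re z \<le> t \<Longrightarrow> cmod (wronskian u' v' z) \<le> K'"
    by auto
  obtain F where F: "F \<in> borel_measurable borel" "(\<integral>\<^sup>+z. F z \<partial>lborel) < \<infinity>"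
    "\<And>z. z \<noteq> 0 \<Longrightarrow> F z = ennreal (\<bar>gauss_coord (met S ?c) z\<bar> * \<rho> z)"
    by (rule total_curvature_in_chart[OF S fin atl c2 c3 met rho cont], assumption, assumption) (rule that)
  have epos: "energy u v z > 0" for z using rho[of "exp z"] by (simp add: uv(3))
  have curv: "ennreal (4 * (cmod (wronskian u v z))\<^sup>2 / (energy u v z)\<^sup>2) \<le> ennreal (exp (2 * Re z)) * F (exp z)" for z
  proof -
    have "ennreal (exp (2 * Re z)) * F (exp z)
        = ennreal (exp (2 * Re z) * (\<bar>gauss_coord (met S ?c) (exp z)\<bar> * \<rho> (exp z)))"
      using rho[of "exp z"] by (subst F(3)) (simp_all add: ennreal_mult')
    also have "\<dots> = ennreal (4 * (cmod (wronskian u v z))\<^sup>2 / (energy u v z)\<^sup>2)"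
      using gauss_coord_punctured_plane[OF uv(1,2) epos uv(3) met rho, of z] by (simp add: mult_ac)
    finally show ?thesis by simp
  qed
  have l: "cmod (wronskian u v z) \<le> max K K'" if "Re z \<le> s" for z using left[OF that] by simp
  have r: "cmod (wronskian u' v' z) \<le> max K K'" if "Re z \<ge> - t" for z using right[of z] that by simp
  have eq: "energy u' v' z = energy u v z" for z by (simp add: uv(3) uv'(3))
  have per: "energy u v (z + 2 * of_real pi * \<i>) = energy u v z" for z
    unfolding uv(3) by (simp add: exp_add exp_two_pi_i')
  obtain \<mu> a b \<beta> where n: "\<mu> > 0" "a \<ge> 0" "b > 0" "a = 0 \<or> \<mu> \<in> \<nat>"
    "\<And>z. energy u v z = model_energy \<mu> a b (z + \<beta>)"
    by (rule periodic_energy_classification[OF uv(1,2) uv'(1,2) eq per l r nz F(1,2) curv], assumption, assumption) (rule that)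
  obtain m where m: "admissible m" "model_data m = (\<mu>, a, b)" using model_data_exists[OF n(1-4)] by blast
  \<comment> \<open>The translation by \<beta> in the coordinate log is multiplication by exp
    \<beta> on the punctured plane.\<close>
  have "isometric S (conformal_plane_domain (- {0}) (model_density m))"
  proof (rule isometric_conformal_plane_domain[OF S atl c2 c3 met])
    show "exp \<beta> \<noteq> 0" by simp
    fix x :: complex assume x: "x \<noteq> 0"
    let ?z = "Ln x"
    have "\<rho> x * (exp (Re ?z))\<^sup>2 = (energy u v ?z)\<^sup>2 / 4"
      using x rho[OF x] by (simp add: uv(3) power_mult_distrib)
    also have "\<dots> = model_density m (exp (?z + \<beta>)) * (exp (Re (?z + \<beta>)))\<^sup>2"
      unfolding n(5) model_density_exp[OF m] ..
    also have "\<dots> = model_density m (exp \<beta> * x) * (cmod (exp \<beta>))\<^sup>2 * (exp (Re ?z))\<^sup>2"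
      using x by (simp add: exp_add power_mult_distrib mult_ac)
    finally show "\<rho> x = model_density m (exp \<beta> * x) * (cmod (exp \<beta>))\<^sup>2" by simp
  qed
  then show ?thesis using that m(1) by (simp add: model_surface_def)
qed

theorem theorem5p2:
  shows "(\<forall>(S :: 'a::{t2_space,second_countable_topology} surface) \<Phi>.
            ricci_surface S \<and> nonpositively_curved S \<and> complete_surface S \<and>
            biholomorphic_onto S (pts S) \<Phi> (- {0}) \<and>
            finite_total_curvature S \<and>
            catenoidal_end S \<Phi> \<and> catenoidal_end S (\<lambda>p. inverse (\<Phi> p))
            \<longrightarrow> (\<exists>m. admissible m \<and> isometric S (model_surface m)))
       \<and> (\<forall>m m'. admissible m \<and> admissible m' \<and> m \<noteq> m'
            \<longrightarrow> \<not> isometric (model_surface m) (model_surface m'))"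
proof (intro conjI allI impI)
  fix S :: "'a surface" and \<Phi>
  assume "ricci_surface S \<and> nonpositively_curved S \<and> complete_surface S \<and>
      biholomorphic_onto S (pts S) \<Phi> (- {0}) \<and> finite_total_curvature S \<and>
      catenoidal_end S \<Phi> \<and> catenoidal_end S (\<lambda>p. inverse (\<Phi> p))"
  then show "\<exists>m. admissible m \<and> isometric S (model_surface m)"
    using catenoidal_annulus_isometric_to_model[of S \<Phi>] unfolding ricci_surface_def by metis
next
  fix m m' assume "admissible m \<and> admissible m' \<and> m \<noteq> m'"
  then show "\<not> isometric (model_surface m) (model_surface m')"
    using isometric_models_imp_eq by blast
qed

end
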